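(* Let $f_1$ and $f_2$ be two normalized eigenforms of level $1$ (of weights $k_1$ and $k_2$), both having rational integral Fourier coefficients, and let $\delta=\delta_{f_1,f_2}$ be the function defined in the context. Then $m \mapsto \delta(m)$ is multiplicative; i.e., if $m=m_1 m_2$ with positive integers $m_1,m_2$ and $\gcd(m_1, m_2)=1$, then $$\delta(m)=\delta(m_1)\delta(m_2).$$
   Context: A normalized eigenform of level $1$ is a holomorphic cusp form $f=\sum_{n\ge1}a(n)q^n$ for $\mathrm{SL}_2(\mathbb Z)$ that is an eigenfunction of all Hecke operators, with $a(1)=1$; write $a_i(n)$ for the coefficients of $f_i$. Let $G_{\mathbb Q}=\mathrm{Gal}(\overline{\mathbb Q}/\mathbb Q)$. By Deligne, for $i=1,2$ and every prime $\ell$ there is a continuous odd irreducible representation $\rho_{f_i,\ell}:G_{\mathbb Q}\to \mathrm{GL}_2(\mathbb Z_\ell)$, unramified at all primes $p\nmid\ell$ (the level being $1$), with $\mathrm{tr}\,\rho_{f_i,\ell}(\mathrm{Frob}_p)=a_i(p)$ and $\det\rho_{f_i,\ell}(\mathrm{Frob}_p)=p^{k_i-1}$ for such $p$. For an integer $m=\prod_j \ell_j^{e_j}>1$, let $\bar\rho_{f_i,m}:G_{\mathbb Q}\to\mathrm{GL}_2(\mathbb Z/m\mathbb Z)\cong\prod_j \mathrm{GL}_2(\mathbb Z/\ell_j^{e_j}\mathbb Z)$ be obtained by reducing each $\rho_{f_i,\ell_j}$ modulo $\ell_j^{e_j}$. Let $\mathscr A_m$ be the image of $\sigma\mapsto(\bar\rho_{f_1,m}(\sigma),\bar\rho_{f_2,m}(\sigma))$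 in $\mathrm{GL}_2(\mathbb Z/m\mathbb Z)^2$, and $\mathscr C_m=\{(A,B)\in\mathscr A_m:\mathrm{tr}(A)=\mathrm{tr}(B)=0\}$. Put $\delta(m)=|\mathscr C_m|/|\mathscr A_m|$ for $m>1$ and $\delta(1)=1$. *)

theory Defs
  imports
    "HOL-Complex_Analysis.Complex_Analysis"
    "HOL-Algebra.Algebra"
    "HOL-Algebra.Algebraic_Closure_Type"
    "HOL-Number_Theory.Residues"
begin

hide_const (open) Divisibility.prime

section \<open>Eigenforms of level one\<close>

definition upper_halfplane :: "complex set" where
  "upper_halfplane = {z. Im z > 0}"

definition has_q_expansion :: "(complex \<Rightarrow> complex) \<Rightarrow> (nat \<Rightarrow> complex) \<Rightarrow> bool" where
  "has_q_expansion f a \<longleftrightarrow>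
     (\<forall>z\<in>upper_halfplane. (\<lambda>n. a n * exp (2 * of_real pi * \<i> * z) ^ n) sums f z)"

text \<open>Only the values of a form on the upper half-plane are meaningful.\<close>

definition cusp_form :: "nat \<Rightarrow> (complex \<Rightarrow> complex) \<Rightarrow> bool" where
  "cusp_form k f \<longleftrightarrow>
     f holomorphic_on upper_halfplane \<and>
     (\<forall>a b c d :: int. a * d - b * c = 1 \<longrightarrow>
        (\<forall>z\<in>upper_halfplane.
           f ((of_int a * z + of_int b) / (of_int c * z + of_int d)) =
             (of_int c * z + of_int d) ^ k * f z)) \<and>
     (\<exists>a. has_q_expansion f a \<and> a 0 = 0)"

definition fourier_coeff :: "(complex \<Rightarrow> complex) \<Rightarrow> nat \<Rightarrow> complex" where
  "fourier_coeff f = (THE a. has_q_expansion f a)"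

text \<open>
  The Hecke operator \<open>(T\<^sub>n f)(z) = n\<^sup>k\<^sup>-\<^sup>1 \<Sum> d\<^sup>-\<^sup>k f ((e z + b) / d)\<close>, the sum being over
  \<open>e d = n\<close> and \<open>0 \<le> b < d\<close>.
\<close>

definition hecke :: "nat \<Rightarrow> nat \<Rightarrow> (complex \<Rightarrow> complex) \<Rightarrow> complex \<Rightarrow> complex" where
  "hecke k n f z =
     of_nat n powi (int k - 1) *
     (\<Sum>d | d dvd n. \<Sum>b<d. f ((of_nat (n div d) * z + of_nat b) / of_nat d) / of_nat d ^ k)"

definition normalized_eigenform :: "nat \<Rightarrow> (complex \<Rightarrow> complex) \<Rightarrow> bool" where
  "normalized_eigenform k f \<longleftrightarrow>
     cusp_form k f \<and>
     (\<forall>n\<ge>1. \<exists>ev. \<forall>z\<in>upper_halfplane. hecke k n f z = ev * f z) \<and>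
     fourier_coeff f 1 = 1"

section \<open>The absolute Galois group of the rationals\<close>

definition Qbar :: "complex ring" where
  "Qbar = ring_of_type_algebra \<lparr>carrier := {x. algebraic x}\<rparr>"

definition Zbar :: "complex ring" where
  "Zbar = ring_of_type_algebra \<lparr>carrier := {x. algebraic_int x}\<rparr>"

definition GalQ :: "(complex \<Rightarrow> complex) monoid" where
  "GalQ = BijGroup (carrier Qbar) \<lparr>carrier := ring_iso Qbar Qbar \<inter> Bij (carrier Qbar)\<rparr>"

definition number_field :: "complex set \<Rightarrow> bool" where
  "number_field L \<longleftrightarrow> subfield L (ring_of_type_algebra :: complex ring) \<and>
     ring.finite_dimension (ring_of_type_algebra :: complex ring) \<rat> L"

text \<open>The basic open sets are the cosets of the subgroups fixing a number field pointwise.\<close>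

definition krull_topology :: "(complex \<Rightarrow> complex) topology" where
  "krull_topology = topology_generated_by
     {{\<tau> \<in> carrier GalQ. \<forall>x\<in>L. \<tau> x = \<sigma> x} | \<sigma> L. \<sigma> \<in> carrier GalQ \<and> number_field L}"

definition complex_conjugation :: "complex \<Rightarrow> complex" where
  "complex_conjugation = restrict cnj (carrier Qbar)"

definition primes_above :: "nat \<Rightarrow> complex set set" where
  "primes_above p = {P. primeideal P Zbar \<and> of_nat p \<in> P}"

definition decomposition_group :: "complex set \<Rightarrow> (complex \<Rightarrow> complex) set" where
  "decomposition_group P = {\<sigma> \<in> carrier GalQ. \<sigma> ` P = P}"

definition inertia_group :: "complex set \<Rightarrow> (complex \<Rightarrow> complex) set" where
  "inertia_group P = {\<sigma> \<in> decomposition_group P. \<forall>x\<in>carrier Zbar. \<sigma> x - x \<in> P}"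

text \<open>
  All arithmetic Frobenius elements at \<open>p\<close>, for all primes above \<open>p\<close>: a union of cosets of
  inertia groups, stable under conjugation.
\<close>

definition frobenius_elements :: "nat \<Rightarrow> (complex \<Rightarrow> complex) set" where
  "frobenius_elements p =
     (\<Union>P\<in>primes_above p. {\<sigma> \<in> decomposition_group P. \<forall>x\<in>carrier Zbar. \<sigma> x - x ^ p \<in> P})"

section \<open>Two by two matrices over a ring\<close>

text \<open>A matrix is the pair of its rows.\<close>

type_synonym 'a mat2 = "('a \<times> 'a) \<times> ('a \<times> 'a)"

fun map_mat2 :: "('a \<Rightarrow> 'b) \<Rightarrow> 'a mat2 \<Rightarrow> 'b mat2" where
  "map_mat2 h ((a, b), (c, d)) = ((h a, h b), (h c, h d))"

fun mat2_mult :: "('a, 'm) ring_scheme \<Rightarrow> 'a mat2 \<Rightarrow> 'a mat2 \<Rightarrow> 'a mat2" where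
  "mat2_mult R ((a, b), (c, d)) ((a', b'), (c', d')) =
     ((a \<otimes>\<^bsub>R\<^esub> a' \<oplus>\<^bsub>R\<^esub> b \<otimes>\<^bsub>R\<^esub> c', a \<otimes>\<^bsub>R\<^esub> b' \<oplus>\<^bsub>R\<^esub> b \<otimes>\<^bsub>R\<^esub> d'),
      (c \<otimes>\<^bsub>R\<^esub> a' \<oplus>\<^bsub>R\<^esub> d \<otimes>\<^bsub>R\<^esub> c', c \<otimes>\<^bsub>R\<^esub> b' \<oplus>\<^bsub>R\<^esub> d \<otimes>\<^bsub>R\<^esub> d'))"

fun mat2_vec :: "('a, 'm) ring_scheme \<Rightarrow> 'a mat2 \<Rightarrow> 'a \<times> 'a \<Rightarrow> 'a \<times> 'a" where
  "mat2_vec R ((a, b), (c, d)) (x, y) =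
     (a \<otimes>\<^bsub>R\<^esub> x \<oplus>\<^bsub>R\<^esub> b \<otimes>\<^bsub>R\<^esub> y, c \<otimes>\<^bsub>R\<^esub> x \<oplus>\<^bsub>R\<^esub> d \<otimes>\<^bsub>R\<^esub> y)"

fun mat2_trace :: "('a, 'm) ring_scheme \<Rightarrow> 'a mat2 \<Rightarrow> 'a" where
  "mat2_trace R ((a, b), (c, d)) = a \<oplus>\<^bsub>R\<^esub> d"

fun mat2_det :: "('a, 'm) ring_scheme \<Rightarrow> 'a mat2 \<Rightarrow> 'a" where
  "mat2_det R ((a, b), (c, d)) = a \<otimes>\<^bsub>R\<^esub> d \<ominus>\<^bsub>R\<^esub> b \<otimes>\<^bsub>R\<^esub> c"

definition M2 :: "('a, 'm) ring_scheme \<Rightarrow> 'a mat2 monoid" where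
  "M2 R = \<lparr>carrier = (carrier R \<times> carrier R) \<times> (carrier R \<times> carrier R),
           monoid.mult = mat2_mult R,
           monoid.one = ((\<one>\<^bsub>R\<^esub>, \<zero>\<^bsub>R\<^esub>), (\<zero>\<^bsub>R\<^esub>, \<one>\<^bsub>R\<^esub>))\<rparr>"

definition GL2 :: "('a, 'm) ring_scheme \<Rightarrow> 'a mat2 monoid" where
  "GL2 R = units_of (M2 R)"

definition subspace2 :: "('a, 'm) ring_scheme \<Rightarrow> ('a \<times> 'a) set \<Rightarrow> bool" where
  "subspace2 K U \<longleftrightarrow>
     U \<subseteq> carrier K \<times> carrier K \<and> (\<zero>\<^bsub>K\<^esub>, \<zero>\<^bsub>K\<^esub>) \<in> U \<and>
     (\<forall>(x, y)\<in>U. \<forall>(x', y')\<in>U. (x \<oplus>\<^bsub>K\<^esub> x', y \<oplus>\<^bsub>K\<^esub> y') \<in> U) \<and>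
     (\<forall>c\<in>carrier K. \<forall>(x, y)\<in>U. (c \<otimes>\<^bsub>K\<^esub> x, c \<otimes>\<^bsub>K\<^esub> y) \<in> U)"

definition irreducible_rep2 ::
    "('g, 'n) monoid_scheme \<Rightarrow> ('a, 'm) ring_scheme \<Rightarrow> ('g \<Rightarrow> 'a mat2) \<Rightarrow> bool" where
  "irreducible_rep2 G K r \<longleftrightarrow>
     (\<forall>U. subspace2 K U \<and> (\<forall>g\<in>carrier G. \<forall>v\<in>U. mat2_vec K (r g) v \<in> U) \<longrightarrow>
        U = {(\<zero>\<^bsub>K\<^esub>, \<zero>\<^bsub>K\<^esub>)} \<or> U = carrier K \<times> carrier K)"

section \<open>The field of fractions of a domain\<close>

definition frac_rel :: "('a, 'm) ring_scheme \<Rightarrow> (('a \<times> 'a) \<times> ('a \<times> 'a)) set" where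
  "frac_rel R = {((a, b), (c, d)) | a b c d.
     a \<in> carrier R \<and> c \<in> carrier R \<and> b \<in> carrier R - {\<zero>\<^bsub>R\<^esub>} \<and> d \<in> carrier R - {\<zero>\<^bsub>R\<^esub>} \<and>
     a \<otimes>\<^bsub>R\<^esub> d = c \<otimes>\<^bsub>R\<^esub> b}"

definition fraction :: "('a, 'm) ring_scheme \<Rightarrow> 'a \<Rightarrow> 'a \<Rightarrow> ('a \<times> 'a) set" where
  "fraction R a b = frac_rel R `` {(a, b)}"

definition fraction_field :: "('a, 'm) ring_scheme \<Rightarrow> ('a \<times> 'a) set ring" where
  "fraction_field R =
     \<lparr>carrier = (carrier R \<times> (carrier R - {\<zero>\<^bsub>R\<^esub>})) // frac_rel R,
      monoid.mult = \<lambda>u v. \<Union>(a, b)\<in>u. \<Union>(c, d)\<in>v. fraction R (a \<otimes>\<^bsub>R\<^esub> c) (b \<otimes>\<^bsub>R\<^esub> d),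
      monoid.one = fraction R \<one>\<^bsub>R\<^esub> \<one>\<^bsub>R\<^esub>,
      ring.zero = fraction R \<zero>\<^bsub>R\<^esub> \<one>\<^bsub>R\<^esub>,
      ring.add = \<lambda>u v. \<Union>(a, b)\<in>u. \<Union>(c, d)\<in>v.
              fraction R (a \<otimes>\<^bsub>R\<^esub> d \<oplus>\<^bsub>R\<^esub> c \<otimes>\<^bsub>R\<^esub> b) (b \<otimes>\<^bsub>R\<^esub> d)\<rparr>"

section \<open>The \<open>\<ell>\<close>-adic integers\<close>

text \<open>
  The inverse limit of the rings \<open>\<int>/\<ell>\<^sup>n\<close> for \<open>n \<ge> 0\<close>; the component \<open>x n\<close> of \<open>x\<close> is the residue
  of \<open>x\<close> modulo \<open>\<ell>\<^sup>n\<close>.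
\<close>

definition Zl :: "nat \<Rightarrow> (nat \<Rightarrow> int) ring" where
  "Zl l = \<lparr>carrier = {x. \<forall>n. x n \<in> {0..<int l ^ n} \<and> x (Suc n) mod int l ^ n = x n},
           monoid.mult = \<lambda>x y n. (x n * y n) mod int l ^ n,
           monoid.one = \<lambda>n. 1 mod int l ^ n,
           ring.zero = \<lambda>n. 0,
           ring.add = \<lambda>x y n. (x n + y n) mod int l ^ n\<rparr>"

definition Zl_of_int :: "nat \<Rightarrow> int \<Rightarrow> nat \<Rightarrow> int" where
  "Zl_of_int l t = (\<lambda>n. t mod int l ^ n)"

definition Zl_topology :: "nat \<Rightarrow> (nat \<Rightarrow> int) topology" where
  "Zl_topology l =
     subtopology (product_topology (\<lambda>n. discrete_topology {0..<int l ^ n}) UNIV) (carrier (Zl l))"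

text \<open>
  Inversion of matrices is continuous over \<open>\<int>\<^sub>\<ell>\<close>, so the topology of the group of units is the one
  induced from the space of all matrices.
\<close>

definition GL2_Zl_topology :: "nat \<Rightarrow> (nat \<Rightarrow> int) mat2 topology" where
  "GL2_Zl_topology l =
     subtopology
       (prod_topology (prod_topology (Zl_topology l) (Zl_topology l))
                      (prod_topology (Zl_topology l) (Zl_topology l)))
       (carrier (GL2 (Zl l)))"

section \<open>The representations attached to an eigenform\<close>

text \<open>
  The properties of the \<open>\<ell>\<close>-adic representation attached by Deligne to an eigenform of level one
  and weight \<open>k\<close> with Fourier coefficients \<open>a n\<close>.  Irreducibility refers to the induced
  representation on the plane over \<open>\<rat>\<^sub>\<ell>\<close>.
\<close>

definition deligne_rep ::
    "(nat \<Rightarrow> int) \<Rightarrow> nat \<Rightarrow> nat \<Rightarrow> ((complex \<Rightarrow> complex) \<Rightarrow> (nat \<Rightarrow> int) mat2) \<Rightarrow> bool" where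
  "deligne_rep a k l \<rho> \<longleftrightarrow>
     \<rho> \<in> hom GalQ (GL2 (Zl l)) \<and>
     continuous_map krull_topology (GL2_Zl_topology l) \<rho> \<and>
     mat2_det (Zl l) (\<rho> complex_conjugation) = \<ominus>\<^bsub>Zl l\<^esub> \<one>\<^bsub>Zl l\<^esub> \<and>
     irreducible_rep2 GalQ (fraction_field (Zl l))
       (\<lambda>\<sigma>. map_mat2 (\<lambda>x. fraction (Zl l) x \<one>\<^bsub>Zl l\<^esub>) (\<rho> \<sigma>)) \<and>
     (\<forall>p. prime p \<and> p \<noteq> l \<longrightarrow>
        (\<forall>P\<in>primes_above p. \<forall>\<sigma>\<in>inertia_group P. \<rho> \<sigma> = \<one>\<^bsub>GL2 (Zl l)\<^esub>) \<and>
        (\<forall>\<sigma>\<in>frobenius_elements p.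
           mat2_trace (Zl l) (\<rho> \<sigma>) = Zl_of_int l (a p) \<and>
           mat2_det (Zl l) (\<rho> \<sigma>) = Zl_of_int l (int p ^ (k - 1))))"

section \<open>The density\<close>

text \<open>
  Given \<open>x \<ell> \<in> \<int>\<^sub>\<ell>\<close> for each prime \<open>\<ell>\<close> dividing \<open>m\<close>, the element of \<open>\<int>/m\<close> corresponding, under the
  Chinese remainder isomorphism, to the residues of \<open>x \<ell>\<close> modulo \<open>\<ell>\<^sup>e\<close>, where \<open>\<ell>\<^sup>e\<close> exactly
  divides \<open>m\<close>.
\<close>

definition crt_residue :: "nat \<Rightarrow> (nat \<Rightarrow> nat \<Rightarrow> int) \<Rightarrow> int" where
  "crt_residue m x =
     (THE r. r \<in> carrier (residue_ring (int m)) \<and>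
             (\<forall>l\<in>prime_factors m. r mod int l ^ multiplicity l m = x l (multiplicity l m)))"

definition mod_rep ::
    "(nat \<Rightarrow> (complex \<Rightarrow> complex) \<Rightarrow> (nat \<Rightarrow> int) mat2) \<Rightarrow> nat \<Rightarrow> (complex \<Rightarrow> complex) \<Rightarrow> int mat2" where
  "mod_rep \<rho> m \<sigma> =
     ((crt_residue m (\<lambda>l. fst (fst (\<rho> l \<sigma>))), crt_residue m (\<lambda>l. snd (fst (\<rho> l \<sigma>)))),
      (crt_residue m (\<lambda>l. fst (snd (\<rho> l \<sigma>))), crt_residue m (\<lambda>l. snd (snd (\<rho> l \<sigma>)))))"

definition image_pairs ::
    "(nat \<Rightarrow> (complex \<Rightarrow> complex) \<Rightarrow> (nat \<Rightarrow> int) mat2) \<Rightarrow>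
     (nat \<Rightarrow> (complex \<Rightarrow> complex) \<Rightarrow> (nat \<Rightarrow> int) mat2) \<Rightarrow> nat \<Rightarrow> (int mat2 \<times> int mat2) set" where
  "image_pairs \<rho>1 \<rho>2 m = (\<lambda>\<sigma>. (mod_rep \<rho>1 m \<sigma>, mod_rep \<rho>2 m \<sigma>)) ` carrier GalQ"

definition traceless_pairs ::
    "(nat \<Rightarrow> (complex \<Rightarrow> complex) \<Rightarrow> (nat \<Rightarrow> int) mat2) \<Rightarrow>
     (nat \<Rightarrow> (complex \<Rightarrow> complex) \<Rightarrow> (nat \<Rightarrow> int) mat2) \<Rightarrow> nat \<Rightarrow> (int mat2 \<times> int mat2) set" where
  "traceless_pairs \<rho>1 \<rho>2 m =
     {(A, B) \<in> image_pairs \<rho>1 \<rho>2 m.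
        mat2_trace (residue_ring (int m)) A = 0 \<and> mat2_trace (residue_ring (int m)) B = 0}"

definition delta ::
    "(nat \<Rightarrow> (complex \<Rightarrow> complex) \<Rightarrow> (nat \<Rightarrow> int) mat2) \<Rightarrow>
     (nat \<Rightarrow> (complex \<Rightarrow> complex) \<Rightarrow> (nat \<Rightarrow> int) mat2) \<Rightarrow> nat \<Rightarrow> real" where
  "delta \<rho>1 \<rho>2 m =
     (if m = 1 then 1
      else real (card (traceless_pairs \<rho>1 \<rho>2 m)) / real (card (image_pairs \<rho>1 \<rho>2 m)))"

end

theory Submission
  imports Defs "Jordan_Normal_Form.Char_Poly" "HOL-Library.Diagonal_Subsequence"
begin

text \<open>
  The Galois image modulo \<open>m\<^sub>1m\<^sub>2\<close> embeds into the product of the images modulo \<open>m\<^sub>1\<close> and \<open>m\<^sub>2\<close>, and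
  the trace conditions split by the Chinese remainder theorem; so it suffices that this embedding
  is onto.  Let \<open>N\<^sub>i\<close> be the kernel of the reduction modulo \<open>m\<^sub>i\<close> and \<open>N = N\<^sub>1N\<^sub>2\<close>.  The reduction modulo
  \<open>m\<^sub>i\<close> is unramified outside \<open>m\<^sub>i\<close>, so the open subgroup \<open>N\<close> contains every inertia group, and by
  Minkowski it is everything.

  Minkowski's theorem is obtained without different and discriminant ideals.  Let \<open>O\<close> be the ring
  of algebraic integers fixed by \<open>N\<close>.  If \<open>\<sigma>\<close> is not in \<open>N\<close>, then the elements \<open>y - \<sigma> y\<close> with \<open>y \<in> O\<close>
  generate the unit ideal of the ring of all algebraic integers: otherwise \<open>\<sigma>\<close> acts trivially on \<open>O\<close>
  modulo a prime, hence lies in \<open>N\<close> times an inertia group.  Multiplying the resulting relations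
  gives \<open>x\<^sub>j\<close> and \<open>y\<^sub>j \<in> O\<close> with \<open>\<Sum>\<^sub>j x\<^sub>j \<sigma> y\<^sub>j\<close> equal to 1 for \<open>\<sigma> \<in> N\<close> and to 0 for representatives
  of the other cosets; this forces the discriminant of an integral basis of \<open>O\<close> to be a unit.
  Minkowski's theorem on linear forms then yields a non-zero element of \<open>O\<close> of norm less than 1 in
  absolute value if \<open>N\<close> has index at least 2.
\<close>

hide_const (open) Determinants.det Finite_Cartesian_Product.mat Finite_Cartesian_Product.vec
hide_const (open) Coset.order Module.module.smult Divisibility.prime Polynomials.degree Polynomials.lead_coeff up_ring.coeff up_ring.monom
unbundle no vec_syntax

section \<open>Minkowski's theorem on linear forms\<close>

text \<open>The ring of all algebraic integers is not Noetherian, and \<open>N\<close> is infinite.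
  Still that ring is the convenient place to work: one prime ideal of it carries both the inertia
  group and the congruences on \<open>fixed_ints N\<close>, so neither primes of number fields nor
  ramification indices appear. The price is paid in passing from a congruence on
  \<open>fixed_ints N\<close> to an element of \<open>N\<close>: this takes a polynomial whose roots
  run over a finite orbit, Gauss's lemma modulo the prime, and a compactness argument over the
  countable field \<open>QQbar\<close>. The list of pairs \<open>(x, y)\<close> plays the part of
  the separability idempotent of an unramified algebra. Expanding the \<open>y\<close> in an
  integral basis turns it into an inverse, with integral entries, of the transposed matrix of
  conjugates; so the discriminant is an integer with an integral inverse. The determinant of the
  conjugates then has modulus exactly 1, and the theorem on linear forms is needed in its boundary
  case, where all bounds are 1 and only one inequality may fail to be strict.\<close>

lemma sum_insert_index:
  assumes "j < Suc n"
  shows "(\<Sum>i<Suc n. f i) = f j + (\<Sum>i<n. f (insert_index j i))"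
proof -
  have "(\<Sum>i<Suc n. f i) = f j + (\<Sum>i\<in>{0..<Suc n} - {j}. f i)"
    using assms by (subst sum.remove[of _ j]) (auto simp: lessThan_atLeast0)
  also have "(\<Sum>i\<in>{0..<Suc n} - {j}. f i) = (\<Sum>i\<in>{0..<n}. f (insert_index j i))"
    unfolding insert_index_image[OF assms, symmetric]
    by (subst sum.reindex) (auto simp: insert_index_inj_on)
  finally show ?thesis by (simp add: lessThan_atLeast0)
qed

text \<open>Euclid's algorithm on the first row, one column addition at a time, until at most one
  entry is left. The last conjunct records that the columns of \<open>B'\<close> lie in the lattice
  spanned by the columns of \<open>B\<close>.\<close>

lemma column_reduction:
  fixes B :: "int mat"
  assumes "B \<in> carrier_mat (Suc n) (Suc n)" "det B \<noteq> 0"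
  shows "\<exists>B' j0. B' \<in> carrier_mat (Suc n) (Suc n) \<and> det B' = det B \<and> j0 < Suc n \<and>
    (\<forall>j<Suc n. j \<noteq> j0 \<longrightarrow> B' $$ (0, j) = 0) \<and>
    (\<forall>c. \<exists>c'. \<forall>i<Suc n. (\<Sum>j<Suc n. B' $$ (i, j) * c j) = (\<Sum>j<Suc n. B $$ (i, j) * c' j))"
  using assms
proof (induction "nat (\<Sum>j<Suc n. \<bar>B $$ (0, j)\<bar>)" arbitrary: B rule: less_induct)
  case less
  note B = less.prems(1)
  show ?case
  proof (cases "\<exists>k l. k < Suc n \<and> l < Suc n \<and> k \<noteq> l \<and> B $$ (0, k) \<noteq> 0 \<and> B $$ (0, l) \<noteq> 0 \<and>
       \<bar>B $$ (0, l)\<bar> \<le> \<bar>B $$ (0, k)\<bar>")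
    case True
    then obtain k l where kl: "k < Suc n" "l < Suc n" "k \<noteq> l" "B $$ (0, k) \<noteq> 0" "B $$ (0, l) \<noteq> 0"
       "\<bar>B $$ (0, l)\<bar> \<le> \<bar>B $$ (0, k)\<bar>" by blast
    \<comment> \<open>This sign makes \<open>s * B $$ (0, l)\<close> opposite to
      \<open>B $$ (0, k)\<close>. Being nonzero and no larger in absolute value, it shrinks entry
      \<open>k\<close>, and with it the sum of absolute values on which the induction runs.\<close>
    define s where "s = - (sgn (B $$ (0, k)) * sgn (B $$ (0, l)))"
    define A where "A = addcol s k l B"
    have A: "A \<in> carrier_mat (Suc n) (Suc n)" using B by (auto simp: A_def)
    have detA: "det A = det B" unfolding A_def by (rule det_addcol[OF kl(2,3) B])
    have ent: "A $$ (i, j) = (if j = k then s * B $$ (i, l) + B $$ (i, j) else B $$ (i, j))"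
      if "i < Suc n" "j < Suc n" for i j
      using that B by (auto simp: A_def)
    have "\<bar>s * B $$ (0, l) + B $$ (0, k)\<bar> < \<bar>B $$ (0, k)\<bar>"
      using kl(4-6) by (auto simp: s_def sgn_if abs_if split: if_splits)
    hence "(\<Sum>j<Suc n. \<bar>A $$ (0, j)\<bar>) < (\<Sum>j<Suc n. \<bar>B $$ (0, j)\<bar>)"
      using kl(1) by (intro sum_strict_mono_ex1) (auto simp: ent)
    hence "nat (\<Sum>j<Suc n. \<bar>A $$ (0, j)\<bar>) < nat (\<Sum>j<Suc n. \<bar>B $$ (0, j)\<bar>)"
      by (subst nat_less_eq_zless) (auto intro: sum_nonneg simp del: sum.lessThan_Suc)
    from less.hyps[OF this A] detA less.prems(2) obtain B' j0 where B':
      "B' \<in> carrier_mat (Suc n) (Suc n)" "det B' = det B" "j0 < Suc n"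
      "\<forall>j<Suc n. j \<noteq> j0 \<longrightarrow> B' $$ (0, j) = 0"
      "\<forall>c. \<exists>c'. \<forall>i<Suc n. (\<Sum>j<Suc n. B' $$ (i, j) * c j) = (\<Sum>j<Suc n. A $$ (i, j) * c' j)"
      by auto
    have *: "\<exists>c'. \<forall>i<Suc n. (\<Sum>j<Suc n. A $$ (i, j) * c j) = (\<Sum>j<Suc n. B $$ (i, j) * c' j)" for c
    proof (intro exI allI impI)
      fix i assume i: "i < Suc n"
      have "(\<Sum>j<Suc n. A $$ (i, j) * c j) =
        (\<Sum>j<Suc n. B $$ (i, j) * c j + (if j = k then s * B $$ (i, l) * c k else 0))"
        using i by (intro sum.cong) (auto simp: ent algebra_simps)
      also have "\<dots> = (\<Sum>j<Suc n. B $$ (i, j) * c j) + s * B $$ (i, l) * c k"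
        using kl(1) by (subst sum.distrib) (simp del: sum.lessThan_Suc)
      also have "\<dots> = (\<Sum>j<Suc n. B $$ (i, j) * c j) + (\<Sum>j<Suc n. if j = l then s * B $$ (i, l) * c k else 0)"
        using kl(2) by (simp del: sum.lessThan_Suc)
      also have "\<dots> = (\<Sum>j<Suc n. B $$ (i, j) * (c j + (if j = l then s * c k else 0)))"
        by (subst sum.distrib[symmetric], intro sum.cong) (auto simp: algebra_simps)
      finally show "(\<Sum>j<Suc n. A $$ (i, j) * c j) =
         (\<Sum>j<Suc n. B $$ (i, j) * (c j + (if j = l then s * c k else 0)))" .
    qed
    have "\<forall>c. \<exists>c'. \<forall>i<Suc n. (\<Sum>j<Suc n. B' $$ (i, j) * c j) = (\<Sum>j<Suc n. B $$ (i, j) * c' j)"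
    proof
      fix c
      obtain c1 where "\<forall>i<Suc n. (\<Sum>j<Suc n. B' $$ (i, j) * c j) = (\<Sum>j<Suc n. A $$ (i, j) * c1 j)"
        using B'(5) by blast
      moreover obtain c2 where "\<forall>i<Suc n. (\<Sum>j<Suc n. A $$ (i, j) * c1 j) = (\<Sum>j<Suc n. B $$ (i, j) * c2 j)"
        using * by blast
      ultimately show "\<exists>c'. \<forall>i<Suc n. (\<Sum>j<Suc n. B' $$ (i, j) * c j) = (\<Sum>j<Suc n. B $$ (i, j) * c' j)"
        by (intro exI[of _ c2]) (simp del: sum.lessThan_Suc)
    qed
    with B'(1-4) show ?thesis by blast
  next
    case False
    \<comment> \<open>Two nonzero entries of the first row would be comparable in absolute value,
      which this case excludes.\<close>
    have "\<exists>j0<Suc n. \<forall>j<Suc n. j \<noteq> j0 \<longrightarrow> B $$ (0, j) = 0"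
    proof (cases "\<exists>j0<Suc n. B $$ (0, j0) \<noteq> 0")
      case True
      then obtain j0 where "j0 < Suc n" "B $$ (0, j0) \<noteq> 0" by blast
      with False show ?thesis by (metis linear)
    qed auto
    with B show ?thesis by blast
  qed
qed

text \<open>After column reduction the first row has a single pivot \<open>t\<close>, so a vector
  modulo the column lattice is coded in mixed radix: first a digit for its first coordinate modulo
  \<open>t\<close>, then the code of the other coordinates modulo the complementary minor. This
  bounds the index of the lattice, which is what the pigeonhole argument uses.\<close>

lemma residue_code:
  fixes B :: "int mat"
  assumes "B \<in> carrier_mat n n" "det B \<noteq> 0"
  shows "\<exists>\<kappa> :: (nat \<Rightarrow> int) \<Rightarrow> int. (\<forall>u. 0 \<le> \<kappa> u \<and> \<kappa> u < \<bar>det B\<bar>) \<and>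
    (\<forall>u v. \<kappa> u = \<kappa> v \<longrightarrow> (\<exists>c. \<forall>i<n. u i - v i = (\<Sum>j<n. B $$ (i, j) * c j)))"
  using assms
proof (induction n arbitrary: B)
  case 0
  then show ?case by (intro exI[of _ "\<lambda>_. 0"]) simp
next
  case (Suc n)
  from column_reduction[OF Suc.prems] obtain B' j0 where B':
      "B' \<in> carrier_mat (Suc n) (Suc n)" and detB': "det B' = det B" and j0: "j0 < Suc n" and
      z: "\<And>j. j<Suc n \<Longrightarrow> j \<noteq> j0 \<Longrightarrow> B' $$ (0, j) = 0" and
      tr: "\<And>c. \<exists>c'. \<forall>i<Suc n. (\<Sum>j<Suc n. B' $$ (i, j) * c j) = (\<Sum>j<Suc n. B $$ (i, j) * c' j)"
    by blast
  define t where "t = B' $$ (0, j0)"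
  define D where "D = mat_delete B' 0 j0"
  have D: "D \<in> carrier_mat n n" using mat_delete_carrier[OF B'] by (simp add: D_def)
  have "det B' = t * cofactor B' 0 j0"
    unfolding laplace_expansion_row[OF B' zero_less_Suc] sum_insert_index[OF j0] t_def
    using j0 by (auto simp: z insert_index_def)
  also have "\<dots> = t * ((-1) ^ j0 * det D)" by (simp add: cofactor_def D_def)
  finally have det: "\<bar>det B\<bar> = \<bar>t\<bar> * \<bar>det D\<bar>" by (simp add: detB' abs_mult power_abs)
  with Suc.prems(2) have nz: "t \<noteq> 0" "det D \<noteq> 0" by auto
  from Suc.IH[OF D nz(2)] obtain \<kappa> where
    k': "\<forall>u. 0 \<le> \<kappa> u \<and> \<kappa> u < \<bar>det D\<bar>" and
    kc': "\<forall>u v. \<kappa> u = \<kappa> v \<longrightarrow> (\<exists>c. \<forall>i<n. u i - v i = (\<Sum>j<n. D $$ (i, j) * c j))"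
    by (elim exE conjE) (rule that)
  have k: "0 \<le> \<kappa> u" "\<kappa> u < \<bar>det D\<bar>" for u using k' by simp_all
  note kc = kc'[rule_format]
  \<comment> \<open>Subtracting a multiple of the pivot column reduces the first coordinate modulo
    \<open>t\<close>; \<open>red\<close> is what becomes of the other coordinates.\<close>
  define red where "red u i = u (Suc i) - (u 0 div t) * B' $$ (Suc i, j0)" for u :: "nat \<Rightarrow> int" and i
  \<comment> \<open>For negative \<open>t\<close> the remainder lies between \<open>t + 1\<close>
    and 0; the shift by \<open>- t - 1\<close> brings it to a digit from 0 to
    \<open>\<bar>t\<bar> - 1\<close>.\<close>
  define r where "r u = u 0 - t * (u 0 div t) + (if t < 0 then - t - 1 else 0)" for u :: "nat \<Rightarrow> int"
  have r: "0 \<le> r u" "r u < \<bar>t\<bar>" for u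
  proof -
    have m: "u 0 - t * (u 0 div t) = u 0 mod t" by (simp add: minus_mult_div_eq_mod)
    have "0 \<le> r u \<and> r u < \<bar>t\<bar>"
    proof (cases "t < 0")
      case True
      have "r u = u 0 mod t - t - 1" using True by (simp add: r_def m)
      moreover have "u 0 mod t \<le> 0" "t < u 0 mod t" using True neg_mod_sign neg_mod_bound by blast+
      ultimately show ?thesis by linarith
    next
      case False
      have "r u = u 0 mod t" using False by (simp add: r_def m)
      moreover have "0 \<le> u 0 mod t" "u 0 mod t < t" using False nz(1) pos_mod_sign pos_mod_bound by force+
      ultimately show ?thesis by linarith
    qed
    thus "0 \<le> r u" "r u < \<bar>t\<bar>" by auto
  qed
  define \<kappa>' where "\<kappa>' u = r u + \<bar>t\<bar> * \<kappa> (red u)" for u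
  show ?case
  proof (intro exI[of _ \<kappa>'] conjI allI impI)
    fix u
    show "0 \<le> \<kappa>' u" using r k by (simp add: \<kappa>'_def)
    have "\<kappa>' u < \<bar>t\<bar> + \<bar>t\<bar> * \<kappa> (red u)" using r by (simp add: \<kappa>'_def)
    also have "\<dots> = \<bar>t\<bar> * (1 + \<kappa> (red u))" by (simp add: algebra_simps)
    also have "\<dots> \<le> \<bar>t\<bar> * \<bar>det D\<bar>" using k(2)[of "red u"] by (intro mult_left_mono) auto
    finally show "\<kappa>' u < \<bar>det B\<bar>" by (simp add: det)
  next
    fix u v assume eq: "\<kappa>' u = \<kappa>' v"
    have rr: "r u = r v"
    proof -
      have "\<kappa>' w mod \<bar>t\<bar> = r w" for w using r[of w] by (simp add: \<kappa>'_def mod_pos_pos_trivial)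
      with eq show ?thesis by metis
    qed
    with eq nz have "\<kappa> (red u) = \<kappa> (red v)" by (simp add: \<kappa>'_def)
    from kc[OF this] obtain c where c: "\<And>i. i<n \<Longrightarrow> red u i - red v i = (\<Sum>j<n. D $$ (i, j) * c j)" by blast
    define q where "q = u 0 div t - v 0 div t"
    \<comment> \<open>The pivot column absorbs the difference of the two quotients, the other
      columns the combination found for the minor.\<close>
    define c' where "c' j = (if j = j0 then q else c (delete_index j0 j))" for j
    have c'i: "c' (insert_index j0 j) = c j" for j unfolding c'_def by simp
    have "u i - v i = (\<Sum>j<Suc n. B' $$ (i, j) * c' j)" if i: "i < Suc n" for i
    proof (cases i)
      case 0
      have "u 0 - v 0 = t * q" using rr by (simp add: r_def q_def algebra_simps)
      moreover have "(\<Sum>j<n. B' $$ (0, insert_index j0 j) * c j) = 0"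
        using j0 by (intro sum.neutral) (auto intro!: z simp: insert_index_def)
      ultimately show ?thesis using 0 unfolding sum_insert_index[OF j0] c'i
        by (simp add: t_def c'_def)
    next
      case (Suc i')
      have "(\<Sum>j<n. B' $$ (i, insert_index j0 j) * c j) = (\<Sum>j<n. D $$ (i', j) * c j)"
        using i Suc B' by (intro sum.cong) (auto simp: D_def mat_delete_def insert_index_def)
      also have "\<dots> = red u i' - red v i'" using c[of i'] i Suc by simp
      finally show ?thesis unfolding sum_insert_index[OF j0] c'i
        using Suc by (simp add: red_def c'_def q_def algebra_simps)
    qed
    with tr[of c'] show "\<exists>c. \<forall>i<Suc n. u i - v i = (\<Sum>j<Suc n. B $$ (i, j) * c j)" by metis
  qed
qed

text \<open>Pigeonhole: the box with sides \<open>s i\<close> has more integer points than there are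
  codes, so two of them differ by a vector of the column lattice, and the coordinates of this
  difference are smaller than the sides.\<close>

lemma integer_linear_forms:
  fixes B :: "int mat" and s :: "nat \<Rightarrow> nat"
  assumes B: "B \<in> carrier_mat n n" "det B \<noteq> 0" and s: "\<bar>det B\<bar> < (\<Prod>i<n. int (s i))"
  shows "\<exists>c j0. j0 < n \<and> c j0 \<noteq> 0 \<and> (\<forall>i<n. \<bar>\<Sum>j<n. B $$ (i, j) * c j\<bar> < int (s i))"
proof -
  obtain \<kappa> :: "(nat \<Rightarrow> int) \<Rightarrow> int" where k': "\<forall>u. 0 \<le> \<kappa> u \<and> \<kappa> u < \<bar>det B\<bar>" and
    kc': "\<forall>u v. \<kappa> u = \<kappa> v \<longrightarrow> (\<exists>c. \<forall>i<n. u i - v i = (\<Sum>j<n. B $$ (i, j) * c j))"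
    using residue_code[OF B] by (elim exE conjE) (rule that)
  have k: "0 \<le> \<kappa> u" "\<kappa> u < \<bar>det B\<bar>" for u using k' by simp_all
  note kc = kc'[rule_format]
  define S where "S = PiE {..<n} (\<lambda>i. {0..<int (s i)})"
  have "card S = (\<Prod>i<n. s i)" by (simp add: S_def card_PiE)
  hence "int (card S) > \<bar>det B\<bar>" using s by simp
  moreover have "card (\<kappa> ` S) \<le> card {0..<\<bar>det B\<bar>}"
    using k by (intro card_mono) auto
  ultimately have "card (\<kappa> ` S) < card S" by simp
  hence "\<not> inj_on \<kappa> S" by (metis card_image nat_neq_iff)
  then obtain u v where uv: "u \<in> S" "v \<in> S" "u \<noteq> v" "\<kappa> u = \<kappa> v" by (auto simp: inj_on_def)
  from kc[OF uv(4)] obtain c where c: "\<And>i. i<n \<Longrightarrow> u i - v i = (\<Sum>j<n. B $$ (i, j) * c j)" by blast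
  have "\<exists>j0<n. c j0 \<noteq> 0"
  proof (rule ccontr)
    assume "\<not> ?thesis"
    hence "u i = v i" if "i < n" for i using c[OF that] by simp
    hence "u = v" using uv(1,2) by (intro PiE_ext[of u "{..<n}" "\<lambda>i. {0..<int (s i)}"]) (auto simp: S_def)
    with uv(3) show False by simp
  qed
  moreover have "\<bar>\<Sum>j<n. B $$ (i, j) * c j\<bar> < int (s i)" if "i < n" for i
  proof -
    have "u i \<in> {0..<int (s i)}" "v i \<in> {0..<int (s i)}"
      using uv(1,2) that unfolding S_def by (auto dest: PiE_mem simp del: atLeastLessThan_iff)
    thus ?thesis unfolding c[OF that, symmetric] by auto
  qed
  ultimately show ?thesis by blast
qed

section \<open>Real linear forms, by rational approximation\<close>

lemma tendsto_det:
  fixes f :: "'b \<Rightarrow> nat \<times> nat \<Rightarrow> real"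
  assumes "\<And>i j. i < n \<Longrightarrow> j < n \<Longrightarrow> ((\<lambda>q. f q (i, j)) \<longlongrightarrow> g (i, j)) F"
  shows "((\<lambda>q. det (mat n n (f q))) \<longlongrightarrow> det (mat n n g)) F"
proof -
  have perm: "p i < n" if "p permutes {0..<n}" "i < n" for p i
    using permutes_in_image[OF that(1), of i] that(2) by simp
  have "((\<lambda>q. \<Sum>p\<in>{p. p permutes {0..<n}}. signof p * (\<Prod>i = 0..<n. f q (i, p i)))
      \<longlongrightarrow> (\<Sum>p\<in>{p. p permutes {0..<n}}. signof p * (\<Prod>i = 0..<n. g (i, p i)))) F"
    by (intro tendsto_intros tendsto_prod assms) (auto intro: perm)
  thus ?thesis by (simp add: det_def perm)
qed

lemma tendsto_cofactor:
  fixes f :: "'b \<Rightarrow> nat \<times> nat \<Rightarrow> real"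
  assumes "\<And>i j. i < n \<Longrightarrow> j < n \<Longrightarrow> ((\<lambda>q. f q (i, j)) \<longlongrightarrow> g (i, j)) F" "k < n" "l < n"
  shows "((\<lambda>q. cofactor (mat n n (f q)) k l) \<longlongrightarrow> cofactor (mat n n g) k l) F"
proof -
  have *: "mat_delete (mat n n h) k l = mat (n - 1) (n - 1)
     (\<lambda>p. h (if fst p < k then fst p else Suc (fst p), if snd p < l then snd p else Suc (snd p)))" for h :: "nat \<times> nat \<Rightarrow> real"
    using assms(2,3) by (auto simp: mat_delete_def intro!: eq_matI)
  show ?thesis unfolding cofactor_def *
    by (intro tendsto_intros tendsto_det) (use assms in auto)
qed

text \<open>Cramer's rule. It keeps the coefficients under control while the matrix is being
  approximated, and it leaves only finitely many integer solutions for given bounds.\<close>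

lemma cofactor_bound:
  fixes A :: "real mat"
  assumes A: "A \<in> carrier_mat n n" and le: "\<And>i. i < n \<Longrightarrow> \<bar>\<Sum>j<n. A $$ (i, j) * c j\<bar> \<le> r i" and j: "j < n"
  shows "\<bar>c j\<bar> * \<bar>det A\<bar> \<le> (\<Sum>i<n. \<bar>cofactor A i j\<bar> * r i)"
proof -
  define x where "x = vec n c"
  have x: "x \<in> carrier_vec n" by (simp add: x_def)
  have "(adj_mat A * A) *\<^sub>v x = det A \<cdot>\<^sub>v x"
    unfolding adj_mat(3)[OF A] using x by (intro eq_vecI) auto
  hence "det A * c j = (adj_mat A *\<^sub>v (A *\<^sub>v x)) $ j"
    using adj_mat(1)[OF A] A x j by (subst assoc_mult_mat_vec[symmetric]) (auto simp: x_def)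
  also have "\<dots> = (\<Sum>i<n. cofactor A i j * (\<Sum>k<n. A $$ (i, k) * c k))"
    using adj_mat(1)[OF A] A j
    by (auto simp: scalar_prod_def x_def adj_mat_def lessThan_atLeast0 intro!: sum.cong)
  finally have "\<bar>c j\<bar> * \<bar>det A\<bar> = \<bar>\<Sum>i<n. cofactor A i j * (\<Sum>k<n. A $$ (i, k) * c k)\<bar>"
    by (simp add: abs_mult[symmetric] mult.commute)
  also have "\<dots> \<le> (\<Sum>i<n. \<bar>cofactor A i j * (\<Sum>k<n. A $$ (i, k) * c k)\<bar>)" by (rule sum_abs)
  also have "\<dots> \<le> (\<Sum>i<n. \<bar>cofactor A i j\<bar> * r i)"
    using le by (intro sum_mono) (auto simp: abs_mult intro!: mult_left_mono)
  finally show ?thesis .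
qed

text \<open>The strict inequality leaves room to shrink every bound by a factor
  \<open>\<mu>\<close>. Replacing \<open>A\<close> by rational matrices with common denominator
  \<open>q\<close>, and clearing it, gives the integer case; as the coefficients stay bounded when
  \<open>q\<close> grows, the error of the approximation fits into the room left.\<close>

theorem minkowski_linear_forms:
  fixes A :: "nat \<times> nat \<Rightarrow> real" and r :: "nat \<Rightarrow> real"
  assumes det: "det (mat n n A) \<noteq> 0" and pos: "\<And>i. i < n \<Longrightarrow> r i > 0"
    and prod: "\<bar>det (mat n n A)\<bar> < (\<Prod>i<n. r i)"
  shows "\<exists>c :: nat \<Rightarrow> int. (\<exists>j<n. c j \<noteq> 0) \<and> (\<forall>i<n. \<bar>\<Sum>j<n. A (i, j) * of_int (c j)\<bar> < r i)"
proof -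
  define d where "d = \<bar>det (mat n n A)\<bar>"
  have d: "d > 0" using det by (simp add: d_def)
  have "((\<lambda>\<mu>. \<mu> ^ n * (\<Prod>i<n. r i)) \<longlongrightarrow> 1 ^ n * (\<Prod>i<n. r i)) (at_left (1::real))"
    by (intro tendsto_intros)
  hence "\<forall>\<^sub>F \<mu> in at_left 1. d < \<mu> ^ n * (\<Prod>i<n. r i)"
    using prod by (intro order_tendstoD(1)) (auto simp: d_def)
  moreover have "\<forall>\<^sub>F \<mu> in at_left (1::real). 0 < \<mu>" "\<forall>\<^sub>F \<mu> in at_left (1::real). \<mu> < 1"
    by (auto intro: eventually_at_leftI[of 0])
  ultimately have "\<forall>\<^sub>F \<mu> in at_left 1. d < \<mu> ^ n * (\<Prod>i<n. r i) \<and> 0 < \<mu> \<and> \<mu> < 1"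
    by eventually_elim auto
  then obtain \<mu> where \<mu>: "0 < \<mu>" "\<mu> < 1" "d < \<mu> ^ n * (\<Prod>i<n. r i)"
    using eventually_happens'[OF trivial_limit_at_left_real] by blast
  define r' where "r' i = \<mu> * r i" for i
  have pos': "r' i > 0" if "i < n" for i using that \<mu> pos by (simp add: r'_def)
  have prod': "d < (\<Prod>i<n. r' i)" using \<mu> by (simp add: r'_def prod.distrib)
  define E where "E q p = of_int \<lfloor>real q * A p\<rfloor> / real q" for q p
  have E_near: "\<bar>A p - E q p\<bar> \<le> 1 / real q" if "q > 0" for q p
  proof -
    have "A p - E q p = (real q * A p - of_int \<lfloor>real q * A p\<rfloor>) / real q"
      using that by (simp add: E_def field_simps)
    moreover have "\<bar>real q * A p - of_int \<lfloor>real q * A p\<rfloor>\<bar> \<le> 1" by linarith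
    ultimately show ?thesis using that by (simp add: divide_right_mono)
  qed
  have E_lim: "(\<lambda>q. E q p) \<longlonglongrightarrow> A p" for p
  proof (rule Lim_transform2[OF tendsto_const])
    show "(\<lambda>q. A p - E q p) \<longlonglongrightarrow> 0"
    proof (rule Lim_null_comparison[OF _ lim_1_over_n])
      show "\<forall>\<^sub>F q in sequentially. norm (A p - E q p) \<le> 1 / real q"
        using eventually_gt_at_top[of 0] by eventually_elim (simp add: E_near)
    qed
  qed
  define K where "K q = (\<Sum>j<n. \<Sum>i<n. \<bar>cofactor (mat n n (E q)) i j\<bar> * r' i)" for q
  define K0 where "K0 = (\<Sum>j<n. \<Sum>i<n. \<bar>cofactor (mat n n A) i j\<bar> * r' i)"
  have "K \<longlonglongrightarrow> K0" unfolding K_def K0_def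
    by (intro tendsto_intros tendsto_cofactor E_lim) auto
  hence ev1: "\<forall>\<^sub>F q in sequentially. K q < K0 + 1" by (rule order_tendstoD) simp
  have lim: "(\<lambda>q. \<bar>det (mat n n (E q))\<bar>) \<longlonglongrightarrow> d" unfolding d_def
    by (intro tendsto_intros tendsto_det E_lim)
  have ev2: "\<forall>\<^sub>F q in sequentially. \<bar>det (mat n n (E q))\<bar> > d / 2"
    by (rule order_tendstoD(1)[OF lim]) (use d in simp)
  have ev3: "\<forall>\<^sub>F q in sequentially. \<bar>det (mat n n (E q))\<bar> < (\<Prod>i<n. r' i)"
    by (rule order_tendstoD(2)[OF lim prod'])
  \<comment> \<open>For large \<open>q\<close> the determinant exceeds \<open>d / 2\<close> and
    \<open>K q\<close> is below \<open>K0 + 1\<close>, so Cramer's rule bounds all coefficients by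
    \<open>C\<close>, independently of \<open>q\<close>. Hence the total error
    \<open>real n * C / real q\<close> tends to 0.\<close>
  define C where "C = 2 * (K0 + 1) / d"
  have ev4: "\<forall>\<^sub>F q in sequentially. \<forall>i\<in>{..<n}. r' i + real n * C * (1 / real q) < r i"
  proof (intro eventually_ball_finite ballI finite_lessThan)
    fix i assume "i \<in> {..<n}"
    hence lt: "r' i + real n * C * 0 < r i" using \<mu> pos[of i] by (simp add: r'_def)
    have "(\<lambda>q. r' i + real n * C * (1 / real q)) \<longlonglongrightarrow> r' i + real n * C * 0"
      by (intro tendsto_intros lim_1_over_n)
    from order_tendstoD(2)[OF this lt]
    show "\<forall>\<^sub>F q in sequentially. r' i + real n * C * (1 / real q) < r i" .
  qed
  obtain q where q: "q > 0" and q1: "K q < K0 + 1" and q2: "\<bar>det (mat n n (E q))\<bar> > d / 2"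
    and q3: "\<bar>det (mat n n (E q))\<bar> < (\<Prod>i<n. r' i)"
    and q4: "\<And>i. i < n \<Longrightarrow> r' i + real n * C * (1 / real q) < r i"
    using eventually_happens'[OF sequentially_bot eventually_conj[OF eventually_gt_at_top[of 0]
       eventually_conj[OF ev1 eventually_conj[OF ev2 eventually_conj[OF ev3 ev4]]]]] by auto
  define B where "B = mat n n (\<lambda>p. \<lfloor>real q * A p\<rfloor>)"
  have B: "B \<in> carrier_mat n n" by (simp add: B_def)
  have "map_mat real_of_int B = real q \<cdot>\<^sub>m mat n n (E q)"
    using q by (auto simp: B_def E_def intro!: eq_matI)
  hence "real_of_int (det B) = real q ^ n * det (mat n n (E q))"
    unfolding of_int_hom.hom_det[symmetric] by simp
  hence absB: "real_of_int \<bar>det B\<bar> = real q ^ n * \<bar>det (mat n n (E q))\<bar>"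
    by (simp add: abs_mult)
  hence nzB: "det B \<noteq> 0" using q q2 d by auto
  define s where "s i = nat \<lceil>real q * r' i\<rceil>" for i
  have s: "real q * r' i \<le> real (s i)" "real (s i) < real q * r' i + 1" if "i < n" for i
    using pos'[OF that] q unfolding s_def by (simp, simp, linarith)
  have "real_of_int \<bar>det B\<bar> < real q ^ n * (\<Prod>i<n. r' i)"
    unfolding absB using q q3 by simp
  also have "\<dots> = (\<Prod>i<n. real q * r' i)" by (simp add: prod.distrib)
  also have "\<dots> \<le> (\<Prod>i<n. real (s i))"
    using s pos' by (intro prod_mono) (use q in \<open>auto intro!: mult_nonneg_nonneg less_imp_le\<close>)
  also have "\<dots> = real_of_int (\<Prod>i<n. int (s i))" by simp
  finally have "\<bar>det B\<bar> < (\<Prod>i<n. int (s i))" by (simp only: of_int_less_iff)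
  from integer_linear_forms[OF B nzB this] obtain c j0 where
    c: "j0 < n" "c j0 \<noteq> 0" and cs: "\<And>i. i < n \<Longrightarrow> \<bar>\<Sum>j<n. B $$ (i, j) * c j\<bar> < int (s i)" by blast
  have small: "\<bar>\<Sum>j<n. E q (i, j) * of_int (c j)\<bar> \<le> r' i" if i: "i < n" for i
  proof -
    have "real q * (\<Sum>j<n. E q (i, j) * of_int (c j)) = (\<Sum>j<n. of_int (B $$ (i, j) * c j))"
      using i q by (auto simp: sum_distrib_left E_def B_def intro!: sum.cong)
    also have "\<dots> = of_int (\<Sum>j<n. B $$ (i, j) * c j)" by simp
    finally have eq: "real q * (\<Sum>j<n. E q (i, j) * of_int (c j)) = of_int (\<Sum>j<n. B $$ (i, j) * c j)" .
    have "real q * \<bar>\<Sum>j<n. E q (i, j) * of_int (c j)\<bar> = \<bar>real q * (\<Sum>j<n. E q (i, j) * of_int (c j))\<bar>"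
      by (simp add: abs_mult)
    also have "\<dots> = of_int \<bar>\<Sum>j<n. B $$ (i, j) * c j\<bar>"
      unfolding eq by (rule of_int_abs[symmetric])
    \<comment> \<open>The form is an integer below \<open>s i\<close>, hence at most
      \<open>s i - 1\<close>: this gains back what rounding up in \<open>s\<close> has lost.\<close>
    also have "\<dots> \<le> real (s i) - 1" using cs[OF i] by linarith
    also have "\<dots> \<le> real q * r' i" using s(2)[OF i] by linarith
    finally show ?thesis using q by simp
  qed
  have bound: "\<bar>of_int (c j)\<bar> \<le> C" if j: "j < n" for j
  proof -
    have "\<bar>real_of_int (c j)\<bar> * (d / 2) \<le> \<bar>real_of_int (c j)\<bar> * \<bar>det (mat n n (E q))\<bar>"
      using q2 by (intro mult_left_mono) auto
    also have "\<dots> \<le> (\<Sum>i<n. \<bar>cofactor (mat n n (E q)) i j\<bar> * r' i)"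
      by (rule cofactor_bound) (use small j in auto)
    also have "\<dots> \<le> K q" unfolding K_def
      using j pos' by (intro member_le_sum sum_nonneg mult_nonneg_nonneg) (auto intro: less_imp_le)
    also have "\<dots> \<le> K0 + 1" using q1 by simp
    finally show ?thesis using d by (simp add: C_def field_simps)
  qed
  have "\<bar>\<Sum>j<n. A (i, j) * of_int (c j)\<bar> < r i" if i: "i < n" for i
  proof -
    have "(\<Sum>j<n. A (i, j) * of_int (c j)) = (\<Sum>j<n. E q (i, j) * of_int (c j)) +
        (\<Sum>j<n. (A (i, j) - E q (i, j)) * of_int (c j))"
      by (simp add: sum.distrib[symmetric] algebra_simps)
    moreover have "\<bar>\<Sum>j<n. (A (i, j) - E q (i, j)) * of_int (c j)\<bar> \<le> (\<Sum>j<n. 1 / real q * C)"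
    proof (intro order.trans[OF sum_abs] sum_mono)
      fix j assume "j \<in> {..<n}"
      thus "\<bar>(A (i, j) - E q (i, j)) * of_int (c j)\<bar> \<le> 1 / real q * C"
        unfolding abs_mult using E_near[OF q] bound[of j] by (intro mult_mono) auto
    qed
    ultimately show ?thesis using small[OF i] q4[OF i] by (simp add: algebra_simps)
  qed
  with c show ?thesis by blast
qed

text \<open>The bounds 1 have product equal to the determinant, so the theorem does not apply
  directly. It does apply to the bounds \<open>t, 1, ..., 1\<close> for each \<open>t > 1\<close>;
  the solutions with first form below 2 are finite in number, and one of them with the least first
  form reaches the limit \<open>t = 1\<close>.\<close>

corollary minkowski_linear_forms_unimodular:
  fixes A :: "nat \<times> nat \<Rightarrow> real"
  assumes det: "\<bar>det (mat n n A)\<bar> = 1" and n: "n > 0"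
  shows "\<exists>c :: nat \<Rightarrow> int. (\<exists>j<n. c j \<noteq> 0) \<and> \<bar>\<Sum>j<n. A (0, j) * of_int (c j)\<bar> \<le> 1 \<and>
    (\<forall>i<n. i > 0 \<longrightarrow> \<bar>\<Sum>j<n. A (i, j) * of_int (c j)\<bar> < 1)"
proof -
  define L where "L c i = \<bar>\<Sum>j<n. A (i, j) * of_int (c j)\<bar>" for c :: "nat \<Rightarrow> int" and i
  \<comment> \<open>Coefficient functions are restricted to the indices below \<open>n\<close>,
    since only then is this set finite.\<close>
  define F where "F = {c \<in> {..<n} \<rightarrow>\<^sub>E UNIV. (\<exists>j<n. c j \<noteq> 0) \<and> L c 0 < 2 \<and> (\<forall>i<n. i > 0 \<longrightarrow> L c i < 1)}"
  have ex: "\<exists>c\<in>F. L c 0 < t" if t: "1 < t" "t \<le> 2" for t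
  proof -
    have "(\<Prod>i<n. if i = 0 then t else 1) = t"
      using n by simp
    hence "\<exists>c :: nat \<Rightarrow> int. (\<exists>j<n. c j \<noteq> 0) \<and> (\<forall>i<n. L c i < (if i = 0 then t else 1))"
      unfolding L_def using det t by (intro minkowski_linear_forms) auto
    then obtain c :: "nat \<Rightarrow> int" where c: "\<exists>j<n. c j \<noteq> 0" "\<And>i. i < n \<Longrightarrow> L c i < (if i = 0 then t else 1)"
      by blast
    define c' where "c' = restrict c {..<n}"
    have L: "L c' i = L c i" for i by (simp add: L_def c'_def)
    have "L c i < 1" if "i < n" "i > 0" for i using c(2)[OF that(1)] that(2) by simp
    hence "c' \<in> F" unfolding F_def mem_Collect_eq L using c(1) c(2)[OF n] t
      by (auto simp: c'_def)
    moreover have "L c' 0 < t" using c(2)[OF n] L by simp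
    ultimately show ?thesis by blast
  qed
  define K where "K = (\<Sum>j<n. \<Sum>i<n. \<bar>cofactor (mat n n A) i j\<bar> * 2)"
  have "F \<subseteq> {..<n} \<rightarrow>\<^sub>E {-\<lceil>K\<rceil>..\<lceil>K\<rceil>}"
  proof
    fix c assume c: "c \<in> F"
    have "c j \<in> {-\<lceil>K\<rceil>..\<lceil>K\<rceil>}" if j: "j < n" for j
    proof -
      have "L c i \<le> 2" if "i < n" for i using c that by (cases "i = 0") (auto simp: F_def intro: less_imp_le order.trans[of _ 1])
      hence "\<bar>real_of_int (c j)\<bar> * \<bar>det (mat n n A)\<bar> \<le> (\<Sum>i<n. \<bar>cofactor (mat n n A) i j\<bar> * 2)"
        by (intro cofactor_bound) (use j in \<open>auto simp: L_def\<close>)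
      also have "\<dots> \<le> K" unfolding K_def
        using j by (intro member_le_sum sum_nonneg) auto
      finally have "\<bar>real_of_int (c j)\<bar> \<le> K" by (simp add: det)
      thus ?thesis by (simp add: abs_le_iff) linarith
    qed
    thus "c \<in> {..<n} \<rightarrow>\<^sub>E {-\<lceil>K\<rceil>..\<lceil>K\<rceil>}" using c by (auto simp: F_def PiE_iff)
  qed
  hence "finite F" by (rule finite_subset) (auto intro!: finite_PiE)
  moreover have "F \<noteq> {}" using ex[of 2] by auto
  ultimately obtain c where c: "c \<in> F" "\<And>c'. c' \<in> F \<Longrightarrow> \<not> L c' 0 < L c 0"
    using arg_min_if_finite[of F "\<lambda>c. L c 0"] by blast
  have "L c 0 \<le> 1"
  proof (rule ccontr)
    assume "\<not> ?thesis"
    moreover have "L c 0 \<le> 2" using c(1) by (simp add: F_def)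
    ultimately show False using ex[of "L c 0"] c(2) by auto
  qed
  with c(1) show ?thesis unfolding F_def L_def by blast
qed

section \<open>The ring of algebraic integers\<close>

text \<open>The characteristic polynomial of an integer matrix is monic with integer coefficients,
  and it vanishes at the eigenvalue \<open>x\<close>.\<close>

lemma algebraic_int_of_int_eigenvalue:
  fixes A :: "nat \<Rightarrow> nat \<Rightarrow> int" and x :: complex
  assumes "\<And>i. i < n \<Longrightarrow> x * v i = (\<Sum>j<n. of_int (A i j) * v j)" "i < n" "v i \<noteq> 0"
  shows "algebraic_int x"
proof -
  define B where "B = mat n n (\<lambda>(i, j). A i j)"
  define C where "C = map_mat complex_of_int B"
  have B: "B \<in> carrier_mat n n" and C: "C \<in> carrier_mat n n" by (auto simp: B_def C_def)
  have "C *\<^sub>v vec n v = x \<cdot>\<^sub>v vec n v"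
    using assms(1) by (intro eq_vecI) (auto simp: C_def B_def scalar_prod_def lessThan_atLeast0)
  moreover have "vec n v $ i \<noteq> 0\<^sub>v n $ i" using assms(2,3) by simp
  hence "vec n v \<noteq> 0\<^sub>v n" by auto
  ultimately have "eigenvalue C x"
    using C unfolding eigenvalue_def eigenvector_def by (auto intro!: exI[of _ "vec n v"])
  hence "poly (char_poly C) x = 0" using eigenvalue_root_char_poly[OF C] by simp
  hence "poly (map_poly of_int (char_poly B)) x = 0"
    by (simp add: C_def of_int_hom.char_poly_hom[OF B])
  moreover have "lead_coeff (char_poly B) = 1" using degree_monic_char_poly[OF B] by simp
  ultimately show ?thesis unfolding algebraic_int_altdef_ipoly by blast
qed

definition int_span :: "(nat \<Rightarrow> complex) \<Rightarrow> nat \<Rightarrow> complex set" where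
  "int_span v n = {\<Sum>j<n. of_int (a j) * v j | a. True}"

lemma int_span_add: "x \<in> int_span v n \<Longrightarrow> y \<in> int_span v n \<Longrightarrow> x + y \<in> int_span v n"
proof -
  assume "x \<in> int_span v n" "y \<in> int_span v n"
  then obtain a b where "x = (\<Sum>j<n. of_int (a j) * v j)" "y = (\<Sum>j<n. of_int (b j) * v j)"
    by (auto simp: int_span_def)
  hence "x + y = (\<Sum>j<n. of_int (a j + b j) * v j)"
    by (simp add: sum.distrib distrib_right)
  thus ?thesis unfolding int_span_def by (intro CollectI exI[of _ "\<lambda>j. a j + b j"]) simp
qed

lemma int_span_mult_of_int: "x \<in> int_span v n \<Longrightarrow> of_int k * x \<in> int_span v n"
proof -
  assume "x \<in> int_span v n"
  then obtain a where "x = (\<Sum>j<n. of_int (a j) * v j)" by (auto simp: int_span_def)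
  hence "of_int k * x = (\<Sum>j<n. of_int (k * a j) * v j)"
    by (simp add: sum_distrib_left mult.assoc)
  thus ?thesis unfolding int_span_def by (intro CollectI exI[of _ "\<lambda>j. k * a j"]) simp
qed

lemma int_span_zero: "0 \<in> int_span v n"
  unfolding int_span_def by (auto intro!: exI[of _ "\<lambda>_. 0"])

lemma int_span_sum: "(\<And>i. i \<in> I \<Longrightarrow> f i \<in> int_span v n) \<Longrightarrow> sum f I \<in> int_span v n"
  by (induction I rule: infinite_finite_induct) (auto intro: int_span_add int_span_zero)

lemma int_span_gen: "i < n \<Longrightarrow> v i \<in> int_span v n"
  unfolding int_span_def by (auto intro!: exI[of _ "\<lambda>j. if j = i then 1 else 0"] simp: if_distrib if_distribR cong: if_cong)

lemma int_span_stable: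
  assumes "\<And>i. i < n \<Longrightarrow> x * v i \<in> int_span v n" "w \<in> int_span v n"
  shows "x * w \<in> int_span v n"
proof -
  from assms(2) obtain a where "w = (\<Sum>j<n. of_int (a j) * v j)" by (auto simp: int_span_def)
  hence "x * w = (\<Sum>j<n. of_int (a j) * (x * v j))" by (simp add: sum_distrib_left algebra_simps)
  thus ?thesis using assms(1) by (auto intro!: int_span_sum int_span_mult_of_int)
qed

lemma algebraic_int_if_int_span_stable:
  assumes "\<And>i. i < n \<Longrightarrow> x * v i \<in> int_span v n" "i < n" "v i \<noteq> 0"
  shows "algebraic_int x"
proof -
  have "\<forall>i. \<exists>a. i < n \<longrightarrow> x * v i = (\<Sum>j<n. of_int (a j) * v j)"
    using assms(1) unfolding int_span_def by blast
  then obtain A where "\<And>i. i < n \<Longrightarrow> x * v i = (\<Sum>j<n. of_int (A i j) * v j)" by metis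
  from algebraic_int_of_int_eigenvalue[OF this assms(2,3)] show ?thesis .
qed

lemma algebraic_int_power_eq:
  assumes "algebraic_int (x :: complex)"
  shows "\<exists>m a. m > 0 \<and> x ^ m = (\<Sum>l<m. of_int (a l) * x ^ l)"
proof -
  from assms obtain p where p: "poly (map_poly of_int p) x = 0" "lead_coeff p = 1"
    unfolding algebraic_int_altdef_ipoly by blast
  have "degree p > 0"
  proof (rule ccontr)
    assume "\<not> ?thesis"
    then obtain c where "p = [:c:]" by (metis degree_eq_zeroE neq0_conv)
    with p show False by simp
  qed
  moreover have "x ^ degree p = (\<Sum>l<degree p. of_int (- coeff p l) * x ^ l)"
  proof -
    have "0 = (\<Sum>l\<le>degree p. of_int (coeff p l) * x ^ l)"
      using p(1) by (simp add: poly_altdef)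
    also have "\<dots> = (\<Sum>l<degree p. of_int (coeff p l) * x ^ l) + x ^ degree p"
      using p(2) by (simp add: lessThan_Suc_atMost[symmetric])
    finally show ?thesis by (simp add: sum_negf eq_neg_iff_add_eq_0 add.commute)
  qed
  ultimately show ?thesis by (intro exI[of _ "degree p"] exI[of _ "\<lambda>l. - coeff p l"] conjI)
qed

text \<open>By the two monic equations, the monomials \<open>x ^ i * y ^ j\<close> with
  \<open>i < m\<close> and \<open>j < k\<close> span a group stable under \<open>x\<close> and under
  \<open>y\<close>, hence under their sum and product; the eigenvalue criterion then covers
  both.\<close>

lemma algebraic_int_plus_times:
  assumes "algebraic_int (x :: complex)" "algebraic_int y"
  shows "algebraic_int (x + y)" "algebraic_int (x * y)"
proof -
  obtain m a where x: "m > 0" "x ^ m = (\<Sum>l<m. of_int (a l) * x ^ l)"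
    using algebraic_int_power_eq[OF assms(1)] by (elim exE conjE) (rule that)
  obtain k b where y: "k > 0" "y ^ k = (\<Sum>l<k. of_int (b l) * y ^ l)"
    using algebraic_int_power_eq[OF assms(2)] by (elim exE conjE) (rule that)
  \<comment> \<open>The exponents \<open>i\<close> and \<open>j\<close> are stored at the index
    \<open>i * k + j\<close>.\<close>
  define v where "v i = x ^ (i div k) * y ^ (i mod k)" for i
  have v: "x ^ i * y ^ j \<in> int_span v (m * k)" if "i < m" "j < k" for i j
  proof -
    have "i * k + j < Suc i * k" using that by simp
    also have "\<dots> \<le> m * k" using that by (intro mult_le_mono1) simp
    finally have "i * k + j < m * k" .
    moreover have "v (i * k + j) = x ^ i * y ^ j" using that by (simp add: v_def)
    ultimately show ?thesis using int_span_gen[of "i * k + j" "m * k" v] by simp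
  qed
  have xs: "x * v i \<in> int_span v (m * k)" if "i < m * k" for i
  proof -
    have i: "i div k < m" "i mod k < k" using that y(1) by (auto simp: less_mult_imp_div_less)
    show ?thesis
    proof (cases "Suc (i div k) < m")
      case True
      thus ?thesis using v[OF True i(2)] by (simp add: v_def mult.assoc)
    next
      case False
      hence "Suc (i div k) = m" using i by simp
      hence "x * v i = x ^ m * y ^ (i mod k)" by (auto simp: v_def)
      also have "\<dots> = (\<Sum>l<m. of_int (a l) * (x ^ l * y ^ (i mod k)))"
        by (simp add: x(2) sum_distrib_right mult.assoc)
      finally show ?thesis using v i by (auto intro!: int_span_sum int_span_mult_of_int)
    qed
  qed
  have ys: "y * v i \<in> int_span v (m * k)" if "i < m * k" for i
  proof -
    have i: "i div k < m" "i mod k < k" using that y(1) by (auto simp: less_mult_imp_div_less)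
    show ?thesis
    proof (cases "Suc (i mod k) < k")
      case True
      thus ?thesis using v[OF i(1) True] by (simp add: v_def mult_ac)
    next
      case False
      hence "Suc (i mod k) = k" using i by simp
      hence "y ^ k = y * y ^ (i mod k)" using power_Suc[of y "i mod k"] by simp
      hence "y * v i = x ^ (i div k) * y ^ k" by (simp add: v_def)
      also have "\<dots> = (\<Sum>l<k. of_int (b l) * (x ^ (i div k) * y ^ l))"
        by (simp add: y(2) sum_distrib_left mult_ac)
      finally show ?thesis using v i by (auto intro!: int_span_sum int_span_mult_of_int)
    qed
  qed
  have nz: "0 < m * k" "v 0 \<noteq> 0" using x(1) y(1) by (auto simp: v_def)
  have "(x + y) * v i \<in> int_span v (m * k)" if "i < m * k" for i
    using xs[OF that] ys[OF that] by (simp add: distrib_right int_span_add)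
  from algebraic_int_if_int_span_stable[OF this nz] show "algebraic_int (x + y)" .
  have "(x * y) * v i \<in> int_span v (m * k)" if "i < m * k" for i
    using int_span_stable[OF xs ys[OF that]] by (simp add: mult.assoc)
  from algebraic_int_if_int_span_stable[OF this nz] show "algebraic_int (x * y)" .
qed

text \<open>The multiplier is the leading coefficient of an integer equation. This reduces the
  closure of the algebraic numbers under sums and products to that of the algebraic
  integers.\<close>

lemma algebraic_iff_ex_algebraic_int:
  "algebraic (x :: complex) \<longleftrightarrow> (\<exists>c::int. c \<noteq> 0 \<and> algebraic_int (of_int c * x))"
proof
  assume "algebraic x"
  then obtain p :: "complex poly" where p: "\<And>i. coeff p i \<in> \<int>" "p \<noteq> 0" "poly p x = 0"
    using Polynomial.algebraicE by blast
  define d where "d = degree p"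
  obtain c where c: "of_int c = lead_coeff p" using p(1) by (metis Ints_cases)
  have c0: "c \<noteq> 0" using p(2) c by auto
  show "\<exists>c::int. c \<noteq> 0 \<and> algebraic_int (of_int c * x)"
  proof (cases "d = 0")
    case True
    then obtain k where "p = [:k:]" unfolding d_def by (metis degree_eq_zeroE)
    with p show ?thesis by simp
  next
    case False
    \<comment> \<open>The coefficients of \<open>c^(d-1) p(X/c)\<close>. The top one is set to 1
      separately, because \<open>d - 1 - i\<close> is truncated to 0 at
      \<open>i = d\<close>.\<close>
    define f where "f i = (if i = d then 1 else coeff p i * of_int c ^ (d - 1 - i))" for i
    define q where "q = (\<Sum>i\<le>d. monom (f i) i)"
    have cq: "coeff q i = (if i \<le> d then f i else 0)" for i
      by (auto simp: q_def coeff_sum if_distrib cong: if_cong)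
    have f: "f i \<in> \<int>" for i using p(1) by (auto simp: f_def)
    have "degree q = d"
    proof (rule antisym)
      show "degree q \<le> d" by (rule degree_le) (simp add: cq)
      show "d \<le> degree q" by (rule le_degree) (simp add: cq f_def)
    qed
    hence "lead_coeff q = 1" by (simp add: cq f_def)
    moreover have "poly q (of_int c * x) = 0"
    proof -
      have "of_int c * (f i * (of_int c * x) ^ i) = of_int c ^ d * (coeff p i * x ^ i)" if "i \<le> d" for i
      proof (cases "i = d")
        case True
        thus ?thesis using c by (simp add: f_def d_def power_mult_distrib)
      next
        case False
        hence "d = Suc (d - 1 - i) + i" using that by simp
        hence "of_int c ^ d = of_int c * of_int c ^ (d - 1 - i) * (of_int c ^ i :: complex)"
          by (metis power_Suc power_add)
        thus ?thesis using False by (simp add: f_def power_mult_distrib)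
      qed
      hence "of_int c * poly q (of_int c * x) = of_int c ^ d * poly p x"
        unfolding q_def poly_sum poly_monom sum_distrib_left poly_altdef[of p] d_def[symmetric]
        by (intro sum.cong) auto
      with p(3) c0 show ?thesis by simp
    qed
    moreover have "coeff q i \<in> \<int>" for i by (simp add: cq f)
    ultimately have "algebraic_int (of_int c * x)" by (intro algebraic_int.intros) auto
    with c0 show ?thesis by blast
  qed
next
  assume "\<exists>c::int. c \<noteq> 0 \<and> algebraic_int (of_int c * x)"
  then obtain c :: int where c: "c \<noteq> 0" "algebraic_int (of_int c * x)" by blast
  then obtain p where p: "lead_coeff p = 1" "\<And>i. coeff p i \<in> \<int>" "poly p (of_int c * x) = 0"
    by (auto elim: algebraic_int.cases)
  define q where "q = pcompose p [:0, of_int c:]"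
  show "algebraic x"
  proof (rule algebraicI)
    show "poly q x = 0" using p by (simp add: q_def poly_pcompose mult.commute)
    show "q \<noteq> 0" using p(1) c(1) by (auto simp: q_def pcompose_eq_0_iff)
    show "coeff q i \<in> \<int>" for i
      unfolding q_def using p(2) by (intro coeff_pcompose_semiring_closed) (auto simp: coeff_pCons split: nat.splits)
  qed
qed

lemma algebraic_plus_times:
  assumes "algebraic (x :: complex)" "algebraic y"
  shows "algebraic (x + y)" "algebraic (x * y)"
proof -
  obtain c d :: int where c: "c \<noteq> 0" "algebraic_int (of_int c * x)" and d: "d \<noteq> 0" "algebraic_int (of_int d * y)"
    using assms unfolding algebraic_iff_ex_algebraic_int by blast
  have eq: "of_int (c * d) * (x + y) = of_int d * (of_int c * x) + of_int c * (of_int d * y)"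
    "of_int (c * d) * (x * y) = (of_int c * x) * (of_int d * y)" by (simp_all add: algebra_simps)
  have "algebraic_int (of_int (c * d) * (x + y))" unfolding eq
    by (intro algebraic_int_plus_times int_imp_algebraic_int c d) auto
  moreover have "algebraic_int (of_int (c * d) * (x * y))"
    unfolding eq by (rule algebraic_int_plus_times(2)[OF c(2) d(2)])
  moreover have "c * d \<noteq> 0" using c d by simp
  ultimately show "algebraic (x + y)" "algebraic (x * y)"
    unfolding algebraic_iff_ex_algebraic_int by blast+
qed

text \<open>Countability lets the later compactness argument run along sequences and a diagonal
  subsequence.\<close>

lemma countable_algebraic: "countable {x :: complex. algebraic x}"
proof -
  have "{x :: complex. algebraic x} \<subseteq> (\<Union>l :: int list. {x. poly (of_int_poly (Poly l)) x = 0 \<and> Poly l \<noteq> 0})"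
  proof clarify
    fix x :: complex assume "algebraic x"
    then obtain p :: "int poly" where "p \<noteq> 0" "poly (of_int_poly p) x = 0"
      by (elim algebraicE') (rule that)
    thus "x \<in> (\<Union>l :: int list. {x. poly (of_int_poly (Poly l)) x = 0 \<and> Poly l \<noteq> 0})"
      by (intro UN_I[of "coeffs p"]) simp_all
  qed
  moreover have "countable (\<Union>l :: int list. {x :: complex. poly (of_int_poly (Poly l)) x = 0 \<and> Poly l \<noteq> 0})"
  proof (intro countable_UN)
    fix l :: "int list"
    show "countable {x :: complex. poly (of_int_poly (Poly l)) x = 0 \<and> Poly l \<noteq> 0}"
    proof (cases "Poly l = 0")
      case False
      hence "finite {x :: complex. poly (of_int_poly (Poly l)) x = 0}" by (intro poly_roots_finite) simp
      thus ?thesis by (auto intro: countable_finite finite_subset)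
    qed simp
  qed auto
  ultimately show ?thesis by (rule countable_subset)
qed

section \<open>Ring homomorphisms and the Galois group\<close>

text \<open>The laws are imposed on \<open>S\<close> only, because a member of \<open>GalQ\<close>
  has no meaningful values outside \<open>QQbar\<close>. With the identity as \<open>h\<close> the
  locale describes a mere subring; it is also used for automorphisms, their action on polynomials,
  and complex conjugation.\<close>

locale subring_hom =
  fixes S :: "'a :: comm_ring_1 set" and h :: "'a \<Rightarrow> 'b :: comm_ring_1"
  assumes zero_closed: "0 \<in> S" and one_closed: "1 \<in> S"
    and plus_closed: "x \<in> S \<Longrightarrow> y \<in> S \<Longrightarrow> x + y \<in> S"
    and times_closed: "x \<in> S \<Longrightarrow> y \<in> S \<Longrightarrow> x * y \<in> S"
    and uminus_closed: "x \<in> S \<Longrightarrow> - x \<in> S"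
    and hom_one: "h 1 = 1"
    and hom_plus: "x \<in> S \<Longrightarrow> y \<in> S \<Longrightarrow> h (x + y) = h x + h y"
    and hom_times: "x \<in> S \<Longrightarrow> y \<in> S \<Longrightarrow> h (x * y) = h x * h y"
begin

lemma hom_zero: "h 0 = 0"
  using hom_plus[OF zero_closed zero_closed] by simp

lemma hom_uminus: "x \<in> S \<Longrightarrow> h (- x) = - h x"
  using hom_plus[of x "- x"] uminus_closed[of x] hom_zero by (simp add: eq_neg_iff_add_eq_0 add.commute)

lemma minus_closed: "x \<in> S \<Longrightarrow> y \<in> S \<Longrightarrow> x - y \<in> S"
  using plus_closed[of x "- y"] uminus_closed by simp

lemma sum_closed: "(\<And>i. i \<in> I \<Longrightarrow> f i \<in> S) \<Longrightarrow> sum f I \<in> S"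
  by (induction I rule: infinite_finite_induct) (auto intro: zero_closed plus_closed)

lemma hom_sum: "(\<And>i. i \<in> I \<Longrightarrow> f i \<in> S) \<Longrightarrow> h (sum f I) = (\<Sum>i\<in>I. h (f i))"
  by (induction I rule: infinite_finite_induct) (auto simp: hom_zero hom_plus sum_closed)

lemma prod_closed: "(\<And>i. i \<in> I \<Longrightarrow> f i \<in> S) \<Longrightarrow> prod f I \<in> S"
  by (induction I rule: infinite_finite_induct) (auto intro: one_closed times_closed)

lemma hom_prod: "(\<And>i. i \<in> I \<Longrightarrow> f i \<in> S) \<Longrightarrow> h (prod f I) = (\<Prod>i\<in>I. h (f i))"
  by (induction I rule: infinite_finite_induct) (auto simp: hom_one hom_times prod_closed)

lemma power_closed: "x \<in> S \<Longrightarrow> x ^ n \<in> S"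
  by (induction n) (auto intro: one_closed times_closed)

lemma hom_power: "x \<in> S \<Longrightarrow> h (x ^ n) = h x ^ n"
  by (induction n) (auto simp: hom_one hom_times power_closed)

lemma of_nat_closed: "of_nat n \<in> S"
  by (induction n) (auto intro: zero_closed one_closed plus_closed)

lemma of_int_closed: "of_int n \<in> S"
  by (cases n) (auto intro: of_nat_closed uminus_closed simp del: of_nat_Suc)

lemma hom_of_nat: "h (of_nat n) = of_nat n"
  by (induction n) (auto simp: hom_zero hom_one hom_plus one_closed of_nat_closed)

lemma hom_of_int: "h (of_int n) = of_int n"
  by (cases n) (auto simp: hom_of_nat hom_uminus of_nat_closed simp del: of_nat_Suc)

lemma poly_closed:
  "(\<And>i. coeff p i \<in> S) \<Longrightarrow> x \<in> S \<Longrightarrow> poly p x \<in> S"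
  unfolding poly_altdef by (intro sum_closed times_closed power_closed)

lemma hom_poly:
  assumes "\<And>i. coeff p i \<in> S" "x \<in> S"
  shows "h (poly p x) = poly (map_poly h p) (h x)"
proof -
  have "h (poly p x) = (\<Sum>i\<le>degree p. h (coeff p i) * h x ^ i)"
    unfolding poly_altdef using assms
    by (subst hom_sum) (auto intro!: sum.cong times_closed power_closed simp: hom_times power_closed hom_power)
  also have "\<dots> = poly (\<Sum>i\<le>degree p. monom (h (coeff p i)) i) (h x)"
    by (simp add: poly_sum poly_monom)
  also have "(\<Sum>i\<le>degree p. monom (h (coeff p i)) i) = map_poly h p"
    by (intro poly_eqI) (auto simp: coeff_sum coeff_map_poly hom_zero if_distrib coeff_eq_0 cong: if_cong)
  finally show ?thesis .
qed

text \<open>Applied twice, this gives the action of an automorphism on polynomials in two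
  variables.\<close>

lemma lift_poly: "subring_hom {p. \<forall>i. coeff p i \<in> S} (map_poly h)"
proof
  fix p q :: "'a poly"
  assume pq: "p \<in> {p. \<forall>i. coeff p i \<in> S}" "q \<in> {p. \<forall>i. coeff p i \<in> S}"
  show "p * q \<in> {p. \<forall>i. coeff p i \<in> S}" using pq
    by (auto simp: coeff_mult intro!: sum_closed times_closed)
  show "map_poly h (p * q) = map_poly h p * map_poly h q" using pq
    by (intro poly_eqI) (auto simp: coeff_map_poly hom_zero coeff_mult hom_sum hom_times times_closed)
  show "map_poly h (p + q) = map_poly h p + map_poly h q" using pq
    by (intro poly_eqI) (auto simp: coeff_map_poly hom_zero hom_plus)
qed (auto simp: zero_closed one_closed plus_closed uminus_closed hom_one coeff_1 map_poly_1')

lemma det_closed: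
  assumes "A \<in> carrier_mat n n" "\<And>i j. i < n \<Longrightarrow> j < n \<Longrightarrow> A $$ (i, j) \<in> S"
  shows "det A \<in> S"
  unfolding det_def'[OF assms(1)]
  by (intro sum_closed times_closed prod_closed assms(2))
     (auto simp: sign_def one_closed uminus_closed permutes_in_image[of _ "{0..<n}", simplified])

lemma hom_det:
  assumes "A \<in> carrier_mat n n" "\<And>i j. i < n \<Longrightarrow> j < n \<Longrightarrow> A $$ (i, j) \<in> S"
  shows "h (det A) = det (map_mat h A)"
proof -
  have perm: "p i < n" if "p permutes {0..<n}" "i < n" for p i
    using permutes_in_image[OF that(1), of i] that(2) by simp
  have A: "map_mat h A \<in> carrier_mat n n" using assms(1) by simp
  have sg: "signof p \<in> S" for p :: "nat \<Rightarrow> nat" by (auto simp: sign_def one_closed uminus_closed)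
  have hsg: "h (signof p) = signof p" for p :: "nat \<Rightarrow> nat"
    by (auto simp: sign_def hom_uminus hom_one one_closed)
  have pr: "(\<Prod>i = 0..<n. A $$ (i, p i)) \<in> S" if "p permutes {0..<n}" for p
    using that assms(2) perm by (intro prod_closed) auto
  have hpr: "h (\<Prod>i = 0..<n. A $$ (i, p i)) = (\<Prod>i = 0..<n. map_mat h A $$ (i, p i))"
    if "p permutes {0..<n}" for p
    using that assms perm by (subst hom_prod) auto
  show ?thesis unfolding det_def'[OF assms(1)] det_def'[OF A]
    by (subst hom_sum) (auto intro!: times_closed sg pr sum.cong simp: hom_times sg hsg pr hpr)
qed

end

section \<open>The Galois group as a group of ring automorphisms\<close>

abbreviation "QQbar \<equiv> {x :: complex. algebraic x}"
abbreviation "ZZbar \<equiv> {x :: complex. algebraic_int x}"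

lemma Qbar_simps [simp]:
  "carrier Qbar = QQbar" "x \<otimes>\<^bsub>Qbar\<^esub> y = x * y" "x \<oplus>\<^bsub>Qbar\<^esub> y = x + y" "\<one>\<^bsub>Qbar\<^esub> = 1" "\<zero>\<^bsub>Qbar\<^esub> = 0"
  by (simp_all add: Qbar_def ring_of_type_algebra_def)

lemma Zbar_simps [simp]:
  "carrier Zbar = ZZbar" "x \<otimes>\<^bsub>Zbar\<^esub> y = x * y" "x \<oplus>\<^bsub>Zbar\<^esub> y = x + y" "\<one>\<^bsub>Zbar\<^esub> = 1" "\<zero>\<^bsub>Zbar\<^esub> = 0"
  by (simp_all add: Zbar_def ring_of_type_algebra_def)

interpretation QQ: subring_hom QQbar "\<lambda>x. x"
  by unfold_locales (auto intro: algebraic_plus_times rat_imp_algebraic)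

interpretation ZZ: subring_hom ZZbar "\<lambda>x. x"
  by unfold_locales (auto intro: algebraic_int_plus_times int_imp_algebraic_int)

lemma subring_hom_QQbarI:
  assumes "\<sigma> 1 = 1" "\<And>x y. x \<in> QQbar \<Longrightarrow> y \<in> QQbar \<Longrightarrow> \<sigma> (x + y) = \<sigma> x + \<sigma> y"
    "\<And>x y. x \<in> QQbar \<Longrightarrow> y \<in> QQbar \<Longrightarrow> \<sigma> (x * y) = \<sigma> x * \<sigma> y"
  shows "subring_hom QQbar \<sigma>"
  using assms QQ.plus_closed QQ.times_closed QQ.uminus_closed QQ.zero_closed QQ.one_closed
  by unfold_locales

lemma GalQ_iff:
  "\<sigma> \<in> carrier GalQ \<longleftrightarrow> bij_betw \<sigma> QQbar QQbar \<and> \<sigma> \<in> extensional QQbar \<and> subring_hom QQbar \<sigma>"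
proof -
  have "\<sigma> \<in> carrier GalQ \<longleftrightarrow> bij_betw \<sigma> QQbar QQbar \<and> \<sigma> \<in> extensional QQbar \<and> \<sigma> 1 = 1 \<and>
    (\<forall>x\<in>QQbar. \<forall>y\<in>QQbar. \<sigma> (x * y) = \<sigma> x * \<sigma> y \<and> \<sigma> (x + y) = \<sigma> x + \<sigma> y)"
    by (auto simp: GalQ_def ring_iso_def Ring.ring_hom_def Bij_def dest: bij_betwE)
  also have "\<dots> \<longleftrightarrow> bij_betw \<sigma> QQbar QQbar \<and> \<sigma> \<in> extensional QQbar \<and> subring_hom QQbar \<sigma>"
  proof (intro conj_cong refl iffI)
    assume "\<sigma> 1 = 1 \<and> (\<forall>x\<in>QQbar. \<forall>y\<in>QQbar. \<sigma> (x * y) = \<sigma> x * \<sigma> y \<and> \<sigma> (x + y) = \<sigma> x + \<sigma> y)"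
    thus "subring_hom QQbar \<sigma>" by (intro subring_hom_QQbarI) blast+
  next
    assume "subring_hom QQbar \<sigma>"
    then interpret subring_hom QQbar \<sigma> .
    show "\<sigma> 1 = 1 \<and> (\<forall>x\<in>QQbar. \<forall>y\<in>QQbar. \<sigma> (x * y) = \<sigma> x * \<sigma> y \<and> \<sigma> (x + y) = \<sigma> x + \<sigma> y)"
      using hom_one hom_plus hom_times by blast
  qed
  finally show ?thesis .
qed

lemma GalQ_subgroup: "subgroup (carrier GalQ) (BijGroup QQbar)"
proof (rule group.subgroupI[OF group_BijGroup])
  show "carrier GalQ \<subseteq> carrier (BijGroup QQbar)"
    by (auto simp: GalQ_iff BijGroup_def Bij_def)
  have "subring_hom QQbar (\<lambda>x\<in>QQbar. x)"
    by (intro subring_hom_QQbarI) (auto simp: algebraic_plus_times)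
  hence "(\<lambda>x\<in>QQbar. x) \<in> carrier GalQ"
    by (auto simp: GalQ_iff bij_betw_def inj_on_def)
  thus "carrier GalQ \<noteq> {}" by blast
next
  fix \<sigma> assume s: "\<sigma> \<in> carrier GalQ"
  hence B: "\<sigma> \<in> Bij QQbar" by (auto simp: GalQ_iff Bij_def)
  interpret subring_hom QQbar \<sigma> using s by (simp add: GalQ_iff)
  define \<tau> where "\<tau> = restrict (inv_into QQbar \<sigma>) QQbar"
  have bij: "bij_betw \<tau> QQbar QQbar"
    using restrict_inv_into_Bij[OF B] by (simp add: \<tau>_def Bij_def)
  have surj: "\<exists>y\<in>QQbar. x = \<sigma> y" if "x \<in> QQbar" for x
    using s that by (auto simp: GalQ_iff bij_betw_def)
  have inv: "\<tau> (\<sigma> x) = x" if "x \<in> QQbar" for x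
    using s that by (auto simp: GalQ_iff \<tau>_def bij_betw_def)
  have "subring_hom QQbar \<tau>"
  proof (rule subring_hom_QQbarI)
    show "\<tau> 1 = 1" using inv[OF one_closed] by (simp add: hom_one)
  next
    fix x y assume "x \<in> QQbar" "y \<in> QQbar"
    then obtain u v where uv: "u \<in> QQbar" "x = \<sigma> u" "v \<in> QQbar" "y = \<sigma> v" using surj by meson
    show "\<tau> (x + y) = \<tau> x + \<tau> y" unfolding uv(2,4)
      by (subst hom_plus[OF uv(1,3), symmetric]) (simp only: inv uv plus_closed)
    show "\<tau> (x * y) = \<tau> x * \<tau> y" unfolding uv(2,4)
      by (subst hom_times[OF uv(1,3), symmetric]) (simp only: inv uv times_closed)
  qed
  with bij have "\<tau> \<in> carrier GalQ" by (auto simp: GalQ_iff \<tau>_def)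
  thus "inv\<^bsub>BijGroup QQbar\<^esub> \<sigma> \<in> carrier GalQ" using B by (simp add: inv_BijGroup \<tau>_def)
next
  fix \<sigma> \<tau> assume st: "\<sigma> \<in> carrier GalQ" "\<tau> \<in> carrier GalQ"
  hence B: "\<sigma> \<in> Bij QQbar" "\<tau> \<in> Bij QQbar" by (auto simp: GalQ_iff Bij_def)
  interpret s: subring_hom QQbar \<sigma> using st by (simp add: GalQ_iff)
  interpret t: subring_hom QQbar \<tau> using st by (simp add: GalQ_iff)
  have t: "\<tau> x \<in> QQbar" if "x \<in> QQbar" for x using st that by (auto simp: GalQ_iff bij_betw_def)
  have "subring_hom QQbar (compose QQbar \<sigma> \<tau>)"
    using t by (intro subring_hom_QQbarI) (auto simp: compose_def algebraic_plus_times s.hom_one t.hom_one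
       t.hom_plus t.hom_times s.hom_plus s.hom_times)
  with compose_Bij[OF B] show "\<sigma> \<otimes>\<^bsub>BijGroup QQbar\<^esub> \<tau> \<in> carrier GalQ"
    using B by (simp add: BijGroup_def GalQ_iff Bij_def)
qed

lemma GalQ_eq: "GalQ = BijGroup QQbar \<lparr>carrier := carrier GalQ\<rparr>"
  by (simp add: GalQ_def)

interpretation GalQ: group GalQ
  by (subst GalQ_eq) (rule subgroup.subgroup_is_group[OF GalQ_subgroup group_BijGroup])

lemma GalQ_hom: "\<sigma> \<in> carrier GalQ \<Longrightarrow> subring_hom QQbar \<sigma>"
  by (simp add: GalQ_iff)

lemma GalQ_closed: "\<sigma> \<in> carrier GalQ \<Longrightarrow> x \<in> QQbar \<Longrightarrow> \<sigma> x \<in> QQbar"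
  by (auto simp: GalQ_iff bij_betw_def)

lemma GalQ_inj: "\<sigma> \<in> carrier GalQ \<Longrightarrow> x \<in> QQbar \<Longrightarrow> y \<in> QQbar \<Longrightarrow> \<sigma> x = \<sigma> y \<longleftrightarrow> x = y"
  by (auto simp: GalQ_iff bij_betw_def inj_on_def)

lemma GalQ_mult:
  assumes "\<sigma> \<in> carrier GalQ" "\<tau> \<in> carrier GalQ" "x \<in> QQbar"
  shows "(\<sigma> \<otimes>\<^bsub>GalQ\<^esub> \<tau>) x = \<sigma> (\<tau> x)"
proof -
  have "\<sigma> \<in> Bij QQbar" "\<tau> \<in> Bij QQbar" using assms by (auto simp: GalQ_iff Bij_def)
  thus ?thesis using assms(3) by (subst GalQ_eq) (simp add: BijGroup_def compose_def)
qed

lemma GalQ_one: "x \<in> QQbar \<Longrightarrow> \<one>\<^bsub>GalQ\<^esub> x = x"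
  by (subst GalQ_eq) (simp add: BijGroup_def)

lemma GalQ_inv:
  assumes "\<sigma> \<in> carrier GalQ" "x \<in> QQbar"
  shows "(inv\<^bsub>GalQ\<^esub> \<sigma>) (\<sigma> x) = x" "\<sigma> ((inv\<^bsub>GalQ\<^esub> \<sigma>) x) = x"
  using GalQ_mult[OF GalQ.inv_closed[OF assms(1)] assms] GalQ_mult[OF assms(1) GalQ.inv_closed[OF assms(1)] assms(2)]
    assms GalQ_one by simp_all

text \<open>Automorphisms fix the integers, hence the coefficients. This is why they preserve
  integrality and why orbits of algebraic numbers are finite.\<close>

lemma GalQ_int_poly_root:
  assumes "\<sigma> \<in> carrier GalQ" "x \<in> QQbar" "poly (of_int_poly p) x = 0"
  shows "poly (of_int_poly p) (\<sigma> x) = 0"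
proof -
  interpret subring_hom QQbar \<sigma> using assms by (simp add: GalQ_iff)
  have "map_poly \<sigma> (of_int_poly p) = of_int_poly p"
    by (intro poly_eqI) (simp add: coeff_map_poly hom_zero hom_of_int)
  moreover have "\<sigma> (poly (of_int_poly p) x) = poly (map_poly \<sigma> (of_int_poly p)) (\<sigma> x)"
    using assms(2) by (intro hom_poly) (auto simp: of_int_closed[simplified])
  ultimately show ?thesis using assms(3) hom_zero by simp
qed

lemma GalQ_closed_ZZbar:
  assumes "\<sigma> \<in> carrier GalQ" "x \<in> ZZbar"
  shows "\<sigma> x \<in> ZZbar"
proof -
  from assms(2) obtain p where p: "poly (of_int_poly p) x = 0" "lead_coeff p = 1"
    by (auto simp: algebraic_int_altdef_ipoly)
  have "x \<in> QQbar" using assms(2) by auto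
  from GalQ_int_poly_root[OF assms(1) this p(1)] have "poly (of_int_poly p) (\<sigma> x) = 0" .
  with p(2) show ?thesis unfolding mem_Collect_eq algebraic_int_altdef_ipoly by blast
qed

lemma GalQ_hom_ZZbar:
  assumes "\<sigma> \<in> carrier GalQ"
  shows "subring_hom ZZbar \<sigma>"
proof -
  interpret subring_hom QQbar \<sigma> using assms by (rule GalQ_hom)
  show ?thesis
  proof
    fix x y assume "x \<in> ZZbar" "y \<in> ZZbar"
    hence "x \<in> QQbar" "y \<in> QQbar" by auto
    thus "\<sigma> (x + y) = \<sigma> x + \<sigma> y" "\<sigma> (x * y) = \<sigma> x * \<sigma> y" by (rule hom_plus hom_times)+
  qed (fact ZZ.zero_closed ZZ.one_closed ZZ.plus_closed ZZ.times_closed ZZ.uminus_closed hom_one)+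
qed

lemma complex_conjugation_GalQ: "complex_conjugation \<in> carrier GalQ"
proof -
  have "bij_betw cnj QQbar QQbar"
    by (rule bij_betw_byWitness[of _ cnj]) auto
  hence "bij_betw complex_conjugation QQbar QQbar"
    using bij_betw_cong[of QQbar complex_conjugation cnj QQbar] by (simp add: complex_conjugation_def)
  moreover have "subring_hom QQbar complex_conjugation"
    by (intro subring_hom_QQbarI) (auto simp: complex_conjugation_def algebraic_plus_times)
  ultimately show ?thesis by (simp add: GalQ_iff complex_conjugation_def)
qed

section \<open>Extension of embeddings\<close>

text \<open>An isomorphism between two subrings of \<open>QQbar\<close>, encoded as its graph, a
  subring of the product of two copies of the complex numbers. The clause on zeros makes both
  projections injective. The encoding is symmetric, so the inverse isomorphism is the converse
  relation, and extension is inclusion, ready for Zorn's lemma.\<close>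

definition embedding_graph :: "(complex \<times> complex) set \<Rightarrow> bool" where
  "embedding_graph R \<longleftrightarrow> (1, 1) \<in> R \<and>
     (\<forall>x y u v. (x, y) \<in> R \<longrightarrow> (u, v) \<in> R \<longrightarrow> (x + u, y + v) \<in> R \<and> (x * u, y * v) \<in> R) \<and>
     (\<forall>x y. (x, y) \<in> R \<longrightarrow> (- x, - y) \<in> R \<and> algebraic x \<and> algebraic y \<and> (x = 0 \<longleftrightarrow> y = 0))"

text \<open>For an embedding graph this makes domain and range subfields; zero needs no exception,
  as \<open>inverse 0 = 0\<close>.\<close>

definition inverse_closed :: "(complex \<times> complex) set \<Rightarrow> bool" where
  "inverse_closed R \<longleftrightarrow> (\<forall>x y. (x, y) \<in> R \<longrightarrow> (inverse x, inverse y) \<in> R)"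

definition poly_graph :: "(complex \<times> complex) set \<Rightarrow> (complex poly \<times> complex poly) set" where
  "poly_graph R = {(p, q). \<forall>i. (coeff p i, coeff q i) \<in> R}"

context
  fixes R assumes R: "embedding_graph R"
begin

lemma embedding_graph_rules:
  "(1, 1) \<in> R" "(x, y) \<in> R \<Longrightarrow> (u, v) \<in> R \<Longrightarrow> (x + u, y + v) \<in> R"
  "(x, y) \<in> R \<Longrightarrow> (u, v) \<in> R \<Longrightarrow> (x * u, y * v) \<in> R"
  "(x, y) \<in> R \<Longrightarrow> (- x, - y) \<in> R" "(x, y) \<in> R \<Longrightarrow> algebraic x" "(x, y) \<in> R \<Longrightarrow> algebraic y"
  "(x, y) \<in> R \<Longrightarrow> x = 0 \<longleftrightarrow> y = 0"
  using R unfolding embedding_graph_def by blast+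

lemma embedding_graph_zero: "(0, 0) \<in> R"
  using embedding_graph_rules(2)[OF embedding_graph_rules(1) embedding_graph_rules(4)[OF embedding_graph_rules(1)]]
  by simp

lemma embedding_graph_diff: "(x, y) \<in> R \<Longrightarrow> (u, v) \<in> R \<Longrightarrow> (x - u, y - v) \<in> R"
  using embedding_graph_rules(2)[of x y "- u" "- v"] embedding_graph_rules(4)[of u v] by simp

lemma embedding_graph_sum:
  "(\<And>i. i \<in> I \<Longrightarrow> (f i, g i) \<in> R) \<Longrightarrow> (sum f I, sum g I) \<in> R"
  by (induction I rule: infinite_finite_induct) (auto intro: embedding_graph_zero embedding_graph_rules(2))

lemma embedding_graph_of_nat: "(of_nat n, of_nat n) \<in> R"
  by (induction n) (auto intro: embedding_graph_zero embedding_graph_rules)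

lemma embedding_graph_of_int: "(of_int n, of_int n) \<in> R"
  by (cases n) (auto intro: embedding_graph_of_nat embedding_graph_rules simp del: of_nat_Suc)

lemma poly_graph_rules:
  assumes "(p, p') \<in> poly_graph R" "(q, q') \<in> poly_graph R"
  shows "(p + q, p' + q') \<in> poly_graph R" "(p - q, p' - q') \<in> poly_graph R" "(p * q, p' * q') \<in> poly_graph R"
  using assms unfolding poly_graph_def
  by (auto simp: coeff_mult intro!: embedding_graph_sum intro: embedding_graph_rules embedding_graph_diff)

lemma poly_graph_monom: "(x, y) \<in> R \<Longrightarrow> (monom x n, monom y n) \<in> poly_graph R"
  unfolding poly_graph_def by (auto simp: embedding_graph_zero)

lemma poly_graph_zero: "(0, 0) \<in> poly_graph R"
  unfolding poly_graph_def by (auto simp: embedding_graph_zero)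

lemma poly_graph_degree:
  assumes "(p, p') \<in> poly_graph R"
  shows "degree p = degree p'" "p = 0 \<longleftrightarrow> p' = 0"
proof -
  have *: "coeff p i = 0 \<longleftrightarrow> coeff p' i = 0" for i
    using assms embedding_graph_rules(7) unfolding poly_graph_def by blast
  thus "degree p = degree p'" unfolding Polynomial.degree_def by simp
  from * show "p = 0 \<longleftrightarrow> p' = 0" by (simp add: poly_eq_iff)
qed

text \<open>Division with remainder is run on \<open>p\<close> and on its image in parallel; the
  degrees agree because corresponding coefficients vanish together.\<close>

lemma poly_graph_div:
  assumes "inverse_closed R" "(f, f') \<in> poly_graph R" "f \<noteq> 0" "(p, p') \<in> poly_graph R"
  shows "\<exists>q q' r r'. (q, q') \<in> poly_graph R \<and> (r, r') \<in> poly_graph R \<and> p = q * f + r \<and> p' = q' * f' + r' \<and>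
    (r = 0 \<or> degree r < degree f)"
  using assms(4)
proof (induction "degree p" arbitrary: p p' rule: less_induct)
  case less
  show ?case
  proof (cases "p = 0 \<or> degree p < degree f")
    case True
    with less.prems show ?thesis
      by (intro exI[of _ 0] exI[of _ p] exI[of _ p']) (auto intro: poly_graph_zero)
  next
    case False
    note f' = poly_graph_degree[OF assms(2)] and p' = poly_graph_degree[OF less.prems]
    define n where "n = degree p - degree f"
    have n: "degree p = n + degree f" using False by (simp add: n_def)
    define m where "m = monom (lead_coeff p * inverse (lead_coeff f)) n"
    define m' where "m' = monom (lead_coeff p' * inverse (lead_coeff f')) n"
    have "(lead_coeff p * inverse (lead_coeff f), lead_coeff p' * inverse (lead_coeff f')) \<in> R"
      using assms(1,2) less.prems unfolding inverse_closed_def poly_graph_def f'(1) p'(1)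
      by (intro embedding_graph_rules(3)) auto
    hence m: "(m, m') \<in> poly_graph R" unfolding m_def m'_def by (rule poly_graph_monom)
    define r where "r = p - m * f"
    define r' where "r' = p' - m' * f'"
    have r: "(r, r') \<in> poly_graph R" unfolding r_def r'_def
      by (intro poly_graph_rules less.prems m assms)
    have dm: "degree (m * f) = degree p" "lead_coeff (m * f) = lead_coeff p"
    proof -
      define c where "c = lead_coeff p * inverse (lead_coeff f)"
      have c: "c \<noteq> 0" using False assms(3) by (simp add: c_def)
      hence "degree m = n" "lead_coeff m = c" unfolding m_def c_def[symmetric] by (simp_all add: degree_monom_eq)
      moreover have "m \<noteq> 0" using c by (simp add: m_def flip: c_def)
      moreover have "c * lead_coeff f = lead_coeff p" using assms(3) by (simp add: c_def)
      ultimately show "degree (m * f) = degree p" "lead_coeff (m * f) = lead_coeff p"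
        using degree_mult_eq[of m f] lead_coeff_mult[of m f] assms(3) n by simp_all
    qed
    hence cr: "coeff r k = 0" if "k \<ge> degree p" for k
      using that by (cases "k = degree p") (auto simp: r_def coeff_eq_0 le_less)
    have "\<exists>q q' s s'. (q, q') \<in> poly_graph R \<and> (s, s') \<in> poly_graph R \<and> r = q * f + s \<and> r' = q' * f' + s' \<and>
      (s = 0 \<or> degree s < degree f)"
    proof (cases "degree p = 0")
      case True
      hence "r = 0" using cr by (simp add: poly_eq_iff)
      thus ?thesis using r poly_graph_degree[OF r] poly_graph_zero
        by (intro exI[of _ 0]) auto
    next
      case nz: False
      have "degree r < degree p"
      proof (rule degree_lessI)
        show "r \<noteq> 0 \<or> degree p > 0" using nz by simp
        show "\<forall>k\<ge>degree p. coeff r k = 0"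
          using cr by blast
      qed
      from less.hyps[OF this r] show ?thesis .
    qed
    then obtain q q' s s' where q: "(q, q') \<in> poly_graph R" "(s, s') \<in> poly_graph R" "r = q * f + s" "r' = q' * f' + s'"
      "s = 0 \<or> degree s < degree f" by blast
    have "p = (m + q) * f + s" "p' = (m' + q') * f' + s'"
      using q(3,4) by (simp_all add: r_def r'_def algebra_simps)
    moreover have "(m + q, m' + q') \<in> poly_graph R" by (rule poly_graph_rules(1)[OF m q(1)])
    ultimately show ?thesis using q(2,5) by blast
  qed
qed

lemma embedding_graph_poly:
  assumes "\<And>i. (coeff p i, coeff q i) \<in> R" "algebraic \<theta>"
  shows "algebraic (poly p \<theta>)"
  using assms by (intro CollectD[OF QQ.poly_closed]) (auto intro: embedding_graph_rules)

end

text \<open>\<open>f\<close> is a minimal polynomial of \<open>\<theta>\<close> over the domain of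
  \<open>R\<close>, not normalised to be monic, and \<open>f'\<close> is its image under the
  isomorphism.\<close>

definition minimal_pair :: "(complex \<times> complex) set \<Rightarrow> complex \<Rightarrow> complex poly \<Rightarrow> complex poly \<Rightarrow> bool" where
  "minimal_pair R \<theta> f f' \<longleftrightarrow> (f, f') \<in> poly_graph R \<and> f \<noteq> 0 \<and> poly f \<theta> = 0 \<and>
     (\<forall>g g'. (g, g') \<in> poly_graph R \<longrightarrow> g \<noteq> 0 \<longrightarrow> poly g \<theta> = 0 \<longrightarrow> degree f \<le> degree g)"

lemma minimal_pair_dvd:
  assumes R: "embedding_graph R" "inverse_closed R" and f: "minimal_pair R \<theta> f f'"
    and p: "(p, p') \<in> poly_graph R" "poly p \<theta> = 0"
  shows "\<exists>q q'. (q, q') \<in> poly_graph R \<and> p = q * f \<and> p' = q' * f'"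
proof -
  from f have f': "(f, f') \<in> poly_graph R" "f \<noteq> 0" "poly f \<theta> = 0" by (auto simp: minimal_pair_def)
  from poly_graph_div[OF R f'(1,2) p(1)] obtain q q' r r' where
    q: "(q, q') \<in> poly_graph R" "(r, r') \<in> poly_graph R" "p = q * f + r" "p' = q' * f' + r'"
    "r = 0 \<or> degree r < degree f" by blast
  have "poly r \<theta> = 0" using p(2) f'(3) q(3) by simp
  hence "r = 0" using q(2,5) f unfolding minimal_pair_def by (metis not_le)
  moreover have "r' = 0" using poly_graph_degree(2)[OF R(1) q(2)] \<open>r = 0\<close> by simp
  ultimately show ?thesis using q by auto
qed

lemma ex_minimal_pair:
  assumes "(p, p') \<in> poly_graph R" "p \<noteq> 0" "poly p \<theta> = 0"
  shows "\<exists>f f'. minimal_pair R \<theta> f f'"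
proof -
  define P where "P f \<longleftrightarrow> (\<exists>f'. (f, f') \<in> poly_graph R) \<and> f \<noteq> 0 \<and> poly f \<theta> = 0" for f
  have "P p" using assms by (auto simp: P_def)
  from ex_has_least_nat[of P p degree, OF this] obtain f where f: "P f" "\<And>g. P g \<Longrightarrow> degree f \<le> degree g" by blast
  from f(1) obtain f' where f': "(f, f') \<in> poly_graph R" by (auto simp: P_def)
  have "minimal_pair R \<theta> f f'" unfolding minimal_pair_def
    using f' f by (auto simp: P_def)
  thus ?thesis by blast
qed

lemma poly_graph_converse: "(q, p) \<in> poly_graph (R\<inverse>) \<longleftrightarrow> (p, q) \<in> poly_graph R"
  by (simp add: poly_graph_def)

lemma embedding_graph_converse: "embedding_graph R \<Longrightarrow> embedding_graph (R\<inverse>)"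
  unfolding embedding_graph_def by blast

lemma inverse_closed_converse: "inverse_closed R \<Longrightarrow> inverse_closed (R\<inverse>)"
  unfolding inverse_closed_def by blast

text \<open>Irreducibility carried across the isomorphism. A minimal polynomial of
  \<open>\<theta>'\<close> divides \<open>f'\<close>; its preimage \<open>g\<close> divides
  \<open>f\<close>, and the minimality of \<open>f\<close> forces \<open>g\<close> to vanish at
  \<open>\<theta>\<close>, so the degrees agree.\<close>

lemma minimal_pair_converse:
  assumes R: "embedding_graph R" "inverse_closed R" and f: "minimal_pair R \<theta> f f'"
    and root: "poly f' \<theta>' = 0"
  shows "minimal_pair (R\<inverse>) \<theta>' f' f"
proof -
  from f have f': "(f, f') \<in> poly_graph R" "f \<noteq> 0" "poly f \<theta> = 0" by (auto simp: minimal_pair_def)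
  note deg = poly_graph_degree[OF R(1) f'(1)]
  note R' = embedding_graph_converse[OF R(1)] inverse_closed_converse[OF R(2)]
  obtain g' g where g: "minimal_pair (R\<inverse>) \<theta>' g' g"
    using ex_minimal_pair[of f' f "R\<inverse>" \<theta>'] f' deg root by (auto simp: poly_graph_converse)
  hence g': "(g, g') \<in> poly_graph R" "g' \<noteq> 0" "poly g' \<theta>' = 0"
    by (auto simp: minimal_pair_def poly_graph_converse)
  note degg = poly_graph_degree[OF R(1) g'(1)]
  obtain q' q where q: "(q, q') \<in> poly_graph R" "f' = q' * g'" "f = q * g"
    using minimal_pair_dvd[OF R' g, of f' f] f' root by (auto simp: poly_graph_converse)
  have qn: "q \<noteq> 0" "g \<noteq> 0" using q(3) f'(2) by auto
  have dsum: "degree f = degree q + degree g" using q(3) qn by (simp add: degree_mult_eq)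
  have "degree g > 0"
  proof (rule ccontr)
    assume "\<not> ?thesis"
    hence "degree g' = 0" using degg by simp
    then obtain c where "g' = [:c:]" by (metis degree_eq_zeroE)
    with g'(2,3) show False by simp
  qed
  \<comment> \<open>Since \<open>g\<close> is not constant, \<open>q\<close> has smaller degree than
    \<open>f\<close>.\<close>
  hence "poly q \<theta> \<noteq> 0"
    using f q(1) qn dsum unfolding minimal_pair_def by (metis add_le_same_cancel1 not_le)
  hence "poly g \<theta> = 0" using f'(3) q(3) by simp
  hence "degree f \<le> degree g" using f g'(1) qn unfolding minimal_pair_def by blast
  hence "degree f' \<le> degree g'" using deg degg by simp
  thus ?thesis using g f' deg root unfolding minimal_pair_def
    by (auto simp: poly_graph_converse intro: order.trans)
qed

text \<open>Evaluate corresponding polynomials at \<open>\<theta>\<close> and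
  \<open>\<theta>'\<close>. By divisibility by the minimal polynomials on either side, one value
  vanishes exactly when the other does, so the result is again the graph of an isomorphism.\<close>

lemma embedding_graph_extend:
  assumes R: "embedding_graph R" "inverse_closed R" and f: "minimal_pair R \<theta> f f'"
    and \<theta>: "algebraic \<theta>" and root: "poly f' \<theta>' = 0"
  shows "\<exists>R'. embedding_graph R' \<and> R \<subseteq> R' \<and> (\<theta>, \<theta>') \<in> R'"
proof -
  note fc = minimal_pair_converse[OF R f root]
  note R' = embedding_graph_converse[OF R(1)] inverse_closed_converse[OF R(2)]
  from f have f': "(f, f') \<in> poly_graph R" "f \<noteq> 0" "poly f \<theta> = 0" by (auto simp: minimal_pair_def)
  have iff: "poly p \<theta> = 0 \<longleftrightarrow> poly p' \<theta>' = 0" if p: "(p, p') \<in> poly_graph R" for p p'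
  proof
    assume "poly p \<theta> = 0"
    with minimal_pair_dvd[OF R f p] root show "poly p' \<theta>' = 0" by auto
  next
    assume "poly p' \<theta>' = 0"
    with minimal_pair_dvd[OF R' fc, of p' p] p f'(3) show "poly p \<theta> = 0" by (auto simp: poly_graph_converse)
  qed
  from \<theta> obtain q :: "int poly" where q: "q \<noteq> 0" "poly (of_int_poly q) \<theta> = 0"
    by (elim algebraicE') (rule that)
  have "(of_int_poly q, of_int_poly q) \<in> poly_graph R"
    by (simp add: poly_graph_def embedding_graph_of_int[OF R(1)])
  from iff[OF this] q(2) have "poly (of_int_poly q) \<theta>' = 0" by simp
  hence \<theta>': "algebraic \<theta>'" using q(1) by (intro algebraicI[of "of_int_poly q"]) auto
  define R' where "R' = {(poly p \<theta>, poly p' \<theta>') | p p'. (p, p') \<in> poly_graph R}"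
  have emb: "embedding_graph R'" unfolding embedding_graph_def
  proof (intro conjI allI impI)
    have "(1, 1) \<in> poly_graph R" using poly_graph_monom[OF R(1) embedding_graph_rules(1)[OF R(1)], of 0]
      by (simp add: monom_0 one_pCons)
    thus "(1, 1) \<in> R'" unfolding R'_def by force
  next
    fix x y u v assume "(x, y) \<in> R'" "(u, v) \<in> R'"
    then obtain p p' q q' where *: "(p, p') \<in> poly_graph R" "(q, q') \<in> poly_graph R"
      "x = poly p \<theta>" "y = poly p' \<theta>'" "u = poly q \<theta>" "v = poly q' \<theta>'" by (auto simp: R'_def)
    show "(x + u, y + v) \<in> R'" "(x * u, y * v) \<in> R'"
      unfolding R'_def using poly_graph_rules[OF R(1) *(1,2)] *(3-6)
      by (force simp flip: poly_add poly_mult)+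
  next
    fix x y assume "(x, y) \<in> R'"
    then obtain p p' where *: "(p, p') \<in> poly_graph R" "x = poly p \<theta>" "y = poly p' \<theta>'" by (auto simp: R'_def)
    show "(- x, - y) \<in> R'"
      unfolding R'_def using poly_graph_rules(2)[OF R(1) poly_graph_zero[OF R(1)] *(1)] *(2,3)
      by (force simp flip: poly_minus)
    show "x = 0 \<longleftrightarrow> y = 0" using iff[OF *(1)] *(2,3) by simp
    show "algebraic x" unfolding *(2)
      by (rule embedding_graph_poly[OF R(1) _ \<theta>, of _ p']) (use *(1) in \<open>simp add: poly_graph_def\<close>)
    show "algebraic y" unfolding *(3)
      by (rule embedding_graph_poly[OF R'(1) _ \<theta>', of _ p]) (use *(1) in \<open>simp add: poly_graph_def\<close>)
  qed
  moreover have "R \<subseteq> R'"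
  proof clarify
    fix x y assume "(x, y) \<in> R"
    hence "([:x:], [:y:]) \<in> poly_graph R" using poly_graph_monom[OF R(1), of x y 0] by (simp add: monom_0)
    thus "(x, y) \<in> R'" unfolding R'_def by force
  qed
  moreover have "(\<theta>, \<theta>') \<in> R'"
  proof -
    have "([:0, 1:], [:0, 1:]) \<in> poly_graph R"
      using poly_graph_monom[OF R(1) embedding_graph_rules(1)[OF R(1)], of 1] by (simp add: monom_Suc monom_0)
    thus ?thesis unfolding R'_def by force
  qed
  ultimately show ?thesis by blast
qed

text \<open>A maximal embedding graph is therefore closed under inverses, as division with remainder
  requires.\<close>

lemma embedding_graph_fractions:
  assumes R: "embedding_graph R"
  shows "\<exists>R'. embedding_graph R' \<and> inverse_closed R' \<and> R \<subseteq> R'"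
proof -
  note rules = embedding_graph_rules[OF R]
  define R' where "R' = {(x / u, y / v) | x y u v. (x, y) \<in> R \<and> (u, v) \<in> R \<and> u \<noteq> 0}"
  have R'I: "(a, b) \<in> R'" if "(x, y) \<in> R" "(u, v) \<in> R" "u \<noteq> 0" "a = x / u" "b = y / v" for a b x y u v
    using that unfolding R'_def by blast
  have "embedding_graph R'" unfolding embedding_graph_def
  proof (intro conjI allI impI)
    show "(1, 1) \<in> R'" by (rule R'I[OF rules(1) rules(1)]) auto
  next
    fix a b c d assume "(a, b) \<in> R'" "(c, d) \<in> R'"
    then obtain x y u v x' y' u' v' where *: "(x, y) \<in> R" "(u, v) \<in> R" "u \<noteq> 0" "a = x / u" "b = y / v"
      "(x', y') \<in> R" "(u', v') \<in> R" "u' \<noteq> 0" "c = x' / u'" "d = y' / v'" unfolding R'_def by blast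
    have nz: "v \<noteq> 0" "v' \<noteq> 0" using rules(7)[OF *(2)] rules(7)[OF *(7)] * by auto
    show "(a + c, b + d) \<in> R'"
      by (rule R'I[OF rules(2)[OF rules(3)[OF *(1) *(7)] rules(3)[OF *(6) *(2)]] rules(3)[OF *(2) *(7)]])
         (use * nz in \<open>auto simp: field_simps\<close>)
    show "(a * c, b * d) \<in> R'"
      by (rule R'I[OF rules(3)[OF *(1) *(6)] rules(3)[OF *(2) *(7)]]) (use * in auto)
  next
    fix a b assume "(a, b) \<in> R'"
    then obtain x y u v where *: "(x, y) \<in> R" "(u, v) \<in> R" "u \<noteq> 0" "a = x / u" "b = y / v"
      unfolding R'_def by blast
    show "(- a, - b) \<in> R'" by (rule R'I[OF rules(4)[OF *(1)] *(2,3)]) (use * in auto)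
    have nz: "v \<noteq> 0" using rules(7)[OF *(2)] * by auto
    show "a = 0 \<longleftrightarrow> b = 0" using * nz rules(7)[OF *(1)] by simp
    show "algebraic a" "algebraic b" unfolding *(4,5) divide_inverse
      using rules(5,6)[OF *(1)] rules(5,6)[OF *(2)] by (auto intro!: algebraic_plus_times)
  qed
  moreover have "inverse_closed R'" unfolding inverse_closed_def
  proof (intro allI impI)
    fix a b assume "(a, b) \<in> R'"
    then obtain x y u v where *: "(x, y) \<in> R" "(u, v) \<in> R" "u \<noteq> 0" "a = x / u" "b = y / v"
      unfolding R'_def by blast
    show "(inverse a, inverse b) \<in> R'"
    proof (cases "x = 0")
      case True
      hence "inverse a = 0" "inverse b = 0" using * rules(7)[OF *(1)] by auto
      thus ?thesis by (intro R'I[OF embedding_graph_zero[OF R] rules(1)]) auto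
    qed (use * in \<open>auto intro: R'I[OF *(2,1)]\<close>)
  qed
  moreover have "R \<subseteq> R'" by (auto intro: R'I[OF _ rules(1)])
  ultimately show ?thesis by blast
qed

text \<open>Zorn's lemma gives a maximal extension. It is defined on all of \<open>QQbar\<close>,
  since a further algebraic number could be adjoined, and so is its converse, which makes it an
  automorphism.\<close>

lemma embedding_graph_extends_to_GalQ:
  assumes R0: "embedding_graph R0"
  shows "\<exists>\<sigma>\<in>carrier GalQ. \<forall>(x, y)\<in>R0. \<sigma> x = y"
proof -
  define A where "A = {R. embedding_graph R \<and> R0 \<subseteq> R}"
  have "\<exists>N\<in>A. \<forall>E'\<in>A. N \<subseteq> E' \<longrightarrow> E' = N"
  proof (rule subset_Zorn_nonempty)
    show "A \<noteq> {}" using R0 by (auto simp: A_def)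
    fix \<C> assume \<C>: "\<C> \<noteq> {}" "subset.chain A \<C>"
    have CA: "embedding_graph E" "R0 \<subseteq> E" if "E \<in> \<C>" for E
      using that \<C>(2) by (auto simp: subset.chain_def A_def)
    have dir: "\<exists>F\<in>\<C>. E \<subseteq> F \<and> E' \<subseteq> F" if "E \<in> \<C>" "E' \<in> \<C>" for E E'
    proof -
      have "E \<subseteq> E' \<or> E' \<subseteq> E" using that \<C>(2) unfolding subset_chain_def by blast
      with that show ?thesis by blast
    qed
    have "embedding_graph (\<Union>\<C>)" unfolding embedding_graph_def
    proof (intro conjI allI impI)
      show "(1, 1) \<in> \<Union>\<C>" using \<C>(1) CA(1) embedding_graph_rules(1) by blast
    next
      fix x y u v assume "(x, y) \<in> \<Union>\<C>" "(u, v) \<in> \<Union>\<C>"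
      then obtain E E' where "E \<in> \<C>" "E' \<in> \<C>" "(x, y) \<in> E" "(u, v) \<in> E'" by blast
      with dir obtain F where "F \<in> \<C>" "(x, y) \<in> F" "(u, v) \<in> F" by blast
      with CA(1) embedding_graph_rules(2,3) show "(x + u, y + v) \<in> \<Union>\<C>" "(x * u, y * v) \<in> \<Union>\<C>" by blast+
    next
      fix x y assume "(x, y) \<in> \<Union>\<C>"
      then obtain E where E: "E \<in> \<C>" "(x, y) \<in> E" by blast
      note r = embedding_graph_rules(4-7)[OF CA(1)[OF E(1)] E(2)]
      show "(- x, - y) \<in> \<Union>\<C>" "algebraic x" "algebraic y" "x = 0 \<longleftrightarrow> y = 0" using r E(1) by blast+
    qed
    thus "\<Union>\<C> \<in> A" using \<C>(1) CA(2) by (auto simp: A_def)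
  qed
  then obtain M where M0: "M \<in> A" "\<forall>Y\<in>A. M \<subseteq> Y \<longrightarrow> Y = M" by (elim bexE) (rule that)
  have M: "embedding_graph M" "R0 \<subseteq> M" using M0(1) by (simp_all add: A_def)
  have max: "E = M" if "embedding_graph E" "M \<subseteq> E" for E
  proof -
    have "E \<in> A" using that M(2) by (simp add: A_def)
    with M0(2) that(2) show ?thesis by simp
  qed
  have inv: "inverse_closed M" using embedding_graph_fractions[OF M(1)] max by metis
  have maxc: "E = M\<inverse>" if "embedding_graph E" "M\<inverse> \<subseteq> E" for E
  proof -
    have "E\<inverse> = M" by (rule max[OF embedding_graph_converse[OF that(1)]]) (use that(2) in \<open>auto simp: subset_iff\<close>)
    thus ?thesis by (metis converse_converse)
  qed
  \<comment> \<open>Stated for an arbitrary maximal graph: \<open>M\<close> itself gives totality,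
    the converse of \<open>M\<close> gives surjectivity.\<close>
  have ex: "\<exists>\<theta>'. (\<theta>, \<theta>') \<in> N" if N: "embedding_graph N" "inverse_closed N"
    and maxN: "\<And>E. embedding_graph E \<Longrightarrow> N \<subseteq> E \<Longrightarrow> E = N" and \<theta>: "algebraic \<theta>" for N \<theta>
  proof -
    from \<theta> obtain q :: "int poly" where q: "q \<noteq> 0" "poly (of_int_poly q) \<theta> = 0"
      by (elim algebraicE') (rule that)
    have "(of_int_poly q, of_int_poly q) \<in> poly_graph N"
      by (simp add: poly_graph_def embedding_graph_of_int[OF N(1)])
    from ex_minimal_pair[OF this, of \<theta>] q obtain f f' where f: "minimal_pair N \<theta> f f'" by auto
    hence f': "(f, f') \<in> poly_graph N" "f \<noteq> 0" "poly f \<theta> = 0" by (auto simp: minimal_pair_def)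
    have "degree f \<noteq> 0"
    proof
      assume "degree f = 0"
      then obtain c where "f = [:c:]" by (metis degree_eq_zeroE)
      with f' show False by simp
    qed
    hence "degree f' \<noteq> 0" using poly_graph_degree(1)[OF N(1) f'(1)] by simp
    hence "\<not> constant (poly f')" by (simp add: constant_degree)
    then obtain \<theta>' where "poly f' \<theta>' = 0" using fundamental_theorem_of_algebra by blast
    from embedding_graph_extend[OF N f \<theta> this] maxN show ?thesis by blast
  qed
  have ex1: "\<exists>y. (x, y) \<in> M" if "algebraic x" for x using ex[OF M(1) inv max that] .
  have ex2: "\<exists>x. (x, y) \<in> M" if "algebraic y" for y
    using ex[OF embedding_graph_converse[OF M(1)] inverse_closed_converse[OF inv] maxc that] by simp
  have funct: "y = y'" if "(x, y) \<in> M" "(x, y') \<in> M" for x y y'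
    using embedding_graph_rules(7)[OF M(1) embedding_graph_diff[OF M(1) that]] by simp
  have inj: "x = x'" if "(x, y) \<in> M" "(x', y) \<in> M" for x x' y
    using embedding_graph_rules(7)[OF M(1) embedding_graph_diff[OF M(1) that]] by simp
  define \<sigma> where "\<sigma> = restrict (\<lambda>x. THE y. (x, y) \<in> M) QQbar"
  have \<sigma>: "\<sigma> x = y" if "(x, y) \<in> M" for x y
  proof -
    have "algebraic x" using embedding_graph_rules(5)[OF M(1) that] .
    moreover have "(THE y. (x, y) \<in> M) = y" using that funct by blast
    ultimately show ?thesis by (simp add: \<sigma>_def)
  qed
  have \<sigma>M: "(x, \<sigma> x) \<in> M" if "x \<in> QQbar" for x using ex1[of x] \<sigma> that by auto
  have "bij_betw \<sigma> QQbar QQbar" unfolding bij_betw_def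
  proof
    show "inj_on \<sigma> QQbar" using \<sigma>M inj by (metis inj_onI)
    show "\<sigma> ` QQbar = QQbar"
    proof
      show "\<sigma> ` QQbar \<subseteq> QQbar" using \<sigma>M embedding_graph_rules(6)[OF M(1)] by blast
      show "QQbar \<subseteq> \<sigma> ` QQbar"
      proof
        fix y assume "y \<in> QQbar"
        then obtain x where x: "(x, y) \<in> M" using ex2 by auto
        hence "x \<in> QQbar" using embedding_graph_rules(5)[OF M(1)] by blast
        thus "y \<in> \<sigma> ` QQbar" using \<sigma>[OF x] by blast
      qed
    qed
  qed
  moreover have "subring_hom QQbar \<sigma>"
    by (intro subring_hom_QQbarI \<sigma> embedding_graph_rules[OF M(1)] \<sigma>M)
  ultimately have "\<sigma> \<in> carrier GalQ" by (simp add: GalQ_iff \<sigma>_def)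
  thus ?thesis using \<sigma> M(2) by blast
qed

text \<open>Extending the identity of the rationals, every root of the minimal polynomial is the
  image of \<open>x\<close> under some automorphism, hence equal to \<open>x\<close>. So that
  polynomial is a multiple of a power of \<open>X - x\<close>, separability makes it linear, and
  \<open>x\<close> is rational.\<close>

theorem GalQ_fixed_algebraic_int:
  assumes x: "algebraic_int x" and fixed: "\<And>\<sigma>. \<sigma> \<in> carrier GalQ \<Longrightarrow> \<sigma> x = x"
  shows "x \<in> \<int>"
proof -
  define R where "R = (\<lambda>q. (q, q)) ` (\<rat> :: complex set)"
  have R: "embedding_graph R" "inverse_closed R"
    by (auto simp: R_def embedding_graph_def inverse_closed_def intro: rat_imp_algebraic)
  have PR: "(p, p') \<in> poly_graph R \<longleftrightarrow> p' = p \<and> (\<forall>i. coeff p i \<in> \<rat>)" for p p'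
    by (auto simp: poly_graph_def R_def poly_eq_iff image_iff)
  have ax: "algebraic x" using x by blast
  then obtain q :: "int poly" where q: "q \<noteq> 0" "poly (of_int_poly q) x = 0"
    by (elim algebraicE') (rule that)
  have "(of_int_poly q, of_int_poly q) \<in> poly_graph R" by (simp add: PR)
  from ex_minimal_pair[OF this, of x] q obtain f f' where "minimal_pair R x f f'" by auto
  moreover from this have "f' = f" by (auto simp: minimal_pair_def PR)
  ultimately have mp: "minimal_pair R x f f" by simp
  hence f: "\<And>i. coeff f i \<in> \<rat>" "f \<noteq> 0" "poly f x = 0" by (auto simp: minimal_pair_def PR)
  have root: "y = x" if "poly f y = 0" for y
  proof -
    from embedding_graph_extend[OF R mp ax that] obtain R' where "embedding_graph R'" "(x, y) \<in> R'" by blast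
    with embedding_graph_extends_to_GalQ[of R'] fixed show ?thesis by force
  qed
  define n where "n = order x f"
  have roots: "{z. poly f z = 0} = {x}" using root f(3) by blast
  have fn: "f = smult (lead_coeff f) ([:- x, 1:] ^ n)"
    using complex_poly_decompose[of f] unfolding roots n_def by simp
  have n: "n \<noteq> 0" using f(2,3) by (simp add: n_def order_root)
  \<comment> \<open>A multiple root would also be a root of the derivative, a rational polynomial of
    smaller degree.\<close>
  have "n = 1"
  proof (rule ccontr)
    assume "n \<noteq> 1"
    with n obtain k where k: "n = Suc (Suc k)" by (metis One_nat_def not0_implies_Suc)
    have "degree f = n" by (subst fn) (use f(2) in \<open>simp add: degree_power_eq\<close>)
    hence deg: "degree f > 0" using n by simp
    have "poly (pderiv f) x = 0" by (subst fn) (simp add: pderiv_smult pderiv_power_Suc k poly_power del: power_Suc)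
    moreover have "(pderiv f, pderiv f) \<in> poly_graph R" using f(1) by (auto simp: PR coeff_pderiv)
    moreover have "pderiv f \<noteq> 0" using deg by (simp add: pderiv_eq_0_iff)
    ultimately have "degree f \<le> degree (pderiv f)" using mp unfolding minimal_pair_def by blast
    thus False using deg by (simp add: degree_pderiv)
  qed
  hence fn1: "f = smult (lead_coeff f) [:- x, 1:]" using fn by simp
  define c where "c = lead_coeff f"
  have "c \<noteq> 0" using f(2) by (simp add: c_def)
  moreover have "coeff f 0 = - c * x" by (subst fn1) (simp add: c_def)
  moreover have "c \<in> \<rat>" using f(1) by (simp add: c_def)
  moreover have "- coeff f 0 \<in> \<rat>" using f(1)[of 0] by simp
  ultimately have "x = - coeff f 0 / c" "- coeff f 0 / c \<in> \<rat>" by (simp, intro Rats_divide)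
  hence "x \<in> \<rat>" by (simp only:)
  with x show ?thesis by (rule rational_algebraic_int_is_int)
qed

section \<open>Prime ideals of the ring of algebraic integers\<close>

lemma Zbar_cring: "cring Zbar"
proof -
  have "\<exists>y\<in>ZZbar. x + y = 0" if "x \<in> ZZbar" for x
    using that by (intro bexI[of _ "- x"]) auto
  thus ?thesis
    by unfold_locales (auto simp: algebra_simps Units_def intro: algebraic_int_plus_times)
qed

interpretation Zbar: cring Zbar by (rule Zbar_cring)

lemma Zbar_a_inv: "x \<in> ZZbar \<Longrightarrow> \<ominus>\<^bsub>Zbar\<^esub> x = - x"
  by (rule Zbar.minus_equality) auto

text \<open>Closure under negation is implied, since -1 is an algebraic integer.\<close>

definition zbar_ideal :: "complex set \<Rightarrow> bool" where
  "zbar_ideal J \<longleftrightarrow> J \<subseteq> ZZbar \<and> 0 \<in> J \<and> (\<forall>x\<in>J. \<forall>y\<in>J. x + y \<in> J) \<and> (\<forall>a\<in>ZZbar. \<forall>x\<in>J. a * x \<in> J)"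

lemma zbar_ideal_uminus:
  assumes "zbar_ideal J" "x \<in> J" shows "- x \<in> J"
proof -
  have "(- 1) * x \<in> J"
    using assms ZZ.uminus_closed[OF ZZ.one_closed] unfolding zbar_ideal_def by blast
  thus ?thesis by simp
qed

lemma zbar_ideal_sum: "zbar_ideal J \<Longrightarrow> (\<And>i. i \<in> I \<Longrightarrow> f i \<in> J) \<Longrightarrow> sum f I \<in> J"
  by (induction I rule: infinite_finite_induct) (auto simp: zbar_ideal_def)

lemma zbar_ideal_imp_ideal:
  assumes J: "zbar_ideal J" shows "ideal J Zbar"
proof (rule idealI)
  show "ring Zbar" by (rule Zbar.ring_axioms)
  have "subgroup J (add_monoid Zbar)"
  proof (rule group.subgroupI)
    show "group (add_monoid Zbar)" using Zbar.add.group_axioms by simp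
    show "J \<noteq> {}" "J \<subseteq> carrier (add_monoid Zbar)" using J by (auto simp: zbar_ideal_def)
    show "inv\<^bsub>add_monoid Zbar\<^esub> x \<in> J" if "x \<in> J" for x
      using that J zbar_ideal_uminus[OF J that] Zbar_a_inv[of x] by (auto simp: zbar_ideal_def a_inv_def)
  qed (use J in \<open>auto simp: zbar_ideal_def\<close>)
  thus "subgroup J (add_monoid Zbar)" .
  have "x * a \<in> J" "a * x \<in> J" if "a \<in> J" "x \<in> ZZbar" for a x
    using J that by (auto simp: zbar_ideal_def mult.commute[of a x])
  thus "\<And>a x. a \<in> J \<Longrightarrow> x \<in> carrier Zbar \<Longrightarrow> x \<otimes>\<^bsub>Zbar\<^esub> a \<in> J"
    "\<And>a x. a \<in> J \<Longrightarrow> x \<in> carrier Zbar \<Longrightarrow> a \<otimes>\<^bsub>Zbar\<^esub> x \<in> J" by simp_all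
qed

lemma primeideal_Zbar_rules:
  assumes "primeideal P Zbar"
  shows "zbar_ideal P" "1 \<notin> P" "x \<in> ZZbar \<Longrightarrow> y \<in> ZZbar \<Longrightarrow> x * y \<in> P \<Longrightarrow> x \<in> P \<or> y \<in> P"
proof -
  interpret primeideal P Zbar by fact
  show "zbar_ideal P" unfolding zbar_ideal_def using a_subset zero_closed a_closed I_l_closed by auto
  show "1 \<notin> P" using I_notcarr one_imp_carrier by auto
  show "x \<in> ZZbar \<Longrightarrow> y \<in> ZZbar \<Longrightarrow> x * y \<in> P \<Longrightarrow> x \<in> P \<or> y \<in> P"
    using I_prime[of x y] by simp
qed

lemma prime_nat_in_primeideal:
  assumes P: "primeideal P Zbar" and n: "n > 0" "of_nat n \<in> P"
  shows "\<exists>p. prime p \<and> of_nat p \<in> P"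
  using n
proof (induction n rule: less_induct)
  case (less n)
  have "n \<noteq> 1" using less.prems primeideal_Zbar_rules(2)[OF P] by auto
  then obtain p where p: "prime p" "p dvd n" using prime_factor_nat by blast
  then obtain k where k: "n = p * k" by blast
  have "of_nat p * of_nat k \<in> P" using less.prems k by simp
  hence "of_nat p \<in> P \<or> of_nat k \<in> P"
    by (intro primeideal_Zbar_rules(3)[OF P]) (auto intro: ZZ.of_nat_closed[simplified])
  moreover have "k < n" "k > 0" using k less.prems(1) prime_gt_1_nat[OF p(1)] by auto
  ultimately show ?case using less.IH[of k] p(1) by blast
qed

text \<open>Zorn's lemma gives a maximal ideal \<open>M\<close> containing \<open>J\<close>, and
  \<open>M\<close> is prime. That it lies above a prime number follows once it contains a positive
  integer, whose prime factors can be split off.\<close>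

lemma ex_primeideal_above:
  assumes J: "zbar_ideal J" "1 \<notin> J"
  shows "\<exists>p P. prime p \<and> P \<in> primes_above p \<and> J \<subseteq> P"
proof -
  define A where "A = {I. zbar_ideal I \<and> J \<subseteq> I \<and> 1 \<notin> I}"
  have "\<exists>M\<in>A. \<forall>I\<in>A. M \<subseteq> I \<longrightarrow> I = M"
  proof (rule subset_Zorn_nonempty)
    show "A \<noteq> {}" using J by (auto simp: A_def)
    fix \<C> assume \<C>: "\<C> \<noteq> {}" "subset.chain A \<C>"
    have CA: "zbar_ideal E" "J \<subseteq> E" "1 \<notin> E" if "E \<in> \<C>" for E
      using that \<C>(2) by (auto simp: subset.chain_def A_def)
    have dir: "\<exists>F\<in>\<C>. E \<subseteq> F \<and> E' \<subseteq> F" if "E \<in> \<C>" "E' \<in> \<C>" for E E'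
    proof -
      have "E \<subseteq> E' \<or> E' \<subseteq> E" using that \<C>(2) unfolding subset_chain_def by blast
      with that show ?thesis by blast
    qed
    have "zbar_ideal (\<Union>\<C>)" unfolding zbar_ideal_def
    proof (intro conjI ballI)
      show "\<Union>\<C> \<subseteq> ZZbar" "0 \<in> \<Union>\<C>" using CA(1) \<C>(1) unfolding zbar_ideal_def by blast+
    next
      fix x y assume "x \<in> \<Union>\<C>" "y \<in> \<Union>\<C>"
      then obtain E E' where "E \<in> \<C>" "E' \<in> \<C>" "x \<in> E" "y \<in> E'" by blast
      with dir obtain F where "F \<in> \<C>" "x \<in> F" "y \<in> F" by blast
      with CA(1)[of F] show "x + y \<in> \<Union>\<C>" unfolding zbar_ideal_def by blast
    next
      fix a x assume "a \<in> ZZbar" "x \<in> \<Union>\<C>"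
      then obtain E where "E \<in> \<C>" "x \<in> E" by blast
      with CA(1)[of E] \<open>a \<in> ZZbar\<close> show "a * x \<in> \<Union>\<C>" unfolding zbar_ideal_def by blast
    qed
    thus "\<Union>\<C> \<in> A" using \<C>(1) CA(2,3) by (auto simp: A_def)
  qed
  then obtain M where M0: "M \<in> A" "\<forall>I\<in>A. M \<subseteq> I \<longrightarrow> I = M" by (elim bexE) (rule that)
  have M: "zbar_ideal M" "J \<subseteq> M" "1 \<notin> M" using M0(1) by (simp_all add: A_def)
  note Mr = M(1)[unfolded zbar_ideal_def]
  have max: "\<exists>a m. a \<in> ZZbar \<and> m \<in> M \<and> 1 = m + a * x" if x: "x \<in> ZZbar" "x \<notin> M" for x
  proof (rule ccontr)
    assume no: "\<not> ?thesis"
    define I where "I = {m + a * x | m a. m \<in> M \<and> a \<in> ZZbar}"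
    have II: "m + a * x \<in> I" if "m \<in> M" "a \<in> ZZbar" for m a using that unfolding I_def by blast
    have "zbar_ideal I" unfolding zbar_ideal_def
    proof (intro conjI ballI)
      show "I \<subseteq> ZZbar" using Mr x(1) by (auto simp: I_def intro!: algebraic_int_plus_times)
      show "0 \<in> I" using II[of 0 0] Mr by simp
    next
      fix y z assume "y \<in> I" "z \<in> I"
      then obtain m a m' a' where *: "m \<in> M" "a \<in> ZZbar" "y = m + a * x" "m' \<in> M" "a' \<in> ZZbar" "z = m' + a' * x"
        unfolding I_def by blast
      have "(m + m') + (a + a') * x \<in> I" using * Mr by (intro II ZZ.plus_closed) auto
      thus "y + z \<in> I" using * by (simp add: algebra_simps)
    next
      fix b z assume b: "b \<in> ZZbar" and "z \<in> I"
      then obtain m a where *: "m \<in> M" "a \<in> ZZbar" "z = m + a * x" unfolding I_def by blast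
      have "(b * m) + (b * a) * x \<in> I" using * Mr b by (intro II ZZ.times_closed) auto
      thus "b * z \<in> I" using * by (simp add: algebra_simps)
    qed
    moreover have "M \<subseteq> I" using II[of _ 0] by auto
    moreover have "1 \<notin> I" using no unfolding I_def by blast
    ultimately have "I = M" using M(2) M0(2) by (simp add: A_def)
    moreover have "x \<in> I" using II[of 0 1] Mr by simp
    ultimately show False using x(2) by simp
  qed
  have prime: "primeideal M Zbar"
  proof (rule primeidealI)
    show "ideal M Zbar" by (rule zbar_ideal_imp_ideal[OF M(1)])
    show "cring Zbar" by (rule Zbar_cring)
    show "carrier Zbar \<noteq> M" using M(3) by auto
    fix x y assume xy: "x \<in> carrier Zbar" "y \<in> carrier Zbar" "x \<otimes>\<^bsub>Zbar\<^esub> y \<in> M"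
    show "x \<in> M \<or> y \<in> M"
    proof (rule disjCI)
      assume "y \<notin> M"
      with max[of y] xy(2) obtain a m where am: "a \<in> ZZbar" "m \<in> M" "1 = m + a * y" by auto
      have "x = x * (m + a * y)" using am(3) by simp
      hence "x = x * m + a * (x * y)" by (simp add: algebra_simps)
      moreover have "x * m \<in> M" "a * (x * y) \<in> M" using am(1,2) xy Mr by auto
      ultimately show "x \<in> M" using Mr by metis
    qed
  qed
  \<comment> \<open>First a nonzero element of \<open>M\<close> is needed. If 2 is not in
    \<open>M\<close>, then \<open>1 = m + a * 2\<close> with \<open>m \<in> M\<close>, and
    \<open>m \<noteq> 0\<close> because one half is not an algebraic integer.\<close>
  have "\<exists>n>0. of_nat n \<in> M"
  proof (cases "(2 :: complex) \<in> M")
    case True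
    thus ?thesis by (intro exI[of _ 2]) auto
  next
    case False
    have "(2 :: complex) \<in> ZZbar" using ZZ.of_nat_closed[of 2] by simp
    from max[OF this False] obtain a m where am: "a \<in> ZZbar" "m \<in> M" "1 = m + a * 2" by blast
    have "m \<noteq> 0"
    proof
      assume "m = 0"
      hence a: "a = of_rat (1/2)" using am(3) by (simp add: of_rat_divide field_simps)
      hence "a \<in> \<rat>" by simp
      with am(1) have "a \<in> \<int>" by (auto intro: rational_algebraic_int_is_int)
      then obtain k where "a = of_int k" by (auto elim: Ints_cases)
      with am(3) \<open>m = 0\<close> have "of_int (k * 2) = (of_int 1 :: complex)" by simp
      hence "k * 2 = 1" by (simp only: of_int_eq_iff)
      thus False by presburger
    qed
    moreover have "m \<in> ZZbar" using am(2) Mr by blast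
    ultimately obtain p :: "int poly" where p: "p \<noteq> 0" "coeff p 0 \<noteq> 0" "poly (of_int_poly p) m = 0"
      using algebraicE'_nonzero[of m] by blast
    obtain c q where pc: "p = pCons c q" by (cases p)
    \<comment> \<open>With \<open>p = c + X q\<close> and \<open>p(m) = 0\<close>, the nonzero
      constant term \<open>c\<close> is the multiple \<open>- q(m) m\<close> of \<open>m\<close>,
      hence in \<open>M\<close>.\<close>
    define a where "a = - (poly (of_int_poly q) m)"
    have "of_int c = a * m"
      using p(3) unfolding pc a_def of_int_hom.map_poly_pCons_hom
      by (simp add: eq_neg_iff_add_eq_0 mult.commute)
    moreover have "a \<in> ZZbar" unfolding a_def
      using am(2) Mr by (intro ZZ.uminus_closed ZZ.poly_closed) (auto intro: ZZ.of_int_closed[simplified])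
    ultimately have "of_int c \<in> M" using am(2) Mr by simp
    hence "of_int \<bar>c\<bar> \<in> M" using zbar_ideal_uminus[OF M(1)] by (cases "c \<ge> 0") auto
    hence "of_nat (nat \<bar>c\<bar>) \<in> M" by simp
    moreover have "nat \<bar>c\<bar> > 0" using p(2) by (simp add: pc)
    ultimately show ?thesis by blast
  qed
  with prime_nat_in_primeideal[OF prime] obtain p where "prime p" "of_nat p \<in> M" by blast
  with prime M(2) show ?thesis unfolding primes_above_def by blast
qed

section \<open>Gauss's lemma modulo a prime ideal\<close>

context
  fixes P assumes P: "primeideal P Zbar"
begin

text \<open>Let \<open>i\<close> and \<open>j\<close> be the lowest indices of coefficients outside
  \<open>P\<close>. In the coefficient of index \<open>i + j\<close> every summand but one has a
  factor of lower index, hence lies in \<open>P\<close>.\<close>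

lemma prime_coeffs_times:
  fixes p q :: "complex poly"
  assumes p: "\<forall>i. coeff p i \<in> ZZbar" "\<not> (\<forall>i. coeff p i \<in> P)"
    and q: "\<forall>i. coeff q i \<in> ZZbar" "\<not> (\<forall>i. coeff q i \<in> P)"
  shows "\<not> (\<forall>i. coeff (p * q) i \<in> P)"
proof
  assume pq: "\<forall>i. coeff (p * q) i \<in> P"
  note P1 = primeideal_Zbar_rules(1)[OF P, unfolded zbar_ideal_def]
  define i where "i = (LEAST i. coeff p i \<notin> P)"
  define j where "j = (LEAST j. coeff q j \<notin> P)"
  have i: "coeff p i \<notin> P" unfolding i_def by (rule LeastI_ex) (use p in blast)
  have j: "coeff q j \<notin> P" unfolding j_def by (rule LeastI_ex) (use q in blast)
  have i': "coeff p k \<in> P" if "k < i" for k using not_less_Least[OF that[unfolded i_def]] by blast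
  have j': "coeff q k \<in> P" if "k < j" for k using not_less_Least[OF that[unfolded j_def]] by blast
  have "coeff (p * q) (i + j) = (\<Sum>k\<le>i + j. coeff p k * coeff q (i + j - k))" by (rule coeff_mult)
  also have "\<dots> = coeff p i * coeff q j + (\<Sum>k\<in>{..i + j} - {i}. coeff p k * coeff q (i + j - k))"
    by (subst sum.remove[of _ i]) auto
  finally have eq: "coeff p i * coeff q j = coeff (p * q) (i + j) - (\<Sum>k\<in>{..i + j} - {i}. coeff p k * coeff q (i + j - k))"
    by simp
  have "(\<Sum>k\<in>{..i + j} - {i}. coeff p k * coeff q (i + j - k)) \<in> P"
  proof (rule zbar_ideal_sum[OF primeideal_Zbar_rules(1)[OF P]])
    fix k assume k: "k \<in> {..i + j} - {i}"
    show "coeff p k * coeff q (i + j - k) \<in> P"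
    proof (cases "k < i")
      case True
      thus ?thesis using i' P1 q(1) by (metis mult.commute)
    next
      case False
      hence "coeff q (i + j - k) \<in> P" using k by (intro j') auto
      thus ?thesis using P1 p(1) by blast
    qed
  qed
  from zbar_ideal_uminus[OF primeideal_Zbar_rules(1)[OF P] this] pq
  have "coeff p i * coeff q j \<in> P" unfolding eq using P1 by (metis diff_conv_add_uminus)
  with primeideal_Zbar_rules(3)[OF P] p(1) q(1) i j show False by blast
qed

lemma prime_coeffs_prod:
  fixes f :: "'b \<Rightarrow> complex poly"
  assumes "finite T" "\<And>t i. t \<in> T \<Longrightarrow> coeff (f t) i \<in> ZZbar" "\<forall>i. coeff (\<Prod>t\<in>T. f t) i \<in> P"
  shows "\<exists>t\<in>T. \<forall>i. coeff (f t) i \<in> P"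
proof (rule ccontr)
  assume no: "\<not> ?thesis"
  interpret Zp: subring_hom "{p :: complex poly. \<forall>i. coeff p i \<in> ZZbar}" "map_poly (\<lambda>x. x)"
    by (rule ZZ.lift_poly)
  have "\<not> (\<forall>i. coeff (\<Prod>t\<in>T. f t) i \<in> P)"
    using assms(1,2) no
  proof (induction T rule: finite_induct)
    case empty
    have "coeff (1 :: complex poly) 0 \<notin> P" using primeideal_Zbar_rules(2)[OF P] by simp
    thus ?case by (auto simp only: prod.empty)
  next
    case (insert t T)
    have "\<forall>i. coeff (\<Prod>t\<in>T. f t) i \<in> ZZbar"
      using Zp.prod_closed[of T f] insert.prems(1) by blast
    thus ?case unfolding prod.insert[OF insert.hyps]
      by (intro prime_coeffs_times) (use insert in blast)+
  qed
  with assms(3) show False by blast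
qed

end

section \<open>Lifting congruences from the fixed ring to all algebraic integers\<close>

definition fixed_ints :: "(complex \<Rightarrow> complex) set \<Rightarrow> complex set" where
  "fixed_ints N = {x \<in> ZZbar. \<forall>n\<in>N. n x = x}"

lemma finite_orbit:
  assumes "N \<subseteq> carrier GalQ" "x \<in> QQbar"
  shows "finite ((\<lambda>n. n x) ` N)"
proof -
  from assms(2) obtain p :: "int poly" where p: "p \<noteq> 0" "poly (of_int_poly p) x = 0"
    unfolding mem_Collect_eq by (elim algebraicE') (rule that)
  have "(\<lambda>n. n x) ` N \<subseteq> {y. poly (of_int_poly p) y = 0}"
    using GalQ_int_poly_root[OF _ assms(2) p(2)] assms(1) by blast
  moreover have "finite {y :: complex. poly (of_int_poly p) y = 0}"
    using p(1) by (intro poly_roots_finite) simp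
  ultimately show ?thesis by (rule finite_subset)
qed

context
  fixes N assumes N: "subgroup N GalQ"
begin

lemma N_in_carrier: "n \<in> N \<Longrightarrow> n \<in> carrier GalQ"
  using subgroup.subset[OF N] by blast

lemma N_apply_ZZbar: "n \<in> N \<Longrightarrow> x \<in> ZZbar \<Longrightarrow> n x \<in> ZZbar"
  using GalQ_closed_ZZbar N_in_carrier by blast

lemma N_mult_apply: "n \<in> N \<Longrightarrow> n' \<in> N \<Longrightarrow> x \<in> ZZbar \<Longrightarrow> (n \<otimes>\<^bsub>GalQ\<^esub> n') x = n (n' x)"
  by (rule GalQ_mult) (auto intro: N_in_carrier)

text \<open>Let \<open>F\<close> be the product of the \<open>Y - t\<close> over the orbit of
  \<open>B\<close> under \<open>N\<close>. Its coefficients lie in \<open>fixed_ints N\<close>, so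
  \<open>g\<close> fixes them modulo \<open>P\<close>; from \<open>F(B) = 0\<close> follows that
  \<open>F(g B)\<close> vanishes modulo \<open>P\<close>, and Gauss's lemma singles out one
  factor.\<close>

lemma fixed_ints_congruence_finite:
  fixes b :: "nat \<Rightarrow> complex"
  assumes P: "primeideal P Zbar" and g: "g \<in> carrier GalQ"
    and cong: "\<And>y. y \<in> fixed_ints N \<Longrightarrow> g y - y \<in> P"
    and b: "\<And>i. i < k \<Longrightarrow> b i \<in> ZZbar"
  shows "\<exists>n\<in>N. \<forall>i<k. g (b i) - n (b i) \<in> P"
proof -
  note Pi = primeideal_Zbar_rules(1)[OF P]
  note P1 = Pi[unfolded zbar_ideal_def]
  define ZX where "ZX = {p :: complex poly. \<forall>i. coeff p i \<in> ZZbar}"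
  define ZXX where "ZXX = {F :: complex poly poly. \<forall>i. coeff F i \<in> ZX}"
  have homX: "subring_hom ZX (map_poly h)" if "h \<in> carrier GalQ" for h
    unfolding ZX_def by (rule subring_hom.lift_poly[OF GalQ_hom_ZZbar[OF that]])
  have homXX: "subring_hom ZXX (map_poly (map_poly h))" if "h \<in> carrier GalQ" for h
    unfolding ZXX_def by (rule subring_hom.lift_poly[OF homX[OF that]])
  have cm: "coeff (map_poly h p) i = h (coeff p i)" if "h \<in> carrier GalQ" for h p i
    using subring_hom.hom_zero[OF GalQ_hom[OF that]] by (simp add: coeff_map_poly)
  \<comment> \<open>One polynomial carries all the \<open>b i\<close>, so that one factor of the
    product yields the same \<open>n\<close> for every \<open>i\<close>.\<close>
  define B where "B = (\<Sum>i<k. monom (b i) i)"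
  have cB: "coeff B i = (if i < k then b i else 0)" for i
    by (auto simp: B_def coeff_sum if_distrib cong: if_cong)
  have B: "B \<in> ZX" using b by (auto simp: ZX_def cB)
  \<comment> \<open>The orbit is a set of polynomials, finite although \<open>N\<close> is
    infinite.\<close>
  define T where "T = (\<lambda>n. map_poly n B) ` N"
  have TZ: "t \<in> ZX" if "t \<in> T" for t
    using that N_apply_ZZbar N_in_carrier B by (auto simp: T_def ZX_def cm)
  have "T \<subseteq> (\<lambda>f. \<Sum>i<k. monom (f i) i) ` (PiE {..<k} (\<lambda>i. (\<lambda>n. n (b i)) ` N))"
  proof
    fix t assume "t \<in> T"
    then obtain n where n: "n \<in> N" "t = map_poly n B" by (auto simp: T_def)
    have "t = (\<Sum>i<k. monom (restrict (\<lambda>i. n (b i)) {..<k} i) i)"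
      using subring_hom.hom_zero[OF GalQ_hom[OF N_in_carrier[OF n(1)]]]
      by (intro poly_eqI) (auto simp: n(2) cm[OF N_in_carrier[OF n(1)]] cB coeff_sum if_distrib cong: if_cong)
    moreover have "restrict (\<lambda>i. n (b i)) {..<k} \<in> PiE {..<k} (\<lambda>i. (\<lambda>n. n (b i)) ` N)"
      using n(1) by auto
    ultimately show "t \<in> (\<lambda>f. \<Sum>i<k. monom (f i) i) ` (PiE {..<k} (\<lambda>i. (\<lambda>n. n (b i)) ` N))" by blast
  qed
  moreover have "finite (PiE {..<k} (\<lambda>i. (\<lambda>n. n (b i)) ` N))"
    using subgroup.subset[OF N] b by (intro finite_PiE finite_orbit) auto
  ultimately have finT: "finite T" by (meson finite_imageI finite_subset)
  define F where "F = (\<Prod>t\<in>T. [:- t, 1:])"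
  have lin: "[:- t, 1:] \<in> ZXX" if "t \<in> ZX" for t
    using that by (auto simp: ZXX_def ZX_def coeff_pCons split: nat.splits)
  have F: "F \<in> ZXX" unfolding F_def
    by (rule subring_hom.prod_closed[OF homXX[OF g]]) (auto intro: lin TZ)
  have perm: "map_poly n ` T = T" if n: "n \<in> N" for n
  proof -
    have comp: "map_poly n (map_poly n' B) = map_poly (n \<otimes>\<^bsub>GalQ\<^esub> n') B" if "n' \<in> N" for n'
      using N_mult_apply[OF n that] B N_in_carrier[OF n] N_in_carrier[OF that] N_in_carrier[OF subgroup.m_closed[OF N n that]]
      by (intro poly_eqI) (auto simp: cm ZX_def)
    have "map_poly n ` T \<subseteq> T"
      using comp subgroup.m_closed[OF N n] by (auto simp: T_def)
    moreover have "T \<subseteq> map_poly n ` T"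
    proof
      fix t assume "t \<in> T"
      then obtain n' where n': "n' \<in> N" "t = map_poly n' B" by (auto simp: T_def)
      define m where "m = inv\<^bsub>GalQ\<^esub> n \<otimes>\<^bsub>GalQ\<^esub> n'"
      have m: "m \<in> N" unfolding m_def
        by (rule subgroup.m_closed[OF N subgroup.m_inv_closed[OF N n] n'(1)])
      have "n \<otimes>\<^bsub>GalQ\<^esub> m = n'" unfolding m_def
        using N_in_carrier[OF n] N_in_carrier[OF n'(1)] by (simp add: GalQ.m_assoc[symmetric])
      hence "t = map_poly n (map_poly m B)" using comp[OF m] n'(2) by simp
      thus "t \<in> map_poly n ` T" using m by (auto simp: T_def)
    qed
    ultimately show ?thesis by blast
  qed
  have Ffix: "map_poly (map_poly n) F = F" if n: "n \<in> N" for n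
  proof -
    note gn = N_in_carrier[OF n]
    have "map_poly (map_poly n) F = (\<Prod>t\<in>T. map_poly (map_poly n) [:- t, 1:])"
      unfolding F_def by (rule subring_hom.hom_prod[OF homXX[OF gn]]) (auto intro: lin TZ)
    also have "\<dots> = (\<Prod>t\<in>T. [:- map_poly n t, 1:])"
      using subring_hom.hom_uminus[OF homX[OF gn]] subring_hom.hom_one[OF homX[OF gn]] TZ
      by (intro prod.cong) (auto simp: map_poly_pCons)
    also have "\<dots> = (\<Prod>t\<in>map_poly n ` T. [:- t, 1:])"
    proof (subst prod.reindex)
      show "inj_on (map_poly n) T"
        using perm[OF n] by (intro eq_card_imp_inj_on finT) simp
    qed simp
    also have "\<dots> = F" by (simp add: perm[OF n] F_def)
    finally show ?thesis .
  qed
  have Fco: "g (coeff (coeff F j) i) - coeff (coeff F j) i \<in> P" for i j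
  proof (rule cong)
    have "n (coeff (coeff F j) i) = coeff (coeff F j) i" if n: "n \<in> N" for n
    proof -
      have "coeff (map_poly (map_poly n) F) j = map_poly n (coeff F j)"
        using subring_hom.hom_zero[OF homX[OF N_in_carrier[OF n]]] by (simp add: coeff_map_poly)
      thus ?thesis using Ffix[OF n] cm[OF N_in_carrier[OF n]] by metis
    qed
    thus "coeff (coeff F j) i \<in> fixed_ints N" using F by (auto simp: fixed_ints_def ZXX_def ZX_def)
  qed
  define G where "G = map_poly g"
  interpret gX: subring_hom ZX G unfolding G_def by (rule homX[OF g])
  have one_N: "\<one>\<^bsub>GalQ\<^esub> \<in> N" by (rule subgroup.one_closed[OF N])
  have "map_poly \<one>\<^bsub>GalQ\<^esub> B = B"
    using B by (intro poly_eqI) (auto simp: cm[OF N_in_carrier[OF one_N]] ZX_def intro!: GalQ_one)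
  hence "B \<in> T" using one_N unfolding T_def by (metis image_eqI)
  hence "poly F B = 0" using finT by (auto simp: F_def poly_prod)
  hence "0 = poly (map_poly G F) (G B)"
    using gX.hom_poly[of F B] F B gX.hom_zero by (simp add: ZXX_def)
  also have "map_poly G F = (\<Sum>j\<le>degree F. monom (G (coeff F j)) j)"
    by (intro poly_eqI) (auto simp: coeff_map_poly gX.hom_zero coeff_sum if_distrib coeff_eq_0 cong: if_cong)
  also have "poly \<dots> (G B) = (\<Sum>j\<le>degree F. G (coeff F j) * G B ^ j)"
    by (simp add: poly_sum poly_monom)
  finally have z: "(\<Sum>j\<le>degree F. G (coeff F j) * G B ^ j) = 0" by simp
  have GB: "G B \<in> ZX" using B GalQ_closed_ZZbar[OF g] by (auto simp: G_def ZX_def cm[OF g])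
  \<comment> \<open>Subtracting the equation \<open>z\<close>, obtained by applying \<open>g\<close>
    to \<open>F(B) = 0\<close>, leaves only differences of coefficients, all in
    \<open>P\<close>.\<close>
  have "- poly F (G B) = (\<Sum>j\<le>degree F. (G (coeff F j) - coeff F j) * G B ^ j)"
    using z by (simp add: poly_altdef sum_subtractf algebra_simps)
  also have "coeff \<dots> i \<in> P" for i
  proof -
    have *: "coeff ((G (coeff F j) - coeff F j) * G B ^ j) i \<in> P" for j
      unfolding coeff_mult
    proof (rule zbar_ideal_sum[OF Pi])
      fix l assume "l \<in> {..i}"
      have "coeff (G B ^ j) (i - l) \<in> ZZbar" using gX.power_closed[OF GB, of j] by (auto simp: ZX_def)
      moreover have "coeff (G (coeff F j) - coeff F j) l \<in> P" using Fco by (simp add: G_def cm[OF g])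
      ultimately show "coeff (G (coeff F j) - coeff F j) l * coeff (G B ^ j) (i - l) \<in> P"
        using P1 by (metis mult.commute)
    qed
    show ?thesis unfolding coeff_sum by (rule zbar_ideal_sum[OF Pi]) (rule *)
  qed
  finally have "coeff (- poly F (G B)) i \<in> P" for i .
  from zbar_ideal_uminus[OF Pi this] have "\<forall>i. coeff (\<Prod>t\<in>T. G B - t) i \<in> P"
    by (simp add: F_def poly_prod algebra_simps)
  moreover have "coeff (G B - t) i \<in> ZZbar" if "t \<in> T" for t i
    using gX.minus_closed[OF GB TZ[OF that]] by (auto simp: ZX_def)
  ultimately obtain t where t: "t \<in> T" "\<forall>i. coeff (G B - t) i \<in> P"
    using prime_coeffs_prod[OF P finT] by blast
  from t(1) obtain n where n: "n \<in> N" "t = map_poly n B" by (auto simp: T_def)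
  have "g (b i) - n (b i) \<in> P" if "i < k" for i
    using t(2)[rule_format, of i] that by (simp add: n(2) G_def cm[OF g] cm[OF N_in_carrier[OF n(1)]] cB)
  with n(1) show ?thesis by blast
qed

end

section \<open>Subgroups containing all inertia groups\<close>

text \<open>The list stands for a sum of pure tensors \<open>x \<otimes> y\<close>; \<open>h\<close>
  is applied to the second factors and the result is multiplied out.\<close>

definition tensor_eval :: "(complex \<times> complex) list \<Rightarrow> (complex \<Rightarrow> complex) \<Rightarrow> complex" where
  "tensor_eval ts h = (\<Sum>(x, y)\<leftarrow>ts. x * h y)"

lemma tensor_eval_append: "tensor_eval (ts @ us) h = tensor_eval ts h + tensor_eval us h"
  by (simp add: tensor_eval_def)

context
  fixes N and F0 :: "complex set"
  assumes N: "subgroup N GalQ"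
    and F0: "finite F0" "F0 \<subseteq> QQbar"
    and N_open: "\<And>\<tau>. \<tau> \<in> carrier GalQ \<Longrightarrow> (\<And>x. x \<in> F0 \<Longrightarrow> \<tau> x = x) \<Longrightarrow> \<tau> \<in> N"
begin

text \<open>An open subgroup is closed. The limit \<open>\<sigma>\<close> agrees with some
  \<open>\<nu> k\<close> on \<open>F0\<close>, so the two differ by an element of
  \<open>N\<close>.\<close>

lemma pointwise_limit_in_N:
  fixes \<nu> :: "nat \<Rightarrow> complex \<Rightarrow> complex"
  assumes \<nu>: "\<And>k. \<nu> k \<in> N" and lim: "\<And>x. x \<in> QQbar \<Longrightarrow> \<exists>K c. \<forall>k\<ge>K. \<nu> k x = c"
  shows "\<exists>\<sigma>\<in>N. \<forall>x\<in>QQbar. \<exists>K. \<forall>k\<ge>K. \<nu> k x = \<sigma> x"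
proof -
  have gal: "\<nu> k \<in> carrier GalQ" for k using \<nu> subgroup.subset[OF N] by blast
  have "\<forall>x. \<exists>c. x \<in> QQbar \<longrightarrow> (\<exists>K. \<forall>k\<ge>K. \<nu> k x = c)" using lim by blast
  then obtain s where s: "\<And>x. x \<in> QQbar \<Longrightarrow> \<exists>K. \<forall>k\<ge>K. \<nu> k x = s x" by metis
  define \<sigma> where "\<sigma> = restrict s QQbar"
  have \<sigma>: "\<exists>K. \<forall>k\<ge>K. \<nu> k x = \<sigma> x" if "x \<in> QQbar" for x using s that by (simp add: \<sigma>_def)
  have agree: "\<exists>k. \<forall>x\<in>A. \<nu> k x = \<sigma> x" if A: "finite A" "A \<subseteq> QQbar" for A
  proof -
    have "\<forall>x\<in>A. \<forall>\<^sub>F k in sequentially. \<nu> k x = \<sigma> x"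
      using \<sigma> A(2) unfolding eventually_sequentially by blast
    hence "\<forall>\<^sub>F k in sequentially. \<forall>x\<in>A. \<nu> k x = \<sigma> x" using A(1) by (intro eventually_ball_finite)
    thus ?thesis unfolding eventually_sequentially by blast
  qed
  have closed: "\<sigma> x \<in> QQbar" if x: "x \<in> QQbar" for x
  proof -
    obtain k where "\<nu> k x = \<sigma> x" using agree[of "{x}"] x by auto
    with GalQ_closed[OF gal[of k] x] show ?thesis by simp
  qed
  have "subring_hom QQbar \<sigma>"
  proof (rule subring_hom_QQbarI)
    obtain k where "\<nu> k 1 = \<sigma> 1" using agree[of "{1}"] by auto
    thus "\<sigma> 1 = 1" using subring_hom.hom_one[OF GalQ_hom[OF gal[of k]]] by simp
  next
    fix x y assume xy: "x \<in> QQbar" "y \<in> QQbar"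
    hence "{x, y, x + y, x * y} \<subseteq> QQbar" by (auto intro: algebraic_plus_times)
    from agree[OF _ this] obtain k where k: "\<nu> k x = \<sigma> x" "\<nu> k y = \<sigma> y" "\<nu> k (x + y) = \<sigma> (x + y)"
      "\<nu> k (x * y) = \<sigma> (x * y)" by auto
    show "\<sigma> (x + y) = \<sigma> x + \<sigma> y" "\<sigma> (x * y) = \<sigma> x * \<sigma> y"
      using subring_hom.hom_plus[OF GalQ_hom[OF gal[of k]] xy] subring_hom.hom_times[OF GalQ_hom[OF gal[of k]] xy] k
      by simp_all
  qed
  moreover have inj: "inj_on \<sigma> QQbar"
  proof (rule inj_onI)
    fix x y assume xy: "x \<in> QQbar" "y \<in> QQbar" "\<sigma> x = \<sigma> y"
    obtain k where "\<nu> k x = \<sigma> x" "\<nu> k y = \<sigma> y" using agree[of "{x, y}"] xy by auto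
    thus "x = y" using GalQ_inj[OF gal[of k] xy(1,2)] xy(3) by simp
  qed
  moreover have "\<sigma> ` QQbar = QQbar"
  proof
    show "\<sigma> ` QQbar \<subseteq> QQbar" using closed by blast
    show "QQbar \<subseteq> \<sigma> ` QQbar"
    proof
      fix y assume y: "y \<in> QQbar"
      then obtain p :: "int poly" where p: "p \<noteq> 0" "poly (of_int_poly p) y = 0"
        unfolding mem_Collect_eq by (elim algebraicE') (rule that)
      define Z where "Z = {z :: complex. poly (of_int_poly p) z = 0}"
      have fin: "finite Z" unfolding Z_def using p(1) by (intro poly_roots_finite) simp
      have ZQ: "Z \<subseteq> QQbar"
      proof
        fix z assume "z \<in> Z"
        thus "z \<in> QQbar" using p(1)
          by (intro CollectI algebraicI[of "of_int_poly p"]) (auto simp: Z_def)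
      qed
      have "\<sigma> ` Z \<subseteq> Z"
      proof clarify
        fix z assume z: "z \<in> Z"
        obtain k where "\<nu> k z = \<sigma> z" using agree[of "{z}"] z ZQ by auto
        moreover have "poly (of_int_poly p) (\<nu> k z) = 0"
          by (rule GalQ_int_poly_root[OF gal]) (use z ZQ in \<open>auto simp: Z_def\<close>)
        ultimately show "\<sigma> z \<in> Z" by (simp add: Z_def)
      qed
      \<comment> \<open>Surjectivity does not pass to pointwise limits by itself; here an injective
        self-map of the finite set of roots is onto.\<close>
      hence "\<sigma> ` Z = Z" using endo_inj_surj[OF fin] inj_on_subset[OF inj ZQ] by blast
      moreover have "y \<in> Z" using p(2) by (simp add: Z_def)
      ultimately show "y \<in> \<sigma> ` QQbar" using ZQ by blast
    qed
  qed
  ultimately have \<sigma>G: "\<sigma> \<in> carrier GalQ" by (simp add: GalQ_iff bij_betw_def \<sigma>_def)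
  obtain k where k: "\<forall>x\<in>F0. \<nu> k x = \<sigma> x" using agree[OF F0] by blast
  define \<tau> where "\<tau> = inv\<^bsub>GalQ\<^esub> (\<nu> k) \<otimes>\<^bsub>GalQ\<^esub> \<sigma>"
  have "\<tau> \<in> N"
  proof (rule N_open)
    show "\<tau> \<in> carrier GalQ" using gal \<sigma>G by (simp add: \<tau>_def)
    fix x assume x: "x \<in> F0"
    hence "\<tau> x = (inv\<^bsub>GalQ\<^esub> (\<nu> k)) (\<nu> k x)"
      using F0(2) k unfolding \<tau>_def by (subst GalQ_mult[OF GalQ.inv_closed[OF gal] \<sigma>G]) auto
    also have "\<dots> = x" using x F0(2) by (intro GalQ_inv(1)[OF gal]) auto
    finally show "\<tau> x = x" .
  qed
  moreover have "\<sigma> = \<nu> k \<otimes>\<^bsub>GalQ\<^esub> \<tau>"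
    using gal \<sigma>G by (simp add: \<tau>_def GalQ.m_assoc[symmetric])
  ultimately have "\<sigma> \<in> N" using subgroup.m_closed[OF N \<nu>] by metis
  with \<sigma> show ?thesis by blast
qed

text \<open>Compactness: for each \<open>k\<close> some element of \<open>N\<close> works for the
  first \<open>k\<close> algebraic numbers. Orbits are finite, so a diagonal subsequence is
  eventually constant at every number, and its limit works for all.\<close>

lemma fixed_ints_congruence:
  assumes P: "primeideal P Zbar" and g: "g \<in> carrier GalQ"
    and cong: "\<And>y. y \<in> fixed_ints N \<Longrightarrow> g y - y \<in> P"
  shows "\<exists>n\<in>N. \<forall>x\<in>ZZbar. g x - n x \<in> P"
proof -
  define e where "e = from_nat_into QQbar"
  have ne: "QQbar \<noteq> {}" using algebraic_0 by blast
  have e_range: "range e = QQbar" unfolding e_def by (rule range_from_nat_into[OF ne countable_algebraic])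
  hence eQ: "e i \<in> QQbar" for i by blast
  have "\<exists>n\<in>N. \<forall>i<k. e i \<in> ZZbar \<longrightarrow> g (e i) - n (e i) \<in> P" for k
  proof -
    \<comment> \<open>The enumeration runs through all of \<open>QQbar\<close>; numbers that are not
      integral are replaced by the harmless value 0.\<close>
    define b where "b i = (if e i \<in> ZZbar then e i else 0)" for i
    have bZ: "b i \<in> ZZbar" for i by (simp add: b_def)
    obtain n where "n \<in> N" "\<forall>i<k. g (b i) - n (b i) \<in> P"
      using fixed_ints_congruence_finite[OF N P g cong, where b = b and k = k] bZ by blast
    thus ?thesis by (intro bexI[of _ n]) (auto simp: b_def split: if_splits)
  qed
  then obtain \<nu> where \<nu>: "\<And>k. \<nu> k \<in> N" and \<nu>P: "\<And>k i. i < k \<Longrightarrow> e i \<in> ZZbar \<Longrightarrow> g (e i) - \<nu> k (e i) \<in> P"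
    by metis
  define Q where "Q i s \<longleftrightarrow> (\<exists>c. \<forall>m. \<nu> (s m) (e i) = c)" for i :: nat and s :: "nat \<Rightarrow> nat"
  interpret subseqs Q
  proof
    fix i and s :: "nat \<Rightarrow> nat" assume "strict_mono s"
    have "range (\<lambda>m. \<nu> (s m) (e i)) \<subseteq> (\<lambda>n. n (e i)) ` N" using \<nu> by blast
    hence "finite (range (\<lambda>m. \<nu> (s m) (e i)))"
      using finite_orbit[OF subgroup.subset[OF N] eQ] finite_subset by blast
    then obtain m0 where "infinite {m \<in> UNIV. \<nu> (s m) (e i) = \<nu> (s m0) (e i)}"
      using pigeonhole_infinite[of "UNIV :: nat set" "\<lambda>m. \<nu> (s m) (e i)"] by auto
    then obtain r :: "nat \<Rightarrow> nat" where r: "strict_mono r" "\<And>m. r m \<in> {m \<in> UNIV. \<nu> (s m) (e i) = \<nu> (s m0) (e i)}"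
      using infinite_enumerate by blast
    hence "Q i (s \<circ> r)" by (auto simp: Q_def)
    with r(1) show "\<exists>r. strict_mono r \<and> Q i (s \<circ> r)" by blast
  qed
  have d: "\<exists>c. \<forall>m. \<nu> (diagseq (Suc i + m)) (e i) = c" for i
    using diagseq_holds[of i] by (auto simp: Q_def)
  have "\<exists>\<sigma>\<in>N. \<forall>x\<in>QQbar. \<exists>K. \<forall>k\<ge>K. \<nu> (diagseq k) x = \<sigma> x"
  proof (rule pointwise_limit_in_N)
    show "\<nu> (diagseq k) \<in> N" for k by (rule \<nu>)
    fix x assume "x \<in> QQbar"
    then obtain i where i: "x = e i" using e_range by blast
    obtain c where c: "\<And>m. \<nu> (diagseq (Suc i + m)) (e i) = c" using d[of i] by blast
    have "\<nu> (diagseq k) x = c" if "k \<ge> Suc i" for k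
      using c[of "k - Suc i"] that i by simp
    thus "\<exists>K c. \<forall>k\<ge>K. \<nu> (diagseq k) x = c" by blast
  qed
  then obtain \<sigma> where \<sigma>: "\<sigma> \<in> N" "\<And>x. x \<in> QQbar \<Longrightarrow> \<exists>K. \<forall>k\<ge>K. \<nu> (diagseq k) x = \<sigma> x" by blast
  have "g x - \<sigma> x \<in> P" if x: "x \<in> ZZbar" for x
  proof -
    have "x \<in> QQbar" using x by auto
    then obtain i where i: "x = e i" using e_range by blast
    obtain K where K: "\<forall>k\<ge>K. \<nu> (diagseq k) x = \<sigma> x" using \<sigma>(2)[OF \<open>x \<in> QQbar\<close>] by blast
    \<comment> \<open>Beyond \<open>K\<close> the sequence has its limit value at \<open>x\<close>,
      and \<open>diagseq k \<ge> k > i\<close> puts \<open>e i\<close> among the numbers already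
      handled.\<close>
    define k where "k = max K (Suc i)"
    have "i < diagseq k" using seq_suble[OF subseq_diagseq, of k] by (simp add: k_def)
    hence "g (e i) - \<nu> (diagseq k) (e i) \<in> P" using x i by (intro \<nu>P) auto
    thus ?thesis using K i by (simp add: k_def)
  qed
  with \<sigma>(1) show ?thesis by blast
qed

section \<open>Separating the cosets of \<open>N\<close> by tensors\<close>

context
  assumes inertia: "\<And>p P. prime p \<Longrightarrow> P \<in> primes_above p \<Longrightarrow> inertia_group P \<subseteq> N"
begin

text \<open>Some \<open>n\<close> in \<open>N\<close> has the same effect as \<open>g\<close> modulo
  \<open>P\<close> on all algebraic integers. Then \<open>g\<close> times the inverse of
  \<open>n\<close> acts trivially modulo \<open>P\<close>, so it lies in the inertia group, which
  \<open>N\<close> contains.\<close>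

lemma in_N_if_fixed_ints_congruent:
  assumes p: "prime p" "P \<in> primes_above p" and g: "g \<in> carrier GalQ"
    and cong: "\<And>y. y \<in> fixed_ints N \<Longrightarrow> g y - y \<in> P"
  shows "g \<in> N"
proof -
  have P: "primeideal P Zbar" using p by (simp add: primes_above_def)
  note P1 = primeideal_Zbar_rules(1)[OF P, unfolded zbar_ideal_def]
  obtain n where n: "n \<in> N" "\<And>x. x \<in> ZZbar \<Longrightarrow> g x - n x \<in> P"
    using fixed_ints_congruence[OF P g cong] by blast
  have nG: "n \<in> carrier GalQ" using n(1) subgroup.subset[OF N] by blast
  define \<tau> where "\<tau> = g \<otimes>\<^bsub>GalQ\<^esub> inv\<^bsub>GalQ\<^esub> n"
  have \<tau>G: "\<tau> \<in> carrier GalQ" using g nG by (simp add: \<tau>_def)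
  have \<tau>: "\<tau> x - x \<in> P" if x: "x \<in> ZZbar" for x
  proof -
    have xQ: "x \<in> QQbar" using x by auto
    have "\<tau> x = g ((inv\<^bsub>GalQ\<^esub> n) x)" unfolding \<tau>_def by (rule GalQ_mult[OF g GalQ.inv_closed[OF nG] xQ])
    moreover have "n ((inv\<^bsub>GalQ\<^esub> n) x) = x" by (rule GalQ_inv(2)[OF nG xQ])
    ultimately show ?thesis using n(2)[OF GalQ_closed_ZZbar[OF GalQ.inv_closed[OF nG] x]] by simp
  qed
  have "\<tau> ` P = P"
  proof
    show "\<tau> ` P \<subseteq> P"
    proof clarify
      fix x assume x: "x \<in> P"
      hence "\<tau> x - x + x \<in> P" using \<tau> P1 by blast
      thus "\<tau> x \<in> P" by simp
    qed
    show "P \<subseteq> \<tau> ` P"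
    proof
      fix x assume x: "x \<in> P"
      hence xZ: "x \<in> ZZbar" "x \<in> QQbar" using P1 by auto
      define y where "y = (inv\<^bsub>GalQ\<^esub> \<tau>) x"
      have y: "y \<in> ZZbar" "\<tau> y = x" unfolding y_def
        using GalQ_closed_ZZbar[OF GalQ.inv_closed[OF \<tau>G] xZ(1)] GalQ_inv(2)[OF \<tau>G xZ(2)] by auto
      have "x + - (\<tau> y - y) \<in> P"
        using \<tau>[OF y(1)] x P1 zbar_ideal_uminus[OF primeideal_Zbar_rules(1)[OF P]] by blast
      hence "y \<in> P" using y(2) by simp
      thus "x \<in> \<tau> ` P" using y(2) by blast
    qed
  qed
  hence "\<tau> \<in> inertia_group P" using \<tau>G \<tau> by (simp add: inertia_group_def decomposition_group_def)
  hence "\<tau> \<in> N" using inertia[OF p] by blast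
  moreover have "g = \<tau> \<otimes>\<^bsub>GalQ\<^esub> n" using g nG by (simp add: \<tau>_def GalQ.m_assoc)
  ultimately show ?thesis using subgroup.m_closed[OF N _ n(1)] by metis
qed

text \<open>The ideal \<open>J\<close> generated by the \<open>y - g y\<close> contains 1, as
  otherwise a prime above it would put \<open>g\<close> into \<open>N\<close>. The relation
  expressing this is a tensor whose values at the identity and at \<open>g\<close> differ by
  1.\<close>

lemma separating_tensor:
  assumes g: "g \<in> carrier GalQ" "g \<notin> N"
  shows "\<exists>ts. set ts \<subseteq> ZZbar \<times> fixed_ints N \<and> tensor_eval ts (\<lambda>x. x) = 1 \<and> tensor_eval ts g = 0"
proof -
  define D where "D ts = (\<Sum>(x, y)\<leftarrow>ts. x * (y - g y))" for ts :: "(complex \<times> complex) list"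
  define J where "J = D ` {ts. set ts \<subseteq> ZZbar \<times> fixed_ints N}"
  have Z: "D ts \<in> ZZbar" if "set ts \<subseteq> ZZbar \<times> fixed_ints N" for ts
    using that
  proof (induction ts)
    case (Cons t ts)
    obtain x y where t: "t = (x, y)" by force
    have "x \<in> ZZbar" "y \<in> ZZbar" using Cons.prems t by (auto simp: fixed_ints_def)
    hence "x * (y - g y) \<in> ZZbar"
      by (intro ZZ.times_closed ZZ.minus_closed GalQ_closed_ZZbar[OF g(1)])
    moreover have "D ts \<in> ZZbar" using Cons by simp
    ultimately have "x * (y - g y) + D ts \<in> ZZbar" by (rule ZZ.plus_closed)
    thus ?case by (simp add: D_def t)
  qed (simp add: D_def)
  have "zbar_ideal J" unfolding zbar_ideal_def
  proof (intro conjI ballI)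
    show "J \<subseteq> ZZbar" using Z by (auto simp: J_def)
    show "0 \<in> J" unfolding J_def by (rule image_eqI[of _ _ "[]"]) (auto simp: D_def)
  next
    fix x y assume "x \<in> J" "y \<in> J"
    then obtain ts us where "set ts \<subseteq> ZZbar \<times> fixed_ints N" "set us \<subseteq> ZZbar \<times> fixed_ints N"
      "x = D ts" "y = D us" by (auto simp: J_def)
    thus "x + y \<in> J" unfolding J_def by (intro image_eqI[of _ _ "ts @ us"]) (auto simp: D_def)
  next
    fix a x assume a: "a \<in> ZZbar" and "x \<in> J"
    then obtain ts where ts: "set ts \<subseteq> ZZbar \<times> fixed_ints N" "x = D ts" by (auto simp: J_def)
    have "D (map (\<lambda>(x, y). (a * x, y)) ts) = a * D ts"
      by (induction ts) (auto simp: D_def algebra_simps)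
    thus "a * x \<in> J" unfolding J_def using ts a
      by (intro image_eqI[of _ _ "map (\<lambda>(x, y). (a * x, y)) ts"]) (auto intro: algebraic_int_plus_times)
  qed
  have "1 \<in> J"
  proof (rule ccontr)
    assume "1 \<notin> J"
    with ex_primeideal_above[OF \<open>zbar_ideal J\<close>] obtain p P where p: "prime p" "P \<in> primes_above p" "J \<subseteq> P" by blast
    have "g \<in> N"
    proof (rule in_N_if_fixed_ints_congruent[OF p(1,2) g(1)])
      fix y assume y: "y \<in> fixed_ints N"
      have "g y - y \<in> J" unfolding J_def using y ZZ.uminus_closed[OF ZZ.one_closed]
        by (intro image_eqI[of _ _ "[(- 1, y)]"]) (auto simp: D_def)
      thus "g y - y \<in> P" using p(3) by blast
    qed
    with g(2) show False by simp
  qed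
  then obtain ts where ts: "set ts \<subseteq> ZZbar \<times> fixed_ints N" "D ts = 1" by (auto simp: J_def)
  \<comment> \<open>Adding the pair \<open>(c, 1)\<close> shifts both values by \<open>c\<close>,
    which brings the value at \<open>g\<close> to 0 and the one at the identity to 1.\<close>
  define c where "c = - tensor_eval ts g"
  have tZ: "tensor_eval ts g \<in> ZZbar" using ts(1)
  proof (induction ts)
    case (Cons t ts)
    obtain x y where t: "t = (x, y)" by force
    have "x * g y \<in> ZZbar"
      using Cons.prems t by (intro ZZ.times_closed GalQ_closed_ZZbar[OF g(1)]) (auto simp: fixed_ints_def)
    moreover have "tensor_eval ts g \<in> ZZbar" using Cons by simp
    ultimately have "x * g y + tensor_eval ts g \<in> ZZbar" by (rule ZZ.plus_closed)
    thus ?case by (simp add: tensor_eval_def t)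
  qed (simp add: tensor_eval_def)
  have D: "D ts = tensor_eval ts (\<lambda>x. x) - tensor_eval ts g"
    by (induction ts) (auto simp: D_def tensor_eval_def algebra_simps)
  have one: "1 \<in> fixed_ints N"
    using subgroup.subset[OF N] subring_hom.hom_one[OF GalQ_hom] ZZ.one_closed by (auto simp: fixed_ints_def)
  show ?thesis
  proof (intro exI[of _ "(c, 1) # ts"] conjI)
    show "set ((c, 1) # ts) \<subseteq> ZZbar \<times> fixed_ints N" using ts(1) one tZ by (auto simp: c_def)
    show "tensor_eval ((c, 1) # ts) (\<lambda>x. x) = 1"
      using D ts(2) by (simp add: tensor_eval_def c_def)
    show "tensor_eval ((c, 1) # ts) g = 0"
      using subring_hom.hom_one[OF GalQ_hom[OF g(1)]] by (simp add: tensor_eval_def c_def)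
  qed
qed

text \<open>Multiplication in the tensor product ring. It allows tensors vanishing at one
  automorphism each to be combined into one vanishing at all of them.\<close>

lemma tensor_eval_product:
  assumes "\<And>y y'. y \<in> fixed_ints N \<Longrightarrow> y' \<in> fixed_ints N \<Longrightarrow> h (y * y') = h y * h y'"
    "set ts \<subseteq> ZZbar \<times> fixed_ints N" "set us \<subseteq> ZZbar \<times> fixed_ints N"
  shows "tensor_eval (map (\<lambda>((x, y), (x', y')). (x * x', y * y')) (List.product ts us)) h =
    tensor_eval ts h * tensor_eval us h"
  using assms(2)
proof (induction ts)
  case (Cons t ts)
  obtain x y where t: "t = (x, y)" by force
  have y: "y \<in> fixed_ints N" using Cons.prems t by auto
  have 1: "tensor_eval (map (\<lambda>(x', y'). (x * x', y * y')) us) h = x * h y * tensor_eval us h"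
    using assms(3) by (induction us) (auto simp: tensor_eval_def algebra_simps assms(1)[OF y] assms(1)[OF _ y])
  have 2: "map (\<lambda>((x, y), (x', y')). (x * x', y * y')) (List.product (t # ts) us) =
      map (\<lambda>(x', y'). (x * x', y * y')) us @ map (\<lambda>((x, y), (x', y')). (x * x', y * y')) (List.product ts us)"
    by (simp add: t)
  have 3: "tensor_eval (map (\<lambda>((x, y), (x', y')). (x * x', y * y')) (List.product ts us)) h =
      tensor_eval ts h * tensor_eval us h" using Cons by simp
  show ?case unfolding 2 tensor_eval_append 1 3 by (simp add: tensor_eval_def t distrib_right)
qed (simp add: tensor_eval_def)

lemma fixed_ints_times:
  assumes "y \<in> fixed_ints N" "y' \<in> fixed_ints N"
  shows "y * y' \<in> fixed_ints N"
proof -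
  have y: "y \<in> ZZbar" "y' \<in> ZZbar" using assms by (auto simp: fixed_ints_def)
  have "n (y * y') = y * y'" if "n \<in> N" for n
  proof -
    have "n \<in> carrier GalQ" using that subgroup.subset[OF N] by blast
    from subring_hom.hom_times[OF GalQ_hom_ZZbar[OF this] y]
    have "n (y * y') = n y * n y'" .
    moreover have "n y = y" "n y' = y'" using assms that by (auto simp: fixed_ints_def)
    ultimately show ?thesis by simp
  qed
  with ZZ.times_closed[OF y] show ?thesis by (simp add: fixed_ints_def)
qed

lemma separating_tensor_finite:
  assumes "finite H" "H \<subseteq> carrier GalQ - N"
  shows "\<exists>ts. set ts \<subseteq> ZZbar \<times> fixed_ints N \<and> tensor_eval ts (\<lambda>x. x) = 1 \<and> (\<forall>h\<in>H. tensor_eval ts h = 0)"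
  using assms
proof (induction H rule: finite_induct)
  case empty
  have one: "1 \<in> fixed_ints N"
    using subgroup.subset[OF N] subring_hom.hom_one[OF GalQ_hom] ZZ.one_closed by (auto simp: fixed_ints_def)
  show ?case by (rule exI[of _ "[(1, 1)]"]) (use one in \<open>auto simp: tensor_eval_def\<close>)
next
  case (insert g H)
  then obtain ts where ts: "set ts \<subseteq> ZZbar \<times> fixed_ints N" "tensor_eval ts (\<lambda>x. x) = 1" "\<forall>h\<in>H. tensor_eval ts h = 0"
    by auto
  obtain us where us: "set us \<subseteq> ZZbar \<times> fixed_ints N" "tensor_eval us (\<lambda>x. x) = 1" "tensor_eval us g = 0"
    using separating_tensor[of g] insert.prems by auto
  define vs where "vs = map (\<lambda>((x, y), (x', y')). (x * x', y * y')) (List.product ts us)"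
  have hom: "h (y * y') = h y * h y'" if "h \<in> insert g H" "y \<in> fixed_ints N" "y' \<in> fixed_ints N" for h y y'
    using subring_hom.hom_times[OF GalQ_hom_ZZbar, of h y y'] that insert.prems by (auto simp: fixed_ints_def)
  have "tensor_eval vs h = tensor_eval ts h * tensor_eval us h" if "h \<in> insert g H" for h
    unfolding vs_def by (rule tensor_eval_product[OF hom[OF that] ts(1) us(1)])
  moreover have "tensor_eval vs (\<lambda>x. x) = tensor_eval ts (\<lambda>x. x) * tensor_eval us (\<lambda>x. x)"
    unfolding vs_def by (rule tensor_eval_product[OF _ ts(1) us(1)]) simp
  moreover have "set vs \<subseteq> ZZbar \<times> fixed_ints N"
    using ts(1) us(1) by (auto simp: vs_def intro!: algebraic_int_plus_times fixed_ints_times)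
  ultimately show ?case using ts us by (intro exI[of _ vs]) auto
qed

end
end

section \<open>Integral bases and the absence of unramified extensions\<close>

text \<open>Expanding by multilinearity in the rows writes the determinant of \<open>V * W\<close>
  as a combination of determinants of \<open>n\<close> rows of \<open>W\<close>, a weak form of the
  Cauchy-Binet formula.\<close>

lemma det_mult_sum_rows:
  fixes V :: "'a :: comm_ring_1 mat"
  assumes V: "V \<in> carrier_mat n m" and W: "W \<in> carrier_mat m n"
    and zero: "\<And>f. (\<And>i. i < n \<Longrightarrow> f i < m) \<Longrightarrow> det (mat n n (\<lambda>(i, k). W $$ (f i, k))) = 0"
  shows "det (V * W) = 0"
proof -
  define a where "a i j = V $$ (i, j) \<cdot>\<^sub>v row W j" for i j
  have a: "a i j \<in> carrier_vec n" if "j < m" for i j using W that by (simp add: a_def)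
  have "V * W = mat\<^sub>r n n (\<lambda>i. finsum_vec TYPE('a) n (a i) {0..<m})"
  proof (rule eq_matI)
    fix i k assume "i < dim_row (mat\<^sub>r n n (\<lambda>i. finsum_vec TYPE('a) n (a i) {0..<m}))"
      "k < dim_col (mat\<^sub>r n n (\<lambda>i. finsum_vec TYPE('a) n (a i) {0..<m}))"
    hence ik: "i < n" "k < n" by auto
    have "finsum_vec TYPE('a) n (a i) {0..<m} $ k = (\<Sum>j = 0..<m. a i j $ k)"
      using a ik by (intro index_finsum_vec) auto
    also have "\<dots> = (\<Sum>j = 0..<m. V $$ (i, j) * W $$ (j, k))"
      using W ik by (intro sum.cong) (auto simp: a_def)
    finally show "(V * W) $$ (i, k) = mat\<^sub>r n n (\<lambda>i. finsum_vec TYPE('a) n (a i) {0..<m}) $$ (i, k)"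
      using V W ik by (auto simp: scalar_prod_def)
  qed (use V W in auto)
  also have "det \<dots> = (\<Sum>f | (\<forall>i\<in>{0..<n}. f i \<in> {0..<m}) \<and> (\<forall>i. i \<notin> {0..<n} \<longrightarrow> f i = i).
      det (mat\<^sub>r n n (\<lambda>i. a i (f i))))"
    by (rule det_linear_rows_sum) (use a in auto)
  also have "\<dots> = 0"
  proof (intro sum.neutral ballI)
    fix f assume "f \<in> {f. (\<forall>i\<in>{0..<n}. f i \<in> {0..<m}) \<and> (\<forall>i. i \<notin> {0..<n} \<longrightarrow> f i = i)}"
    hence f: "f i < m" if "i < n" for i using that by auto
    have "det (mat\<^sub>r n n (\<lambda>i. a i (f i))) = prod (\<lambda>i. V $$ (i, f i)) {0..<n} * det (mat\<^sub>r n n (\<lambda>i. row W (f i)))"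
      unfolding a_def by (rule det_rows_mul) (use W f in auto)
    also have "mat\<^sub>r n n (\<lambda>i. row W (f i)) = mat n n (\<lambda>(i, k). W $$ (f i, k))"
      using W f by (auto intro!: eq_matI)
    finally show "det (mat\<^sub>r n n (\<lambda>i. a i (f i))) = 0" using zero[OF f] by simp
  qed
  finally show ?thesis .
qed

lemma sum_list_nth: "(\<Sum>t\<leftarrow>ts. f t) = (\<Sum>j<length ts. f (ts ! j))"
  by (simp add: sum_list_sum_nth lessThan_atLeast0)

lemma GalQ_fixed_imp_int:
  assumes "algebraic_int s" "\<And>\<sigma>. \<sigma> \<in> carrier GalQ \<Longrightarrow> \<sigma> s = s"
  shows "\<exists>k::int. s = of_int k"
proof -
  have "s \<in> \<int>" by (rule GalQ_fixed_algebraic_int) (use assms in auto)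
  thus ?thesis by (auto elim: Ints_cases)
qed

section \<open>Coset representatives as embeddings of the fixed field: trace, norm,
  discriminant\<close>

context
  fixes N :: "(complex \<Rightarrow> complex) set" and r :: "nat \<Rightarrow> complex \<Rightarrow> complex" and n :: nat and ts :: "(complex \<times> complex) list"
  assumes N: "subgroup N GalQ"
    and r: "\<And>k. k < n \<Longrightarrow> r k \<in> carrier GalQ"
    and cover: "\<And>g. g \<in> carrier GalQ \<Longrightarrow> \<exists>k<n. inv\<^bsub>GalQ\<^esub> (r k) \<otimes>\<^bsub>GalQ\<^esub> g \<in> N"
    and distinct: "\<And>k l. k < n \<Longrightarrow> l < n \<Longrightarrow> inv\<^bsub>GalQ\<^esub> (r k) \<otimes>\<^bsub>GalQ\<^esub> r l \<in> N \<Longrightarrow> k = l"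
    and ts: "set ts \<subseteq> ZZbar \<times> fixed_ints N" "tensor_eval ts (\<lambda>x. x) = 1"
      "\<And>k l. k < n \<Longrightarrow> l < n \<Longrightarrow> k \<noteq> l \<Longrightarrow> tensor_eval ts (inv\<^bsub>GalQ\<^esub> (r k) \<otimes>\<^bsub>GalQ\<^esub> r l) = 0"
begin

abbreviation "O_N \<equiv> fixed_ints N"

lemma O_N_ZZbar: "y \<in> O_N \<Longrightarrow> y \<in> ZZbar"
  by (simp add: fixed_ints_def)

lemma r_ZZbar: "k < n \<Longrightarrow> y \<in> ZZbar \<Longrightarrow> r k y \<in> ZZbar"
  by (rule GalQ_closed_ZZbar[OF r])

lemma same_coset_apply:
  assumes g: "g \<in> carrier GalQ" "h \<in> carrier GalQ" "inv\<^bsub>GalQ\<^esub> h \<otimes>\<^bsub>GalQ\<^esub> g \<in> N" and y: "y \<in> O_N"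
  shows "g y = h y"
proof -
  define m where "m = inv\<^bsub>GalQ\<^esub> h \<otimes>\<^bsub>GalQ\<^esub> g"
  have m: "m \<in> N" "m \<in> carrier GalQ" using g by (auto simp: m_def)
  have "g = h \<otimes>\<^bsub>GalQ\<^esub> m" using g by (simp add: m_def GalQ.m_assoc[symmetric])
  moreover have "y \<in> QQbar" using y by (auto simp: fixed_ints_def)
  ultimately have "g y = h (m y)" using GalQ_mult[OF g(2) m(2)] by simp
  moreover have "m y = y" using m(1) y by (auto simp: fixed_ints_def)
  ultimately show ?thesis by simp
qed

text \<open>\<open>\<sigma>\<close> moves the coset of \<open>r k\<close> to that of some
  \<open>r (\<pi> k)\<close>, and on \<open>O_N\<close> an automorphism depends on its coset only.
  Hence traces and norms are rational, and complex conjugation permutes the embeddings.\<close>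

lemma GalQ_permutes_cosets:
  assumes \<sigma>: "\<sigma> \<in> carrier GalQ"
  shows "\<exists>\<pi>. bij_betw \<pi> {..<n} {..<n} \<and> (\<forall>k<n. \<forall>y\<in>O_N. \<sigma> (r k y) = r (\<pi> k) y)"
proof -
  have "\<forall>k. \<exists>l. k < n \<longrightarrow> l < n \<and> inv\<^bsub>GalQ\<^esub> (r l) \<otimes>\<^bsub>GalQ\<^esub> (\<sigma> \<otimes>\<^bsub>GalQ\<^esub> r k) \<in> N"
    using cover \<sigma> r by (metis GalQ.m_closed)
  then obtain \<pi> where \<pi>: "\<And>k. k < n \<Longrightarrow> \<pi> k < n"
    "\<And>k. k < n \<Longrightarrow> inv\<^bsub>GalQ\<^esub> (r (\<pi> k)) \<otimes>\<^bsub>GalQ\<^esub> (\<sigma> \<otimes>\<^bsub>GalQ\<^esub> r k) \<in> N" by metis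
  have "inj_on \<pi> {..<n}"
  proof (rule inj_onI)
    fix k l assume kl: "k \<in> {..<n}" "l \<in> {..<n}" "\<pi> k = \<pi> l"
    define a where "a = inv\<^bsub>GalQ\<^esub> (r (\<pi> k)) \<otimes>\<^bsub>GalQ\<^esub> (\<sigma> \<otimes>\<^bsub>GalQ\<^esub> r k)"
    define b where "b = inv\<^bsub>GalQ\<^esub> (r (\<pi> k)) \<otimes>\<^bsub>GalQ\<^esub> (\<sigma> \<otimes>\<^bsub>GalQ\<^esub> r l)"
    have ab: "a \<in> N" "b \<in> N" using \<pi>(2)[of k] \<pi>(2)[of l] kl by (auto simp: a_def b_def)
    have cl: "r k \<in> carrier GalQ" "r l \<in> carrier GalQ" "r (\<pi> k) \<in> carrier GalQ" using kl r \<pi>(1)[of k] by auto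
    have "inv\<^bsub>GalQ\<^esub> a \<otimes>\<^bsub>GalQ\<^esub> b = inv\<^bsub>GalQ\<^esub> (r k) \<otimes>\<^bsub>GalQ\<^esub> r l"
      unfolding a_def b_def using cl \<sigma>
      by (simp add: GalQ.inv_mult_group GalQ.m_assoc) (simp add: GalQ.m_assoc[symmetric])
    moreover have "inv\<^bsub>GalQ\<^esub> a \<otimes>\<^bsub>GalQ\<^esub> b \<in> N"
      using subgroup.m_closed[OF N subgroup.m_inv_closed[OF N ab(1)] ab(2)] .
    ultimately show "k = l" using distinct kl by simp
  qed
  hence "bij_betw \<pi> {..<n} {..<n}"
    using \<pi>(1) endo_inj_surj[of "{..<n}" \<pi>] by (auto simp: bij_betw_def image_subset_iff)
  moreover have "\<sigma> (r k y) = r (\<pi> k) y" if k: "k < n" and y: "y \<in> O_N" for k y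
  proof -
    have "y \<in> QQbar" using O_N_ZZbar[OF y] by auto
    hence "\<sigma> (r k y) = (\<sigma> \<otimes>\<^bsub>GalQ\<^esub> r k) y" using GalQ_mult[OF \<sigma> r[OF k]] by simp
    also have "\<dots> = r (\<pi> k) y"
      by (rule same_coset_apply[OF _ r[OF \<pi>(1)[OF k]] \<pi>(2)[OF k] y]) (use \<sigma> r k in simp)
    finally show ?thesis .
  qed
  ultimately show ?thesis by blast
qed

lemma trace_int:
  assumes y: "y \<in> O_N"
  shows "\<exists>t::int. (\<Sum>k<n. r k y) = of_int t"
proof (rule GalQ_fixed_imp_int)
  have rZ: "r k y \<in> ZZbar" if "k < n" for k using r_ZZbar[OF that O_N_ZZbar[OF y]] .
  show "algebraic_int (\<Sum>k<n. r k y)" using ZZ.sum_closed[of "{..<n}" "\<lambda>k. r k y"] rZ by auto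
  fix \<sigma> assume \<sigma>: "\<sigma> \<in> carrier GalQ"
  from GalQ_permutes_cosets[OF this] obtain \<pi> where \<pi>: "bij_betw \<pi> {..<n} {..<n}"
    "\<And>k. k < n \<Longrightarrow> \<sigma> (r k y) = r (\<pi> k) y" using y by blast
  have "\<sigma> (\<Sum>k<n. r k y) = (\<Sum>k<n. r (\<pi> k) y)"
    using rZ \<pi>(2) by (subst subring_hom.hom_sum[OF GalQ_hom_ZZbar[OF \<sigma>]]) auto
  also have "\<dots> = (\<Sum>k<n. r k y)" by (rule sum.reindex_bij_betw[OF \<pi>(1)])
  finally show "\<sigma> (\<Sum>k<n. r k y) = (\<Sum>k<n. r k y)" .
qed

lemma norm_int:
  assumes y: "y \<in> O_N"
  shows "\<exists>t::int. (\<Prod>k<n. r k y) = of_int t"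
proof (rule GalQ_fixed_imp_int)
  have rZ: "r k y \<in> ZZbar" if "k < n" for k using r_ZZbar[OF that O_N_ZZbar[OF y]] .
  show "algebraic_int (\<Prod>k<n. r k y)" using ZZ.prod_closed[of "{..<n}" "\<lambda>k. r k y"] rZ by auto
  fix \<sigma> assume \<sigma>: "\<sigma> \<in> carrier GalQ"
  from GalQ_permutes_cosets[OF this] obtain \<pi> where \<pi>: "bij_betw \<pi> {..<n} {..<n}"
    "\<And>k. k < n \<Longrightarrow> \<sigma> (r k y) = r (\<pi> k) y" using y by blast
  have "\<sigma> (\<Prod>k<n. r k y) = (\<Prod>k<n. r (\<pi> k) y)"
    using rZ \<pi>(2) by (subst subring_hom.hom_prod[OF GalQ_hom_ZZbar[OF \<sigma>]]) auto
  also have "\<dots> = (\<Prod>k<n. r k y)" by (rule prod.reindex_bij_betw[OF \<pi>(1)])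
  finally show "\<sigma> (\<Prod>k<n. r k y) = (\<Prod>k<n. r k y)" .
qed

lemma O_N_plus_times:
  assumes "x \<in> O_N" "y \<in> O_N"
  shows "x + y \<in> O_N" "x * y \<in> O_N" "of_int c * x \<in> O_N"
proof -
  have Z: "x \<in> ZZbar" "y \<in> ZZbar" "of_int c \<in> ZZbar" using assms O_N_ZZbar ZZ.of_int_closed by auto
  have "m (x + y) = x + y \<and> m (x * y) = x * y \<and> m (of_int c * x) = of_int c * x" if "m \<in> N" for m
  proof -
    have "m \<in> carrier GalQ" using that subgroup.subset[OF N] by blast
    then interpret subring_hom ZZbar m by (rule GalQ_hom_ZZbar)
    have "m x = x" "m y = y" using assms that by (auto simp: fixed_ints_def)
    thus ?thesis using hom_plus[OF Z(1,2)] hom_times[OF Z(1,2)] hom_times[OF Z(3,1)] hom_of_int by simp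
  qed
  thus "x + y \<in> O_N" "x * y \<in> O_N" "of_int c * x \<in> O_N"
    using ZZ.plus_closed[OF Z(1,2)] ZZ.times_closed[OF Z(1,2)] ZZ.times_closed[OF Z(3,1)]
    by (simp_all add: fixed_ints_def)
qed

lemma O_N_sum:
  fixes m :: nat
  shows "(\<And>i. i < m \<Longrightarrow> f i \<in> O_N) \<Longrightarrow> m > 0 \<Longrightarrow> (\<Sum>i<m. f i) \<in> O_N"
proof (induction m)
  case (Suc m)
  thus ?case by (cases m) (auto intro: O_N_plus_times)
qed simp

text \<open>One row for each embedding; the squared determinant is the discriminant of the family
  \<open>b\<close>.\<close>

definition emb_mat :: "(nat \<Rightarrow> complex) \<Rightarrow> complex mat" where
  "emb_mat b = mat n n (\<lambda>(k, i). r k (b i))"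

lemma emb_mat_carrier: "emb_mat b \<in> carrier_mat n n" by (simp add: emb_mat_def)

text \<open>Apply \<open>r k\<close> to the value of the tensor at the quotient of
  \<open>r l\<close> by \<open>r k\<close>. The two components of \<open>ts\<close> thus behave like
  dual bases with respect to the embeddings.\<close>

lemma tensor_orthogonal:
  assumes k: "k < n" "l < n"
  shows "(\<Sum>j<length ts. r k (fst (ts ! j)) * r l (snd (ts ! j))) = (if k = l then 1 else 0)"
proof -
  interpret subring_hom ZZbar "r k" by (rule GalQ_hom_ZZbar[OF r[OF k(1)]])
  define g where "g = inv\<^bsub>GalQ\<^esub> (r k) \<otimes>\<^bsub>GalQ\<^esub> r l"
  have g: "g \<in> carrier GalQ" using r k by (simp add: g_def)
  have t: "fst (ts ! j) \<in> ZZbar" "snd (ts ! j) \<in> O_N" if "j < length ts" for j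
    using ts(1) nth_mem[OF that] by (cases "ts ! j"; auto)+
  have tg: "r k (g (snd (ts ! j))) = r l (snd (ts ! j))" if "j < length ts" for j
  proof -
    have "snd (ts ! j) \<in> QQbar" using O_N_ZZbar[OF t(2)[OF that]] by auto
    moreover have "r k \<otimes>\<^bsub>GalQ\<^esub> g = r l" using r k by (simp add: g_def GalQ.m_assoc[symmetric])
    ultimately show ?thesis using GalQ_mult[OF r[OF k(1)] g] by metis
  qed
  have ev: "tensor_eval ts h = (\<Sum>j<length ts. fst (ts ! j) * h (snd (ts ! j)))" for h
    by (simp add: tensor_eval_def sum_list_nth split_def)
  have "(\<Sum>j<length ts. r k (fst (ts ! j)) * r l (snd (ts ! j))) =
        (\<Sum>j<length ts. r k (fst (ts ! j) * g (snd (ts ! j))))"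
  proof (intro sum.cong refl)
    fix j assume "j \<in> {..<length ts}"
    hence j: "j < length ts" by simp
    have "r k (fst (ts ! j) * g (snd (ts ! j))) = r k (fst (ts ! j)) * r k (g (snd (ts ! j)))"
      by (intro hom_times t[OF j] GalQ_closed_ZZbar[OF g] O_N_ZZbar)
    thus "r k (fst (ts ! j)) * r l (snd (ts ! j)) = r k (fst (ts ! j) * g (snd (ts ! j)))"
      using tg[OF j] by simp
  qed
  also have "\<dots> = r k (tensor_eval ts g)" unfolding ev
    by (rule hom_sum[symmetric]) (use t in \<open>auto intro!: ZZ.times_closed[simplified] GalQ_closed_ZZbar[OF g, simplified] dest: O_N_ZZbar\<close>)
  also have "tensor_eval ts g = (if k = l then 1 else 0)"
  proof (cases "k = l")
    case True
    hence g1: "g = \<one>\<^bsub>GalQ\<^esub>" using r k by (simp add: g_def)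
    have "tensor_eval ts g = tensor_eval ts (\<lambda>x. x)" unfolding ev
    proof (intro sum.cong refl arg_cong2[of _ _ _ _ "(*)"])
      fix j assume "j \<in> {..<length ts}"
      hence "snd (ts ! j) \<in> QQbar" using O_N_ZZbar[OF t(2)[of j]] by auto
      thus "g (snd (ts ! j)) = snd (ts ! j)" unfolding g1 by (rule GalQ_one)
    qed
    thus ?thesis using ts(2) True by simp
  next
    case False
    thus ?thesis using ts(3)[OF k] by (simp add: g_def)
  qed
  also have "r k (if k = l then 1 else 0) = (if k = l then 1 else 0)"
    using hom_one hom_zero by (cases "k = l") simp_all
  finally show ?thesis .
qed

text \<open>By orthogonality, the conjugates of the components of \<open>ts\<close> form matrices
  with \<open>V * W = 1\<close>. If every choice of \<open>n\<close> second components were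
  degenerate, this product would have determinant 0. No primitive element is called for.\<close>

lemma ex_nondegenerate: "\<exists>b. (\<forall>i. b i \<in> O_N) \<and> det (emb_mat b) \<noteq> 0"
proof (rule ccontr)
  assume no: "\<not> ?thesis"
  define m where "m = length ts"
  define V where "V = mat n m (\<lambda>(k, j). r k (fst (ts ! j)))"
  define W where "W = mat m n (\<lambda>(j, l). r l (snd (ts ! j)))"
  have VW: "V \<in> carrier_mat n m" "W \<in> carrier_mat m n" by (auto simp: V_def W_def)
  have zero_O: "0 \<in> O_N"
    using subgroup.subset[OF N] subring_hom.hom_zero[OF GalQ_hom] ZZ.zero_closed by (auto simp: fixed_ints_def)
  have "det (V * W) = 0"
  proof (rule det_mult_sum_rows[OF VW])
    fix f :: "nat \<Rightarrow> nat" assume f: "\<And>i. i < n \<Longrightarrow> f i < m"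
    \<comment> \<open>Membership in \<open>O_N\<close> is claimed for every index, and
      \<open>f\<close> is controlled below \<open>n\<close> only, hence the padding with 0.\<close>
    define b where "b i = (if i < n then snd (ts ! f i) else 0)" for i
    have "b i \<in> O_N" for i
      using ts(1) nth_mem[of "f i" ts] f[of i] zero_O by (cases "ts ! f i") (auto simp: b_def m_def)
    hence "det (emb_mat b) = 0" using no by blast
    moreover have "mat n n (\<lambda>(i, k). W $$ (f i, k)) = transpose_mat (emb_mat b)"
      using f by (intro eq_matI) (auto simp: W_def emb_mat_def b_def)
    ultimately show "det (mat n n (\<lambda>(i, k). W $$ (f i, k))) = 0"
      by (simp add: det_transpose[OF emb_mat_carrier])
  qed
  moreover have "V * W = 1\<^sub>m n"
    using tensor_orthogonal
    by (intro eq_matI) (auto simp: V_def W_def scalar_prod_def m_def lessThan_atLeast0)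
  ultimately show False by simp
qed

text \<open>The entries are traces of products: this is the Gram matrix of the trace form.\<close>

lemma gram_int:
  assumes b: "\<And>i. i < n \<Longrightarrow> b i \<in> O_N"
  shows "\<exists>G :: int mat. G \<in> carrier_mat n n \<and> map_mat of_int G = transpose_mat (emb_mat b) * emb_mat b"
proof -
  have "\<forall>i j. \<exists>t::int. i < n \<longrightarrow> j < n \<longrightarrow> (\<Sum>k<n. r k (b i * b j)) = of_int t"
    using trace_int O_N_plus_times(2) b by blast
  then obtain t :: "nat \<Rightarrow> nat \<Rightarrow> int" where
    t: "\<And>i j. i < n \<Longrightarrow> j < n \<Longrightarrow> (\<Sum>k<n. r k (b i * b j)) = of_int (t i j)" by metis
  have rm: "r k (b i * b j) = r k (b i) * r k (b j)" if "k < n" "i < n" "j < n" for k i j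
    by (rule subring_hom.hom_times[OF GalQ_hom_ZZbar[OF r[OF that(1)]] O_N_ZZbar O_N_ZZbar]) (use b that in auto)
  have "map_mat of_int (mat n n (\<lambda>(i, j). t i j)) = transpose_mat (emb_mat b) * emb_mat b"
    by (rule eq_matI) (auto simp: emb_mat_def scalar_prod_def t[symmetric] rm lessThan_atLeast0 intro!: sum.cong)
  thus ?thesis by (intro exI[of _ "mat n n (\<lambda>(i, j). t i j)"]) auto
qed

lemma det_emb_mat_square:
  assumes b: "\<And>i. i < n \<Longrightarrow> b i \<in> O_N"
  shows "\<exists>D :: int. det (emb_mat b) ^ 2 = of_int D"
proof -
  obtain G :: "int mat" where G: "G \<in> carrier_mat n n" "map_mat of_int G = transpose_mat (emb_mat b) * emb_mat b"
    using gram_int[of b] b by auto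
  have "of_int (det G) = det (transpose_mat (emb_mat b) * emb_mat b)"
    unfolding G(2)[symmetric] by (simp add: of_int_hom.hom_det)
  also have "\<dots> = det (emb_mat b) ^ 2"
    using emb_mat_carrier[of b] by (subst det_mult[of _ n]) (auto simp: det_transpose[of _ n] power2_eq_square)
  finally show ?thesis by metis
qed

text \<open>The traces of the \<open>b i * x\<close> are integers, and the integral Gram matrix
  sends the coordinates of \<open>x\<close> to them. Cramer's rule gives the coordinates with common
  denominator \<open>D\<close>, the discriminant.\<close>

lemma rational_coordinates:
  assumes b: "\<And>i. i < n \<Longrightarrow> b i \<in> O_N" and nz: "det (emb_mat b) \<noteq> 0" and x: "x \<in> O_N"
  shows "\<exists>D (e :: nat \<Rightarrow> int). D \<noteq> 0 \<and> (\<forall>k<n. r k x = (\<Sum>i<n. of_int (e i) / of_int D * r k (b i)))"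
proof -
  define M where "M = emb_mat b"
  have M: "M \<in> carrier_mat n n" unfolding M_def by (rule emb_mat_carrier)
  obtain G :: "int mat" where G: "G \<in> carrier_mat n n" "map_mat of_int G = transpose_mat M * M"
    using gram_int[of b] b unfolding M_def by auto
  have "\<forall>i. \<exists>t::int. i < n \<longrightarrow> (\<Sum>k<n. r k (b i * x)) = of_int t"
    using trace_int O_N_plus_times(2) b x by blast
  then obtain t :: "nat \<Rightarrow> int" where t: "\<And>i. i < n \<Longrightarrow> (\<Sum>k<n. r k (b i * x)) = of_int (t i)" by metis
  have rm: "r k (b i * x) = r k (b i) * r k x" if "k < n" "i < n" for k i
    by (rule subring_hom.hom_times[OF GalQ_hom_ZZbar[OF r[OF that(1)]] O_N_ZZbar O_N_ZZbar]) (use b x that in auto)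
  define xv where "xv = vec n (\<lambda>k. r k x)"
  define D where "D = det G"
  have "of_int D = det (transpose_mat M * M)"
    unfolding G(2)[symmetric] D_def by (simp add: of_int_hom.hom_det)
  also have "\<dots> = det M * det M" using M by (subst det_mult[of _ n]) (auto simp: det_transpose[of _ n])
  finally have D: "of_int D = det M * det M" .
  have D0: "D \<noteq> 0" using D nz by (auto simp: M_def)
  \<comment> \<open>Multiplying by the adjugate solves the system up to the factor \<open>D\<close>
    without leaving the integers.\<close>
  define ev where "ev = adj_mat G *\<^sub>v vec n t"
  have evc: "ev \<in> carrier_vec n" using adj_mat(1)[OF G(1)] by (simp add: ev_def)
  have "G *\<^sub>v ev = (G * adj_mat G) *\<^sub>v vec n t"
    unfolding ev_def using G(1) adj_mat(1)[OF G(1)] by (subst assoc_mult_mat_vec[of _ n n _ n]) auto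
  also have "\<dots> = D \<cdot>\<^sub>v vec n t"
    unfolding adj_mat(2)[OF G(1)] D_def by (intro eq_vecI) auto
  finally have Gev: "G *\<^sub>v ev = D \<cdot>\<^sub>v vec n t" .
  define ec where "ec = map_vec complex_of_int ev"
  have ecc: "ec \<in> carrier_vec n" using evc by (simp add: ec_def)
  have tM: "transpose_mat M *\<^sub>v xv = map_vec of_int (vec n t)"
    by (intro eq_vecI) (auto simp: M_def xv_def emb_mat_def scalar_prod_def t[symmetric] rm lessThan_atLeast0 intro!: sum.cong)
  have "transpose_mat M *\<^sub>v (M *\<^sub>v ec) = (transpose_mat M * M) *\<^sub>v ec"
    using M ecc by (subst assoc_mult_mat_vec[of _ n n _ n]) auto
  also have "\<dots> = map_vec of_int (G *\<^sub>v ev)"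
    unfolding G(2)[symmetric] ec_def using G(1) evc
    by (simp add: of_int_hom.mult_mat_vec_hom[of _ n n])
  also have "\<dots> = transpose_mat M *\<^sub>v (of_int D \<cdot>\<^sub>v xv)"
    unfolding Gev using tM M by (auto simp: mult_mat_vec[of _ n n] xv_def of_int_hom.vec_hom_smult)
  finally have eq: "transpose_mat M *\<^sub>v (M *\<^sub>v ec - of_int D \<cdot>\<^sub>v xv) = 0\<^sub>v n"
    using M ecc by (subst mult_minus_distrib_mat_vec[of _ n n]) (auto simp: xv_def)
  have "M *\<^sub>v ec - of_int D \<cdot>\<^sub>v xv = 0\<^sub>v n"
  proof (rule ccontr)
    assume "M *\<^sub>v ec - of_int D \<cdot>\<^sub>v xv \<noteq> 0\<^sub>v n"
    moreover have "M *\<^sub>v ec - of_int D \<cdot>\<^sub>v xv \<in> carrier_vec n" using M ecc by (auto simp: xv_def)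
    ultimately have "det (transpose_mat M) = 0"
      using eq M det_0_iff_vec_prod_zero_field[of "transpose_mat M" n] by auto
    thus False using nz det_transpose[OF M] by (simp add: M_def)
  qed
  hence z: "(M *\<^sub>v ec - of_int D \<cdot>\<^sub>v xv) $ k = 0" if "k < n" for k using that by simp
  have "r k x = (\<Sum>i<n. of_int (ev $ i) / of_int D * r k (b i))" if k: "k < n" for k
  proof -
    have "(\<Sum>i<n. r k (b i) * of_int (ev $ i)) = of_int D * r k x"
      using z[OF k] k M ecc evc
      by (simp add: M_def emb_mat_def xv_def scalar_prod_def ec_def lessThan_atLeast0)
    hence "r k x = (\<Sum>i<n. r k (b i) * of_int (ev $ i)) / of_int D" using D0 by (simp add: field_simps)
    thus ?thesis by (simp add: sum_divide_distrib mult.commute)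
  qed
  thus ?thesis using D0 by blast
qed

text \<open>Among nondegenerate families take one whose discriminant is least in absolute value. If
  \<open>x\<close> had a coordinate that is not an integer, exchanging the corresponding
  \<open>b i\<close> for \<open>x - q * b i\<close> would multiply the determinant by a proper
  fraction.\<close>

lemma ex_integral_basis:
  "\<exists>b. (\<forall>i<n. b i \<in> O_N) \<and> det (emb_mat b) \<noteq> 0 \<and>
     (\<forall>x\<in>O_N. \<exists>c :: nat \<Rightarrow> int. \<forall>k<n. r k x = (\<Sum>i<n. of_int (c i) * r k (b i)))"
proof -
  define Q where "Q b \<longleftrightarrow> (\<forall>i<n. b i \<in> O_N) \<and> det (emb_mat b) \<noteq> 0" for b
  \<comment> \<open>The absolute discriminant, turned into a natural number so that a least value
    exists.\<close>
  define \<delta> where "\<delta> b = nat \<bar>SOME D :: int. det (emb_mat b) ^ 2 = of_int D\<bar>" for b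
  have \<delta>: "real (\<delta> b) = cmod (det (emb_mat b)) ^ 2" if "Q b" for b
  proof -
    have "\<exists>D :: int. det (emb_mat b) ^ 2 = of_int D" using that by (intro det_emb_mat_square) (auto simp: Q_def)
    hence "det (emb_mat b) ^ 2 = of_int (SOME D :: int. det (emb_mat b) ^ 2 = of_int D)" by (rule someI_ex)
    hence "cmod (det (emb_mat b) ^ 2) = cmod (of_int (SOME D :: int. det (emb_mat b) ^ 2 = of_int D))" by (rule arg_cong)
    thus ?thesis by (simp add: \<delta>_def norm_power)
  qed
  obtain b0 where "Q b0" using ex_nondegenerate by (auto simp: Q_def)
  from ex_has_least_nat[of Q b0 \<delta>, OF this] obtain b where Qb: "Q b" and min: "\<And>b'. Q b' \<Longrightarrow> \<delta> b \<le> \<delta> b'" by blast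
  have bO: "b i \<in> O_N" if "i < n" for i using Qb that by (simp add: Q_def)
  have nz: "det (emb_mat b) \<noteq> 0" using Qb by (simp add: Q_def)
  have "\<exists>c :: nat \<Rightarrow> int. \<forall>k<n. r k x = (\<Sum>i<n. of_int (c i) * r k (b i))" if x: "x \<in> O_N" for x
  proof -
    obtain D and e :: "nat \<Rightarrow> int" where D: "D \<noteq> 0" and e: "\<And>k. k < n \<Longrightarrow> r k x = (\<Sum>i<n. of_int (e i) / of_int D * r k (b i))"
      using rational_coordinates[OF bO nz x] by metis
    have "D dvd e i" if i: "i < n" for i
    proof (rule ccontr)
      assume nd: "\<not> D dvd e i"
      define q where "q = e i div D"
      \<comment> \<open>The fractional part of the offending coordinate: nonzero, of modulus below
        1, and by Cramer's rule the factor that the exchange puts on the determinant.\<close>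
      define \<gamma> :: complex where "\<gamma> = of_int (e i mod D) / of_int D"
      define b' where "b' = b(i := x + of_int (- q) * b i)"
      define v where "v = vec n (\<lambda>j. of_int (e j) / of_int D - (if j = i then of_int q else 0) :: complex)"
      have "x + of_int (- q) * b i \<in> O_N"
        by (rule O_N_plus_times(1)[OF x O_N_plus_times(3)[OF bO[OF i] x]])
      hence b'O: "b' j \<in> O_N" if "j < n" for j
        using bO[OF that] by (cases "j = i") (simp_all only: b'_def fun_upd_same fun_upd_other not_False_eq_True)
      have rb': "r k (b' i) = r k x - of_int q * r k (b i)" if k: "k < n" for k
      proof -
        interpret subring_hom ZZbar "r k" by (rule GalQ_hom_ZZbar[OF r[OF k]])
        have Z: "x \<in> ZZbar" "b i \<in> ZZbar" "of_int (- q) \<in> ZZbar"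
          using x bO[OF i] O_N_ZZbar of_int_closed by auto
        have "r k (b' i) = r k x + r k (of_int (- q) * b i)"
          using hom_plus[OF Z(1) times_closed[OF Z(3,2)]] by (simp add: b'_def)
        also have "r k (of_int (- q) * b i) = of_int (- q) * r k (b i)"
          by (simp only: hom_times[OF Z(3,2)] hom_of_int)
        finally show ?thesis by simp
      qed
      have "emb_mat b' = replace_col (emb_mat b) (emb_mat b *\<^sub>v v) i"
      proof (rule eq_matI)
        fix k j assume "k < dim_row (replace_col (emb_mat b) (emb_mat b *\<^sub>v v) i)"
          "j < dim_col (replace_col (emb_mat b) (emb_mat b *\<^sub>v v) i)"
        hence kj: "k < n" "j < n" by (auto simp: replace_col_def emb_mat_def)
        have "(emb_mat b *\<^sub>v v) $ k = (\<Sum>l<n. r k (b l) * (of_int (e l) / of_int D - (if l = i then of_int q else 0)))"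
          using kj by (simp add: emb_mat_def v_def scalar_prod_def lessThan_atLeast0)
        also have "\<dots> = (\<Sum>l<n. of_int (e l) / of_int D * r k (b l)) - (\<Sum>l<n. if l = i then of_int q * r k (b i) else 0)"
          unfolding sum_subtractf[symmetric] by (intro sum.cong) (auto simp: algebra_simps)
        also have "\<dots> = r k (b' i)" using e[OF kj(1)] rb'[OF kj(1)] i by simp
        finally show "emb_mat b' $$ (k, j) = replace_col (emb_mat b) (emb_mat b *\<^sub>v v) i $$ (k, j)"
          using kj by (auto simp: replace_col_def emb_mat_def b'_def)
      qed (auto simp: replace_col_def emb_mat_def)
      hence "det (emb_mat b') = v $ i * det (emb_mat b)"
        using cramer_lemma_mat[OF emb_mat_carrier[of b] _ i, of v] by (simp add: v_def)
      also have "v $ i = \<gamma>"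
      proof -
        have "of_int (e i) = of_int (D * q + e i mod D)" by (simp add: q_def)
        hence "of_int (e i) = of_int D * of_int q + (of_int (e i mod D) :: complex)" by simp
        thus ?thesis using D i by (simp add: v_def \<gamma>_def field_simps)
      qed
      finally have det: "det (emb_mat b') = \<gamma> * det (emb_mat b)" .
      have "e i mod D \<noteq> 0" using nd by (simp add: dvd_eq_mod_eq_0)
      hence \<gamma>0: "\<gamma> \<noteq> 0" using D by (simp add: \<gamma>_def)
      have "\<bar>e i mod D\<bar> < \<bar>D\<bar>" using D by (rule abs_mod_less)
      hence "\<bar>real_of_int (e i mod D)\<bar> < \<bar>real_of_int D\<bar>" by linarith
      hence \<gamma>1: "cmod \<gamma> < 1" using D by (simp add: \<gamma>_def norm_divide)
      have Qb': "Q b'" unfolding Q_def using b'O det \<gamma>0 nz by simp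
      have "cmod (det (emb_mat b')) < cmod (det (emb_mat b))"
        using \<gamma>1 nz by (simp add: det norm_mult)
      hence "cmod (det (emb_mat b')) ^ 2 < cmod (det (emb_mat b)) ^ 2"
        by (intro power_strict_mono) auto
      hence "\<delta> b' < \<delta> b" using \<delta>[OF Qb] \<delta>[OF Qb'] by simp
      with min[OF Qb'] show False by simp
    qed
    hence "\<exists>c. \<forall>i. i < n \<longrightarrow> e i = D * c i" unfolding dvd_def by metis
    then obtain c where c: "\<And>i. i < n \<Longrightarrow> e i = D * c i" by metis
    have "r k x = (\<Sum>i<n. of_int (c i) * r k (b i))" if "k < n" for k
      unfolding e[OF that] using D by (intro sum.cong) (auto simp: c)
    thus ?thesis by blast
  qed
  with bO nz show ?thesis by blast
qed

text \<open>Expanding the second components of \<open>ts\<close> in the basis turns orthogonality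
  into \<open>W * transpose_mat M = 1\<close>, where \<open>W\<close> has algebraic integers as
  entries. So the inverse of the discriminant is a rational algebraic integer, and the discriminant
  is 1 or -1.\<close>

lemma integral_basis_unimodular:
  assumes b: "\<And>i. i < n \<Longrightarrow> b i \<in> O_N"
    and basis: "\<And>x. x \<in> O_N \<Longrightarrow> \<exists>c :: nat \<Rightarrow> int. \<forall>k<n. r k x = (\<Sum>i<n. of_int (c i) * r k (b i))"
  shows "cmod (det (emb_mat b)) = 1"
proof -
  define M where "M = emb_mat b"
  have M: "M \<in> carrier_mat n n" unfolding M_def by (rule emb_mat_carrier)
  have t: "fst (ts ! j) \<in> ZZbar" "snd (ts ! j) \<in> O_N" if "j < length ts" for j
    using ts(1) nth_mem[OF that] by (cases "ts ! j"; auto)+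
  have "\<forall>j. \<exists>c :: nat \<Rightarrow> int. j < length ts \<longrightarrow> (\<forall>k<n. r k (snd (ts ! j)) = (\<Sum>i<n. of_int (c i) * r k (b i)))"
    using basis t(2) by blast
  then obtain c :: "nat \<Rightarrow> nat \<Rightarrow> int" where
    c: "\<And>j k. j < length ts \<Longrightarrow> k < n \<Longrightarrow> r k (snd (ts ! j)) = (\<Sum>i<n. of_int (c j i) * r k (b i))" by metis
  define W where "W = mat n n (\<lambda>(k, i). \<Sum>j<length ts. r k (fst (ts ! j)) * of_int (c j i))"
  have W: "W \<in> carrier_mat n n" by (simp add: W_def)
  have "W * transpose_mat M = 1\<^sub>m n"
  proof (rule eq_matI)
    fix k l assume "k < dim_row (1\<^sub>m n)" "l < dim_col (1\<^sub>m n)"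
    hence kl: "k < n" "l < n" by auto
    have "(W * transpose_mat M) $$ (k, l) = (\<Sum>i<n. (\<Sum>j<length ts. r k (fst (ts ! j)) * of_int (c j i)) * r l (b i))"
      using kl by (simp add: W_def M_def emb_mat_def scalar_prod_def lessThan_atLeast0)
    also have "\<dots> = (\<Sum>j<length ts. \<Sum>i<n. r k (fst (ts ! j)) * (of_int (c j i) * r l (b i)))"
      by (subst sum.swap) (simp add: sum_distrib_right mult.assoc)
    also have "\<dots> = (\<Sum>j<length ts. r k (fst (ts ! j)) * r l (snd (ts ! j)))"
      using kl by (intro sum.cong) (auto simp: c sum_distrib_left)
    also have "\<dots> = (if k = l then 1 else 0)" by (rule tensor_orthogonal[OF kl])
    finally show "(W * transpose_mat M) $$ (k, l) = 1\<^sub>m n $$ (k, l)" using kl by simp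
  qed (auto simp: W_def M_def emb_mat_def)
  hence "det W * det (transpose_mat M) = 1" using det_mult[OF W, of "transpose_mat M"] M by simp
  hence WM: "det W * det M = 1" using det_transpose[OF M] by simp
  have "det W \<in> ZZbar"
  proof (rule ZZ.det_closed[OF W])
    fix k i assume ki: "k < n" "i < n"
    have "(\<Sum>j<length ts. r k (fst (ts ! j)) * of_int (c j i)) \<in> ZZbar"
      using t(1) ki by (intro ZZ.sum_closed ZZ.times_closed r_ZZbar ZZ.of_int_closed) auto
    thus "W $$ (k, i) \<in> ZZbar" using ki by (simp add: W_def)
  qed
  hence W2: "algebraic_int (det W ^ 2)" using ZZ.power_closed[of "det W" 2] by simp
  obtain D :: int where D: "det M ^ 2 = of_int D" using det_emb_mat_square[of b] b unfolding M_def by blast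
  have prod1: "det W ^ 2 * of_int D = 1" using WM by (simp add: D[symmetric] power_mult_distrib[symmetric])
  hence "D \<noteq> 0" by auto
  with prod1 have "det W ^ 2 = 1 / of_int D" by (simp add: field_simps)
  hence "det W ^ 2 \<in> \<rat>" by simp
  with W2 have "det W ^ 2 \<in> \<int>" by (rule rational_algebraic_int_is_int)
  then obtain E :: int where "det W ^ 2 = of_int E" by (auto elim: Ints_cases)
  with prod1 have "of_int (E * D) = (of_int 1 :: complex)" by simp
  hence "E * D = 1" by (simp only: of_int_eq_iff)
  hence "\<bar>D\<bar> = 1" by (metis abs_mult abs_one abs_zmult_eq_1 mult.commute)
  hence "cmod (det M ^ 2) = 1" unfolding D by (metis norm_of_int of_int_1 of_int_abs)
  hence "cmod (det M) ^ 2 = 1" by (simp add: norm_power)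
  hence "cmod (det M) = 1" by (metis norm_ge_zero power2_eq_1_iff le_minus_one_simps(3))
  thus ?thesis by (simp add: M_def)
qed

text \<open>Conjugation permutes the rows of \<open>M\<close>, so a matrix \<open>U\<close> with
  determinant of modulus 1 turns \<open>M\<close> into the real matrix with entries
  \<open>Re + Im\<close>; real and complex places are treated alike. The boundary case of the
  theorem on linear forms then gives a nonzero \<open>x\<close> with all conjugates of modulus at
  most 1 and one of them smaller.\<close>

lemma index_less_two: "n < 2"
proof (rule ccontr)
  assume "\<not> n < 2"
  hence n2: "n \<ge> 2" by simp
  obtain b where b: "\<And>i. i < n \<Longrightarrow> b i \<in> O_N" and nz: "det (emb_mat b) \<noteq> 0" and
    basis: "\<And>x. x \<in> O_N \<Longrightarrow> \<exists>c :: nat \<Rightarrow> int. \<forall>k<n. r k x = (\<Sum>i<n. of_int (c i) * r k (b i))"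
    using ex_integral_basis by blast
  have det1: "cmod (det (emb_mat b)) = 1" using integral_basis_unimodular[of b] b basis by blast
  define M where "M = emb_mat b"
  have M: "M \<in> carrier_mat n n" unfolding M_def by (rule emb_mat_carrier)
  define \<tau> where "\<tau> = complex_conjugation"
  have \<tau>: "\<tau> \<in> carrier GalQ" unfolding \<tau>_def by (rule complex_conjugation_GalQ)
  have \<tau>a: "\<tau> z = cnj z" if "z \<in> QQbar" for z using that by (simp add: \<tau>_def complex_conjugation_def)
  obtain \<pi> where bij: "bij_betw \<pi> {..<n} {..<n}" and "\<forall>k<n. \<forall>y\<in>O_N. \<tau> (r k y) = r (\<pi> k) y"
    using GalQ_permutes_cosets[OF \<tau>] by blast
  hence \<pi>: "cnj (r k y) = r (\<pi> k) y" if "k < n" "y \<in> O_N" for k y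
    using \<tau>a[of "r k y"] r_ZZbar[OF that(1) O_N_ZZbar[OF that(2)]] that by auto
  have \<pi>n: "\<pi> k < n" if "k < n" for k using bij that by (auto simp: bij_betw_def)
  have bM: "M $$ (k, i) = r k (b i)" if "k < n" "i < n" for k i using that by (simp add: M_def emb_mat_def)
  have \<pi>M: "cnj (M $$ (k, i)) = M $$ (\<pi> k, i)" if "k < n" "i < n" for k i
    using \<pi>[OF that(1) b[OF that(2)]] bM that \<pi>n by simp
  \<comment> \<open>Conjugating twice shows that the rows \<open>k\<close> and
    \<open>\<pi> (\<pi> k)\<close> are equal, and equal rows with different indices would make the
    determinant vanish.\<close>
  have \<pi>\<pi>: "\<pi> (\<pi> k) = k" if k: "k < n" for k
  proof (rule ccontr)
    assume ne: "\<pi> (\<pi> k) \<noteq> k"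
    have "row M (\<pi> (\<pi> k)) = row M k"
    proof (rule eq_vecI)
      fix i assume "i < dim_vec (row M k)"
      hence i: "i < n" using M by simp
      have "M $$ (\<pi> (\<pi> k), i) = M $$ (k, i)"
        using \<pi>M[OF \<pi>n[OF k] i] \<pi>M[OF k i] by (metis complex_cnj_cnj)
      thus "row M (\<pi> (\<pi> k)) $ i = row M k $ i" using M i k \<pi>n[OF \<pi>n[OF k]] by simp
    qed (use M in auto)
    from det_identical_rows[OF M ne \<pi>n[OF \<pi>n[OF k]] k this] nz show False by (simp add: M_def)
  qed
  \<comment> \<open>Chosen so that \<open>\<alpha> * z + \<beta> * cnj z = Re z + Im z\<close>, and
    so that \<open>U\<close> times its entrywise conjugate is the identity.\<close>
  define \<alpha> :: complex where "\<alpha> = Complex (1/2) (- 1/2)"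
  define \<beta> :: complex where "\<beta> = Complex (1/2) (1/2)"
  have cnj\<alpha>: "cnj \<alpha> = \<beta>" "cnj \<beta> = \<alpha>" by (simp_all add: \<alpha>_def \<beta>_def complex_eq_iff)
  have \<alpha>\<beta>: "\<alpha> * \<beta> + \<beta> * \<alpha> = 1" "\<alpha> * \<alpha> + \<beta> * \<beta> = 0" by (simp_all add: \<alpha>_def \<beta>_def complex_eq_iff)
  define U where "U = mat n n (\<lambda>(k, l). (if l = k then \<alpha> else 0) + (if l = \<pi> k then \<beta> else 0))"
  have U: "U \<in> carrier_mat n n" by (simp add: U_def)
  have Urow: "(\<Sum>l<n. U $$ (k, l) * f l) = \<alpha> * f k + \<beta> * f (\<pi> k)" if k: "k < n" for k f
  proof -
    have "(\<Sum>l<n. U $$ (k, l) * f l) = (\<Sum>l<n. (if l = k then \<alpha> * f k else 0) + (if l = \<pi> k then \<beta> * f (\<pi> k) else 0))"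
      using k by (intro sum.cong) (auto simp: U_def algebra_simps)
    thus ?thesis using k \<pi>n[OF k] by (simp add: sum.distrib)
  qed
  have "U * map_mat cnj U = 1\<^sub>m n"
  proof (rule eq_matI)
    fix k m assume "k < dim_row (1\<^sub>m n)" "m < dim_col (1\<^sub>m n)"
    hence km: "k < n" "m < n" by auto
    have "(U * map_mat cnj U) $$ (k, m) = (\<Sum>l<n. U $$ (k, l) * cnj (U $$ (l, m)))"
      using km U by (simp add: scalar_prod_def lessThan_atLeast0)
    also have "\<dots> = \<alpha> * cnj (U $$ (k, m)) + \<beta> * cnj (U $$ (\<pi> k, m))" by (rule Urow[OF km(1)])
    also have "\<dots> = (if m = k then \<alpha> * \<beta> + \<beta> * \<alpha> else 0) + (if m = \<pi> k then \<alpha> * \<alpha> + \<beta> * \<beta> else 0)"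
      using km \<pi>n[OF km(1)] \<pi>\<pi>[OF km(1)] by (simp add: U_def cnj\<alpha> algebra_simps)
    also have "\<dots> = 1\<^sub>m n $$ (k, m)" using km by (auto simp: \<alpha>\<beta>)
    finally show "(U * map_mat cnj U) $$ (k, m) = 1\<^sub>m n $$ (k, m)" .
  qed (use U in auto)
  hence "det U * det (map_mat cnj U) = 1" using det_mult[OF U, of "map_mat cnj U"] U by simp
  moreover have "det (map_mat cnj U) = cnj (det U)"
  proof -
    interpret cn: subring_hom "UNIV :: complex set" cnj by unfold_locales auto
    show ?thesis by (rule cn.hom_det[OF U, symmetric]) auto
  qed
  ultimately have "det U * cnj (det U) = 1" by simp
  hence "complex_of_real (cmod (det U) ^ 2) = 1" unfolding complex_norm_square .
  hence "cmod (det U) ^ 2 = 1" by (simp only: of_real_eq_1_iff)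
  hence detU: "cmod (det U) = 1" by (simp add: power2_eq_1_iff) (smt (verit) norm_ge_zero)
  define A where "A p = Re (M $$ p) + Im (M $$ p)" for p
  have "U * M = map_mat of_real (mat n n A)"
  proof (rule eq_matI)
    fix k i assume "k < dim_row (map_mat complex_of_real (mat n n A))" "i < dim_col (map_mat complex_of_real (mat n n A))"
    hence ki: "k < n" "i < n" by auto
    have "(U * M) $$ (k, i) = (\<Sum>l<n. U $$ (k, l) * M $$ (l, i))"
      using ki U M by (simp add: scalar_prod_def lessThan_atLeast0)
    also have "\<dots> = \<alpha> * M $$ (k, i) + \<beta> * cnj (M $$ (k, i))" unfolding Urow[OF ki(1)] \<pi>M[OF ki] ..
    also have "\<dots> = of_real (A (k, i))" by (simp add: \<alpha>_def \<beta>_def A_def complex_eq_iff field_simps)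
    finally show "(U * M) $$ (k, i) = map_mat complex_of_real (mat n n A) $$ (k, i)" using ki by simp
  qed (use U M in auto)
  hence "det U * det M = of_real (det (mat n n A))"
    using det_mult[OF U M] by (simp add: of_real_hom.hom_det)
  hence "cmod (det U * det M) = \<bar>det (mat n n A)\<bar>" by simp
  hence detA: "\<bar>det (mat n n A)\<bar> = 1" using detU det1 by (simp add: norm_mult M_def)
  \<comment> \<open>Form 0 has the weak bound. As \<open>n \<ge> 2\<close>, there is also a form 1,
    and it has the strict one.\<close>
  obtain c :: "nat \<Rightarrow> int" where c: "\<exists>j<n. c j \<noteq> 0" and c0: "\<bar>\<Sum>j<n. A (0, j) * of_int (c j)\<bar> \<le> 1" and
    c1: "\<And>i. i < n \<Longrightarrow> i > 0 \<Longrightarrow> \<bar>\<Sum>j<n. A (i, j) * of_int (c j)\<bar> < 1"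
    using minkowski_linear_forms_unimodular[OF detA] n2 by auto
  define x where "x = (\<Sum>i<n. of_int (c i) * b i)"
  define L where "L k = (\<Sum>j<n. A (k, j) * of_int (c j))" for k
  have "of_int (c i) * b i \<in> O_N" if "i < n" for i
    by (rule O_N_plus_times(3)[OF b[OF that] b[OF that]])
  hence xO: "x \<in> O_N" unfolding x_def using n2 by (intro O_N_sum) auto
  have rx: "r k x = (\<Sum>i<n. of_int (c i) * M $$ (k, i))" if k: "k < n" for k
  proof -
    interpret subring_hom ZZbar "r k" by (rule GalQ_hom_ZZbar[OF r[OF k]])
    have Z: "of_int (c i) \<in> ZZbar" "b i \<in> ZZbar" if "i < n" for i using of_int_closed O_N_ZZbar b that by auto
    have "r k x = (\<Sum>i<n. r k (of_int (c i) * b i))" unfolding x_def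
      using Z times_closed by (intro hom_sum) blast
    also have "\<dots> = (\<Sum>i<n. of_int (c i) * M $$ (k, i))"
      using k by (intro sum.cong refl) (simp add: bM hom_times[OF Z] hom_of_int)
    finally show ?thesis .
  qed
  have Lx: "L k = Re (r k x) + Im (r k x)" if "k < n" for k
    unfolding rx[OF that] by (simp add: L_def A_def sum.distrib[symmetric] algebra_simps)
  have L\<pi>: "L (\<pi> k) = Re (r k x) - Im (r k x)" if "k < n" for k
    unfolding Lx[OF \<pi>n[OF that]] \<pi>[OF that xO, symmetric] by simp
  \<comment> \<open>The forms \<open>k\<close> and \<open>\<pi> k\<close> are the real part of the
    same number plus and minus its imaginary part; at a real place they coincide.\<close>
  have sq: "2 * cmod (r k x) ^ 2 = L k ^ 2 + L (\<pi> k) ^ 2" if "k < n" for k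
    unfolding L\<pi>[OF that] Lx[OF that] cmod_power2 by (simp add: power2_eq_square algebra_simps)
  have L_le: "L k ^ 2 \<le> 1" if "k < n" for k
    using c0 c1[OF that] by (cases "k = 0") (auto simp: L_def abs_square_le_1 less_imp_le)
  have L_less: "L 1 ^ 2 < 1" using c1[of 1] n2 by (simp add: L_def abs_square_less_1)
  have le1: "cmod (r k x) \<le> 1" if "k < n" for k
  proof -
    have "cmod (r k x) ^ 2 \<le> 1" using sq[OF that] L_le[OF that] L_le[OF \<pi>n[OF that]] by linarith
    thus ?thesis by (simp add: abs_square_le_1)
  qed
  have less1: "cmod (r 1 x) < 1"
  proof -
    have "cmod (r 1 x) ^ 2 < 1" using sq[of 1] L_less L_le[OF \<pi>n[of 1]] n2 by linarith
    thus ?thesis by (simp add: abs_square_less_1)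
  qed
  have "(\<Prod>k<n. cmod (r k x)) = cmod (r 1 x) * (\<Prod>k\<in>{..<n} - {1}. cmod (r k x))"
    using n2 by (subst prod.remove[of _ 1]) auto
  also have "\<dots> \<le> cmod (r 1 x) * 1"
    using le1 by (intro mult_left_mono prod_le_1) auto
  also have "\<dots> < 1" using less1 by simp
  finally have small: "cmod (\<Prod>k<n. r k x) < 1" by (simp add: prod_norm)
  obtain t :: int where t: "(\<Prod>k<n. r k x) = of_int t" using norm_int[OF xO] by blast
  have "\<bar>real_of_int t\<bar> < 1" using small unfolding t by simp
  \<comment> \<open>The norm vanishes, so \<open>x = 0\<close>; then the nonzero vector
    \<open>c\<close> lies in the kernel of the invertible matrix \<open>M\<close>.\<close>
  hence "t = 0" by linarith
  hence "(\<Prod>k<n. r k x) = 0" using t by simp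
  then obtain k where k: "k < n" "r k x = 0" by auto
  have xQ: "x \<in> QQbar" using O_N_ZZbar[OF xO] by auto
  have "r k x = r k 0" using k subring_hom.hom_zero[OF GalQ_hom[OF r[OF k(1)]]] by simp
  hence "x = 0" using GalQ_inj[OF r[OF k(1)] xQ, of 0] by simp
  hence x0: "r l x = 0" if "l < n" for l using subring_hom.hom_zero[OF GalQ_hom[OF r[OF that]]] by simp
  define v where "v = vec n (\<lambda>i. complex_of_int (c i))"
  have "M *\<^sub>v v = 0\<^sub>v n"
    using M x0 rx by (intro eq_vecI) (auto simp: v_def scalar_prod_def lessThan_atLeast0 mult.commute)
  moreover have "v \<in> carrier_vec n" by (simp add: v_def)
  moreover have "v \<noteq> 0\<^sub>v n"
  proof
    assume "v = 0\<^sub>v n"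
    hence "v $ i = 0" if "i < n" for i using that by simp
    with c show False by (auto simp: v_def)
  qed
  ultimately have "det M = 0" using det_0_iff_vec_prod_zero_field[OF M] by auto
  with nz show False by (simp add: M_def)
qed

end

text \<open>\<open>\<kappa>\<close> is a labelling with finitely many values, at least as fine as
  \<open>E\<close>; hence there are finitely many classes. The choice \<open>pick\<close> depends on
  the class only, so its values can be enumerated without repetition.\<close>

lemma ex_transversal:
  assumes equiv: "\<And>a. a \<in> A \<Longrightarrow> E a a" "\<And>a b. a \<in> A \<Longrightarrow> b \<in> A \<Longrightarrow> E a b \<Longrightarrow> E b a"
    "\<And>a b c. a \<in> A \<Longrightarrow> b \<in> A \<Longrightarrow> c \<in> A \<Longrightarrow> E a b \<Longrightarrow> E b c \<Longrightarrow> E a c"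
    and fin: "finite (\<kappa> ` A)" "\<And>a b. a \<in> A \<Longrightarrow> b \<in> A \<Longrightarrow> \<kappa> a = \<kappa> b \<Longrightarrow> E a b"
  shows "\<exists>(n :: nat) r. (\<forall>k<n. r k \<in> A) \<and> (\<forall>a\<in>A. \<exists>k<n. E (r k) a) \<and> (\<forall>k<n. \<forall>l<n. E (r k) (r l) \<longrightarrow> k = l)"
proof -
  define pick where "pick a = (SOME b. b \<in> A \<and> E b a)" for a
  have pick: "pick a \<in> A \<and> E (pick a) a" if "a \<in> A" for a
    unfolding pick_def by (rule someI[of _ a]) (use that equiv(1) in auto)
  have pick_eq: "pick a = pick b" if "a \<in> A" "b \<in> A" "E a b" for a b
  proof -
    have "(\<lambda>c. c \<in> A \<and> E c a) = (\<lambda>c. c \<in> A \<and> E c b)"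
      using that equiv(2,3) by (intro ext) blast
    thus ?thesis unfolding pick_def by simp
  qed
  have "pick ` A \<subseteq> (\<lambda>c. pick (SOME a. a \<in> A \<and> \<kappa> a = c)) ` (\<kappa> ` A)"
  proof clarify
    fix a assume a: "a \<in> A"
    define s where "s = (SOME a'. a' \<in> A \<and> \<kappa> a' = \<kappa> a)"
    have s: "s \<in> A \<and> \<kappa> s = \<kappa> a" unfolding s_def by (rule someI[of _ a]) (use a in auto)
    hence "pick a = pick s" using fin(2)[of s a] pick_eq[of s a] a by simp
    thus "pick a \<in> (\<lambda>c. pick (SOME a. a \<in> A \<and> \<kappa> a = c)) ` (\<kappa> ` A)"
      unfolding s_def by (rule image_eqI) (use a in simp)
  qed
  hence "finite (pick ` A)" using fin(1) by (meson finite_imageI finite_subset)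
  then obtain r where r: "bij_betw r {0..<card (pick ` A)} (pick ` A)"
    using ex_bij_betw_nat_finite by blast
  define n where "n = card (pick ` A)"
  have rk: "r k \<in> pick ` A" if "k < n" for k using bij_betw_apply[OF r, of k] that by (simp add: n_def)
  have "r k \<in> A" if k: "k < n" for k
  proof -
    obtain a where "r k = pick a" "a \<in> A" using rk[OF k] by (rule imageE)
    thus ?thesis using pick[of a] by simp
  qed
  moreover have "\<exists>k<n. E (r k) a" if a: "a \<in> A" for a
  proof -
    have "pick a \<in> r ` {0..<n}" using bij_betw_imp_surj_on[OF r] a by (simp add: n_def)
    then obtain k where "k < n" "r k = pick a" by auto
    thus ?thesis using pick[OF a] by auto
  qed
  moreover have "k = l" if kl: "k < n" "l < n" "E (r k) (r l)" for k l
  proof -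
    obtain a where a: "r k = pick a" "a \<in> A" using rk[OF kl(1)] by (rule imageE)
    obtain b where b: "r l = pick b" "b \<in> A" using rk[OF kl(2)] by (rule imageE)
    note pab = pick[OF a(2)] pick[OF b(2)]
    have "pick (pick a) = pick (pick b)" using kl(3) a b pab by (intro pick_eq) simp_all
    moreover have "pick (pick a) = pick a" using pab a(2) by (intro pick_eq) simp_all
    moreover have "pick (pick b) = pick b" using pab b(2) by (intro pick_eq) simp_all
    ultimately have "r k = r l" using a b by simp
    thus "k = l" using inj_onD[OF bij_betw_imp_inj_on[OF r], of k l] kl by (simp add: n_def)
  qed
  ultimately show ?thesis by blast
qed

text \<open>Finiteness of the index enters through \<open>\<kappa>\<close>, whose values separate
  the left cosets of \<open>N\<close>. A transversal and a tensor separating its members bring the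
  situation under \<open>index_less_two\<close>.\<close>

theorem no_unramified_extension:
  assumes N: "subgroup N GalQ"
    and F0: "finite F0" "F0 \<subseteq> QQbar"
    and N_open: "\<And>\<tau>. \<tau> \<in> carrier GalQ \<Longrightarrow> (\<And>x. x \<in> F0 \<Longrightarrow> \<tau> x = x) \<Longrightarrow> \<tau> \<in> N"
    and inertia: "\<And>p P. prime p \<Longrightarrow> P \<in> primes_above p \<Longrightarrow> inertia_group P \<subseteq> N"
    and fin: "finite (\<kappa> ` carrier GalQ)"
      "\<And>g h. g \<in> carrier GalQ \<Longrightarrow> h \<in> carrier GalQ \<Longrightarrow> \<kappa> g = \<kappa> h \<Longrightarrow> inv\<^bsub>GalQ\<^esub> g \<otimes>\<^bsub>GalQ\<^esub> h \<in> N"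
  shows "N = carrier GalQ"
proof -
  define E where "E g h \<longleftrightarrow> inv\<^bsub>GalQ\<^esub> g \<otimes>\<^bsub>GalQ\<^esub> h \<in> N" for g h
  have "\<exists>(n :: nat) r. (\<forall>k<n. r k \<in> carrier GalQ) \<and> (\<forall>a\<in>carrier GalQ. \<exists>k<n. E (r k) a) \<and>
    (\<forall>k<n. \<forall>l<n. E (r k) (r l) \<longrightarrow> k = l)"
  proof (rule ex_transversal)
    show "E g g" if "g \<in> carrier GalQ" for g using that subgroup.one_closed[OF N] by (simp add: E_def)
    show "E h g" if "g \<in> carrier GalQ" "h \<in> carrier GalQ" "E g h" for g h
    proof -
      have "inv\<^bsub>GalQ\<^esub> (inv\<^bsub>GalQ\<^esub> g \<otimes>\<^bsub>GalQ\<^esub> h) \<in> N" using that subgroup.m_inv_closed[OF N] by (simp add: E_def)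
      thus ?thesis using that by (simp add: E_def GalQ.inv_mult_group)
    qed
    show "E g k" if "g \<in> carrier GalQ" "h \<in> carrier GalQ" "k \<in> carrier GalQ" "E g h" "E h k" for g h k
    proof -
      have "(inv\<^bsub>GalQ\<^esub> g \<otimes>\<^bsub>GalQ\<^esub> h) \<otimes>\<^bsub>GalQ\<^esub> (inv\<^bsub>GalQ\<^esub> h \<otimes>\<^bsub>GalQ\<^esub> k) \<in> N"
        using that subgroup.m_closed[OF N] by (simp add: E_def)
      also have "(inv\<^bsub>GalQ\<^esub> g \<otimes>\<^bsub>GalQ\<^esub> h) \<otimes>\<^bsub>GalQ\<^esub> (inv\<^bsub>GalQ\<^esub> h \<otimes>\<^bsub>GalQ\<^esub> k) = inv\<^bsub>GalQ\<^esub> g \<otimes>\<^bsub>GalQ\<^esub> (h \<otimes>\<^bsub>GalQ\<^esub> inv\<^bsub>GalQ\<^esub> h) \<otimes>\<^bsub>GalQ\<^esub> k"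
        using that(1-3) by (simp only: GalQ.m_assoc GalQ.m_closed GalQ.inv_closed)
      also have "\<dots> = inv\<^bsub>GalQ\<^esub> g \<otimes>\<^bsub>GalQ\<^esub> k" using that(1-3) by simp
      finally show ?thesis by (simp add: E_def)
    qed
    show "finite (\<kappa> ` carrier GalQ)" by (rule fin)
    show "E g h" if "g \<in> carrier GalQ" "h \<in> carrier GalQ" "\<kappa> g = \<kappa> h" for g h
      using fin(2)[OF that] by (simp add: E_def)
  qed
  then obtain n :: nat and r where r: "\<And>k. k < n \<Longrightarrow> r k \<in> carrier GalQ"
    and cover: "\<And>g. g \<in> carrier GalQ \<Longrightarrow> \<exists>k<n. E (r k) g"
    and dist: "\<And>k l. k < n \<Longrightarrow> l < n \<Longrightarrow> E (r k) (r l) \<Longrightarrow> k = l" by metis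
  \<comment> \<open>One tensor has to vanish at all quotients of distinct representatives at
    once.\<close>
  define H where "H = (\<lambda>(k, l). inv\<^bsub>GalQ\<^esub> (r k) \<otimes>\<^bsub>GalQ\<^esub> r l) ` {(k, l). k < n \<and> l < n \<and> k \<noteq> l}"
  have finH: "finite H" unfolding H_def
    by (rule finite_imageI, rule finite_subset[of _ "{..<n} \<times> {..<n}"]) auto
  have HN: "H \<subseteq> carrier GalQ - N" using r dist by (auto simp: H_def E_def)
  have "\<exists>ts. set ts \<subseteq> ZZbar \<times> fixed_ints N \<and> tensor_eval ts (\<lambda>x. x) = 1 \<and> (\<forall>h\<in>H. tensor_eval ts h = 0)"
  proof (rule separating_tensor_finite[OF N F0 _ _ finH HN])
    show "\<tau> \<in> N" if "\<tau> \<in> carrier GalQ" "\<And>x. x \<in> F0 \<Longrightarrow> \<tau> x = x" for \<tau> using N_open[OF that] .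
    show "inertia_group P \<subseteq> N" if "prime p" "P \<in> primes_above p" for p P by (rule inertia[OF that])
  qed
  then obtain ts where ts: "set ts \<subseteq> ZZbar \<times> fixed_ints N" "tensor_eval ts (\<lambda>x. x) = 1" "\<forall>h\<in>H. tensor_eval ts h = 0"
    by blast
  have n2: "n < 2"
  proof (rule index_less_two[OF N _ _ _ ts(1,2)])
    show "r k \<in> carrier GalQ" if "k < n" for k by (rule r[OF that])
    show "\<exists>k<n. inv\<^bsub>GalQ\<^esub> (r k) \<otimes>\<^bsub>GalQ\<^esub> g \<in> N" if "g \<in> carrier GalQ" for g
      using cover[OF that] by (simp add: E_def)
    show "k = l" if "k < n" "l < n" "inv\<^bsub>GalQ\<^esub> (r k) \<otimes>\<^bsub>GalQ\<^esub> r l \<in> N" for k l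
      using dist[OF that(1,2)] that(3) by (simp add: E_def)
    show "tensor_eval ts (inv\<^bsub>GalQ\<^esub> (r k) \<otimes>\<^bsub>GalQ\<^esub> r l) = 0" if "k < n" "l < n" "k \<noteq> l" for k l
      using ts(3) that by (auto simp: H_def)
  qed
  have "g \<in> N" if g: "g \<in> carrier GalQ" for g
  proof -
    obtain k where k: "k < n" "E (r k) g" using cover[OF g] by blast
    obtain l where l: "l < n" "E (r l) \<one>\<^bsub>GalQ\<^esub>" using cover[of "\<one>\<^bsub>GalQ\<^esub>"] by auto
    \<comment> \<open>There is only one class, so every element shares it with the neutral
      element.\<close>
    have "k = l" using k(1) l(1) n2 by linarith
    hence "inv\<^bsub>GalQ\<^esub> (r k) \<in> N" using l r[OF k(1)] by (simp add: E_def)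
    hence rk: "r k \<in> N" using subgroup.m_inv_closed[OF N, of "inv\<^bsub>GalQ\<^esub> (r k)"] r[OF k(1)] by simp
    have "r k \<otimes>\<^bsub>GalQ\<^esub> (inv\<^bsub>GalQ\<^esub> (r k) \<otimes>\<^bsub>GalQ\<^esub> g) \<in> N"
      using subgroup.m_closed[OF N rk] k(2) by (simp add: E_def)
    thus ?thesis using r[OF k(1)] g by (simp add: GalQ.m_assoc[symmetric])
  qed
  thus ?thesis using subgroup.subset[OF N] by blast
qed

section \<open>The Krull topology and independence of Galois images\<close>

interpretation CF: cring "ring_of_type_algebra :: complex ring"
  by (rule cring_from_type_algebra)

lemma CF_field: "field (ring_of_type_algebra :: complex ring)"
  by (rule field_from_type_algebra)

lemma CF_simps [simp]:
  "carrier (ring_of_type_algebra :: complex ring) = UNIV"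
  "x \<otimes>\<^bsub>ring_of_type_algebra :: complex ring\<^esub> y = x * y" "x \<oplus>\<^bsub>ring_of_type_algebra :: complex ring\<^esub> y = x + y"
  "\<one>\<^bsub>ring_of_type_algebra :: complex ring\<^esub> = 1" "\<zero>\<^bsub>ring_of_type_algebra :: complex ring\<^esub> = 0"
  by (simp_all add: ring_of_type_algebra_def)

lemma CF_pow [simp]: "(x :: complex) [^]\<^bsub>ring_of_type_algebra :: complex ring\<^esub> (n :: nat) = x ^ n"
  by (induction n) auto

lemma Rats_subfield: "subfield \<rat> (ring_of_type_algebra :: complex ring)"
proof (rule field.subfieldI'[OF CF_field])
  have inv: "\<ominus>\<^bsub>ring_of_type_algebra :: complex ring\<^esub> x = - x" for x :: complex
    by (rule CF.minus_equality) auto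
  show "subring \<rat> (ring_of_type_algebra :: complex ring)"
    by (rule CF.subringI) (auto simp: inv)
  fix k :: complex assume k: "k \<in> \<rat> - {\<zero>\<^bsub>ring_of_type_algebra :: complex ring\<^esub>}"
  have "inv\<^bsub>ring_of_type_algebra :: complex ring\<^esub> k = inverse k"
    by (rule CF.comm_inv_char) (use k in auto)
  thus "inv\<^bsub>ring_of_type_algebra :: complex ring\<^esub> k \<in> \<rat>" using k by auto
qed

text \<open>List polynomials keep the leading coefficient first, \<open>Poly\<close> expects it
  last.\<close>

lemma CF_eval: "CF.eval p x = poly (Poly (rev p)) x"
proof (induction p)
  case (Cons a p)
  have "Poly (rev p @ [a]) = Poly (rev p) + monom a (length p)"
    by (simp add: Poly_append smult_monom)
  thus ?case using Cons by (simp add: poly_monom add.commute)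
qed simp

lemma number_field_algebraic:
  assumes L: "number_field L" and x: "x \<in> L"
  shows "algebraic x"
proof -
  have L': "subfield L (ring_of_type_algebra :: complex ring)" "CF.finite_dimension \<rat> L"
    using L by (simp_all add: number_field_def)
  have "(CF.algebraic over \<rat>) x"
    by (rule CF.finite_dimension_imp_algebraic[OF Rats_subfield subfieldE(1)[OF L'(1)] L'(2) x])
  then obtain p where p: "p \<in> carrier (\<rat> [X]\<^bsub>ring_of_type_algebra :: complex ring\<^esub>)" "p \<noteq> []"
    "CF.eval p x = \<zero>\<^bsub>ring_of_type_algebra :: complex ring\<^esub>"
    using domain.algebraicE[OF field.axioms(1)[OF CF_field] subfieldE(1)[OF Rats_subfield]] by auto
  hence pp: "set p \<subseteq> \<rat>" "hd p \<noteq> 0" by (auto simp: univ_poly_def polynomial_def)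
  define q where "q = Poly (rev p)"
  have "poly q x = 0" using p(3) by (simp add: q_def CF_eval)
  moreover have "coeff q i \<in> \<rat>" for i
    using pp(1) nth_mem[of i "rev p"] by (auto simp: q_def coeff_Poly_eq nth_default_def)
  moreover have "coeff q (length p - 1) \<noteq> 0"
    using pp(2) p(2) by (simp add: q_def coeff_Poly_eq nth_default_def rev_nth hd_conv_nth)
  hence "q \<noteq> 0" by auto
  ultimately show ?thesis by (intro algebraicI'[of q]) auto
qed

text \<open>Automorphisms agree on the rationals, so on a number field they are determined by a
  finite basis. This turns the basic open sets of the Krull topology into finitely many
  conditions.\<close>

lemma number_field_finitely_determined:
  assumes L: "number_field L"
  shows "\<exists>F. finite F \<and> F \<subseteq> QQbar \<and>
    (\<forall>\<sigma>\<in>carrier GalQ. \<forall>\<tau>\<in>carrier GalQ. (\<forall>x\<in>F. \<tau> x = \<sigma> x) \<longrightarrow> (\<forall>x\<in>L. \<tau> x = \<sigma> x))"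
proof -
  obtain d where "CF.dimension d \<rat> L" using L by (auto simp: number_field_def)
  then obtain Vs where Vs: "CF.Span \<rat> Vs = L"
    using CF.exists_base[OF Rats_subfield] by blast
  have VL: "set Vs \<subseteq> L" using CF.Span_base_incl[OF Rats_subfield, of Vs] Vs by simp
  hence VQ: "set Vs \<subseteq> QQbar" using number_field_algebraic[OF L] by blast
  have "\<tau> x = \<sigma> x" if st: "\<sigma> \<in> carrier GalQ" "\<tau> \<in> carrier GalQ" and eq: "\<forall>x\<in>set Vs. \<tau> x = \<sigma> x" and x: "x \<in> L" for \<sigma> \<tau> x
  proof -
    interpret s: subring_hom QQbar \<sigma> using st by (simp add: GalQ_iff)
    interpret t: subring_hom QQbar \<tau> using st by (simp add: GalQ_iff)
    have rat: "\<tau> q = \<sigma> q" "q \<in> QQbar" if "q \<in> \<rat>" for q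
    proof -
      from that obtain a b :: int where q: "b > 0" "coprime a b" "q = of_int a / of_int b" by (rule Rats_cases')
      show qQ: "q \<in> QQbar" using that by (auto intro: rat_imp_algebraic)
      have "of_int b * \<tau> q = \<tau> (of_int b * q)" "of_int b * \<sigma> q = \<sigma> (of_int b * q)"
        using t.hom_times[OF t.of_int_closed qQ] s.hom_times[OF s.of_int_closed qQ] t.hom_of_int s.hom_of_int by simp_all
      moreover have bq: "of_int b * q = of_int a" using q by simp
      ultimately have "of_int b * \<tau> q = of_int b * \<sigma> q"
        by (simp only: t.hom_of_int s.hom_of_int bq)
      thus "\<tau> q = \<sigma> q" using q(1) by simp
    qed
    from x Vs obtain Ks where Ks: "set Ks \<subseteq> \<rat>" "x = CF.combine Ks Vs"
      using CF.Span_eq_combine_set[OF Rats_subfield, of Vs] by auto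
    have "CF.combine Ks Us \<in> QQbar \<and> \<tau> (CF.combine Ks Us) = \<sigma> (CF.combine Ks Us)"
      if "set Us \<subseteq> set Vs" "set Ks \<subseteq> \<rat>" for Us Ks
      using that
    proof (induction Us arbitrary: Ks)
      case Nil
      show ?case by (cases Ks) (simp_all add: s.hom_zero t.hom_zero)
    next
      case step: (Cons u Us)
      show ?case
      proof (cases Ks)
        case (Cons k Ks')
        have u: "u \<in> QQbar" "\<tau> u = \<sigma> u" using step.prems VQ eq by auto
        have k: "k \<in> QQbar" "\<tau> k = \<sigma> k" using step.prems Cons rat by auto
        have ku: "k * u \<in> QQbar" using s.times_closed[OF k(1) u(1)] .
        have IH: "CF.combine Ks' Us \<in> QQbar" "\<tau> (CF.combine Ks' Us) = \<sigma> (CF.combine Ks' Us)"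
          using step.IH[of Ks'] step.prems Cons by auto
        have "\<tau> (k * u + CF.combine Ks' Us) = \<sigma> (k * u + CF.combine Ks' Us)"
          unfolding s.hom_plus[OF ku IH(1)] t.hom_plus[OF ku IH(1)] s.hom_times[OF k(1) u(1)] t.hom_times[OF k(1) u(1)]
          using u k IH by simp
        thus ?thesis using s.plus_closed[OF ku IH(1)] Cons by simp
      qed (simp add: s.hom_zero t.hom_zero)
    qed
    thus ?thesis using Ks by blast
  qed
  with VQ show ?thesis by (intro exI[of _ "set Vs"]) blast
qed

lemma krull_open_finitely_determined:
  assumes "openin krull_topology U" "\<sigma> \<in> U"
  shows "\<exists>F. finite F \<and> F \<subseteq> QQbar \<and> (\<forall>\<tau>\<in>carrier GalQ. (\<forall>x\<in>F. \<tau> x = \<sigma> x) \<longrightarrow> \<tau> \<in> U)"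
proof -
  from assms(1) have "generate_topology_on
     {{\<tau> \<in> carrier GalQ. \<forall>x\<in>L. \<tau> x = \<sigma> x} | \<sigma> L. \<sigma> \<in> carrier GalQ \<and> number_field L} U"
    unfolding krull_topology_def openin_topology_generated_by_iff .
  thus ?thesis using assms(2)
  proof (induction rule: generate_topology_on.induct)
    case (Int A B)
    then obtain F F' where "finite F" "F \<subseteq> QQbar" "\<forall>\<tau>\<in>carrier GalQ. (\<forall>x\<in>F. \<tau> x = \<sigma> x) \<longrightarrow> \<tau> \<in> A"
      "finite F'" "F' \<subseteq> QQbar" "\<forall>\<tau>\<in>carrier GalQ. (\<forall>x\<in>F'. \<tau> x = \<sigma> x) \<longrightarrow> \<tau> \<in> B"
      by auto
    thus ?case by (intro exI[of _ "F \<union> F'"]) auto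
  next
    case (UN K)
    then obtain k where k: "k \<in> K" "\<sigma> \<in> k" by (elim UnionE)
    from UN.IH[OF this] obtain F where "finite F" "F \<subseteq> QQbar" "\<forall>\<tau>\<in>carrier GalQ. (\<forall>x\<in>F. \<tau> x = \<sigma> x) \<longrightarrow> \<tau> \<in> k"
      by blast
    thus ?case using k(1) by (intro exI[of _ F]) auto
  next
    case (Basis s)
    then obtain \<rho> L where s: "s = {\<tau> \<in> carrier GalQ. \<forall>x\<in>L. \<tau> x = \<rho> x}" "number_field L" by blast
    obtain F where F: "finite F" "F \<subseteq> QQbar"
      "\<forall>\<sigma>\<in>carrier GalQ. \<forall>\<tau>\<in>carrier GalQ. (\<forall>x\<in>F. \<tau> x = \<sigma> x) \<longrightarrow> (\<forall>x\<in>L. \<tau> x = \<sigma> x)"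
      using number_field_finitely_determined[OF s(2)] by blast
    have "\<tau> \<in> s" if "\<tau> \<in> carrier GalQ" "\<forall>x\<in>F. \<tau> x = \<sigma> x" for \<tau>
    proof -
      have \<sigma>: "\<sigma> \<in> carrier GalQ" "\<forall>x\<in>L. \<sigma> x = \<rho> x" using Basis.prems by (simp_all add: s(1))
      have "\<forall>x\<in>L. \<tau> x = \<sigma> x" using F(3) \<sigma>(1) that by simp
      thus ?thesis using \<sigma>(2) that(1) by (simp add: s(1))
    qed
    thus ?case using F(1,2) by (intro exI[of _ F]) simp
  qed simp
qed

text \<open>A congruence on the Galois group. It stands for equality of images under a homomorphism
  without naming the target group; the class of the neutral element is the kernel.\<close>

definition biinvariant :: "((complex \<Rightarrow> complex) \<Rightarrow> (complex \<Rightarrow> complex) \<Rightarrow> bool) \<Rightarrow> bool" where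
  "biinvariant R \<longleftrightarrow>
     (\<forall>\<sigma>. R \<sigma> \<sigma>) \<and> (\<forall>\<sigma> \<tau>. R \<sigma> \<tau> \<longrightarrow> R \<tau> \<sigma>) \<and> (\<forall>\<sigma> \<tau> \<upsilon>. R \<sigma> \<tau> \<longrightarrow> R \<tau> \<upsilon> \<longrightarrow> R \<sigma> \<upsilon>) \<and>
     (\<forall>\<sigma>\<in>carrier GalQ. \<forall>\<tau>\<in>carrier GalQ. \<forall>\<alpha>\<in>carrier GalQ. R \<sigma> \<tau> \<longrightarrow>
        R (\<alpha> \<otimes>\<^bsub>GalQ\<^esub> \<sigma>) (\<alpha> \<otimes>\<^bsub>GalQ\<^esub> \<tau>) \<and> R (\<sigma> \<otimes>\<^bsub>GalQ\<^esub> \<alpha>) (\<tau> \<otimes>\<^bsub>GalQ\<^esub> \<alpha>))"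

lemma biinvariant_rules:
  assumes "biinvariant R"
  shows "R \<sigma> \<sigma>" "R \<sigma> \<tau> \<Longrightarrow> R \<tau> \<sigma>" "R \<sigma> \<tau> \<Longrightarrow> R \<tau> \<upsilon> \<Longrightarrow> R \<sigma> \<upsilon>"
    "\<sigma> \<in> carrier GalQ \<Longrightarrow> \<tau> \<in> carrier GalQ \<Longrightarrow> \<alpha> \<in> carrier GalQ \<Longrightarrow> R \<sigma> \<tau> \<Longrightarrow> R (\<alpha> \<otimes>\<^bsub>GalQ\<^esub> \<sigma>) (\<alpha> \<otimes>\<^bsub>GalQ\<^esub> \<tau>)"
    "\<sigma> \<in> carrier GalQ \<Longrightarrow> \<tau> \<in> carrier GalQ \<Longrightarrow> \<alpha> \<in> carrier GalQ \<Longrightarrow> R \<sigma> \<tau> \<Longrightarrow> R (\<sigma> \<otimes>\<^bsub>GalQ\<^esub> \<alpha>) (\<tau> \<otimes>\<^bsub>GalQ\<^esub> \<alpha>)"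
  using assms unfolding biinvariant_def by blast+

lemma biinvariant_kernel:
  assumes R: "biinvariant R"
  shows "subgroup {\<sigma> \<in> carrier GalQ. R \<sigma> \<one>\<^bsub>GalQ\<^esub>} GalQ"
    and "\<sigma> \<in> carrier GalQ \<Longrightarrow> \<tau> \<in> carrier GalQ \<Longrightarrow> R \<sigma> \<tau> \<Longrightarrow> R (inv\<^bsub>GalQ\<^esub> \<sigma> \<otimes>\<^bsub>GalQ\<^esub> \<tau>) \<one>\<^bsub>GalQ\<^esub>"
    and "\<sigma> \<in> carrier GalQ \<Longrightarrow> \<alpha> \<in> carrier GalQ \<Longrightarrow> R \<sigma> \<one>\<^bsub>GalQ\<^esub> \<Longrightarrow> R (inv\<^bsub>GalQ\<^esub> \<alpha> \<otimes>\<^bsub>GalQ\<^esub> \<sigma> \<otimes>\<^bsub>GalQ\<^esub> \<alpha>) \<one>\<^bsub>GalQ\<^esub>"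
proof -
  note rules = biinvariant_rules[OF R]
  show "subgroup {\<sigma> \<in> carrier GalQ. R \<sigma> \<one>\<^bsub>GalQ\<^esub>} GalQ"
  proof (rule GalQ.subgroupI)
    show "{\<sigma> \<in> carrier GalQ. R \<sigma> \<one>\<^bsub>GalQ\<^esub>} \<noteq> {}" using rules(1) by blast
    fix \<sigma> assume "\<sigma> \<in> {\<sigma> \<in> carrier GalQ. R \<sigma> \<one>\<^bsub>GalQ\<^esub>}"
    hence s: "\<sigma> \<in> carrier GalQ" "R \<sigma> \<one>\<^bsub>GalQ\<^esub>" by auto
    have "R (inv\<^bsub>GalQ\<^esub> \<sigma> \<otimes>\<^bsub>GalQ\<^esub> \<sigma>) (inv\<^bsub>GalQ\<^esub> \<sigma> \<otimes>\<^bsub>GalQ\<^esub> \<one>\<^bsub>GalQ\<^esub>)"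
      using s by (intro rules(4)) auto
    hence "R (inv\<^bsub>GalQ\<^esub> \<sigma>) \<one>\<^bsub>GalQ\<^esub>" using s(1) rules(2) by simp
    thus "inv\<^bsub>GalQ\<^esub> \<sigma> \<in> {\<sigma> \<in> carrier GalQ. R \<sigma> \<one>\<^bsub>GalQ\<^esub>}" using s by simp
    fix \<tau> assume "\<tau> \<in> {\<sigma> \<in> carrier GalQ. R \<sigma> \<one>\<^bsub>GalQ\<^esub>}"
    hence t: "\<tau> \<in> carrier GalQ" "R \<tau> \<one>\<^bsub>GalQ\<^esub>" by auto
    have "R (\<sigma> \<otimes>\<^bsub>GalQ\<^esub> \<tau>) (\<sigma> \<otimes>\<^bsub>GalQ\<^esub> \<one>\<^bsub>GalQ\<^esub>)" using s t by (intro rules(4)) auto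
    hence "R (\<sigma> \<otimes>\<^bsub>GalQ\<^esub> \<tau>) \<sigma>" using s by simp
    from rules(3)[OF this s(2)] show "\<sigma> \<otimes>\<^bsub>GalQ\<^esub> \<tau> \<in> {\<sigma> \<in> carrier GalQ. R \<sigma> \<one>\<^bsub>GalQ\<^esub>}"
      using s t by simp
  qed auto
  show "R (inv\<^bsub>GalQ\<^esub> \<sigma> \<otimes>\<^bsub>GalQ\<^esub> \<tau>) \<one>\<^bsub>GalQ\<^esub>" if "\<sigma> \<in> carrier GalQ" "\<tau> \<in> carrier GalQ" "R \<sigma> \<tau>"
    using rules(4)[OF that(2,1) GalQ.inv_closed[OF that(1)] rules(2)[OF that(3)]] that(1) by simp
  show "R (inv\<^bsub>GalQ\<^esub> \<alpha> \<otimes>\<^bsub>GalQ\<^esub> \<sigma> \<otimes>\<^bsub>GalQ\<^esub> \<alpha>) \<one>\<^bsub>GalQ\<^esub>" if "\<sigma> \<in> carrier GalQ" "\<alpha> \<in> carrier GalQ" "R \<sigma> \<one>\<^bsub>GalQ\<^esub>"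
  proof -
    have "R (inv\<^bsub>GalQ\<^esub> \<alpha> \<otimes>\<^bsub>GalQ\<^esub> \<sigma>) (inv\<^bsub>GalQ\<^esub> \<alpha> \<otimes>\<^bsub>GalQ\<^esub> \<one>\<^bsub>GalQ\<^esub>)"
      using that by (intro rules(4)) auto
    hence "R (inv\<^bsub>GalQ\<^esub> \<alpha> \<otimes>\<^bsub>GalQ\<^esub> \<sigma> \<otimes>\<^bsub>GalQ\<^esub> \<alpha>) (inv\<^bsub>GalQ\<^esub> \<alpha> \<otimes>\<^bsub>GalQ\<^esub> \<one>\<^bsub>GalQ\<^esub> \<otimes>\<^bsub>GalQ\<^esub> \<alpha>)"
      using that by (intro rules(5)) auto
    thus ?thesis using that by simp
  qed
qed

text \<open>The product \<open>N\<close> of the two kernels inherits openness and finite index from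
  \<open>K1\<close>, and it contains every inertia group, so it is everything. Writing the quotient
  of \<open>\<tau>\<close> by \<open>\<sigma>\<close> as \<open>a \<otimes> b\<close> accordingly,
  \<open>\<sigma> \<otimes> a\<close> has the prescribed classes.\<close>

theorem linearly_disjoint:
  assumes R: "biinvariant R1" "biinvariant R2"
    and F: "finite F" "F \<subseteq> QQbar" "\<And>\<tau>. \<tau> \<in> carrier GalQ \<Longrightarrow> (\<And>x. x \<in> F \<Longrightarrow> \<tau> x = x) \<Longrightarrow> R1 \<tau> \<one>\<^bsub>GalQ\<^esub>"
    and fin: "finite (\<kappa> ` carrier GalQ)"
      "\<And>g h. g \<in> carrier GalQ \<Longrightarrow> h \<in> carrier GalQ \<Longrightarrow> \<kappa> g = \<kappa> h \<Longrightarrow> R1 g h"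
    and inertia: "\<And>p P. prime p \<Longrightarrow> P \<in> primes_above p \<Longrightarrow>
      (\<forall>\<sigma>\<in>inertia_group P. R1 \<sigma> \<one>\<^bsub>GalQ\<^esub>) \<or> (\<forall>\<sigma>\<in>inertia_group P. R2 \<sigma> \<one>\<^bsub>GalQ\<^esub>)"
    and st: "\<sigma> \<in> carrier GalQ" "\<tau> \<in> carrier GalQ"
  shows "\<exists>g\<in>carrier GalQ. R1 g \<sigma> \<and> R2 g \<tau>"
proof -
  define K1 where "K1 = {\<sigma> \<in> carrier GalQ. R1 \<sigma> \<one>\<^bsub>GalQ\<^esub>}"
  define K2 where "K2 = {\<sigma> \<in> carrier GalQ. R2 \<sigma> \<one>\<^bsub>GalQ\<^esub>}"
  note sub = biinvariant_kernel(1)[OF R(1), folded K1_def] biinvariant_kernel(1)[OF R(2), folded K2_def]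
  have K: "a \<in> carrier GalQ" if "a \<in> K1 \<or> a \<in> K2" for a using that by (auto simp: K1_def K2_def)
  define N where "N = {a \<otimes>\<^bsub>GalQ\<^esub> b | a b. a \<in> K1 \<and> b \<in> K2}"
  have NI: "a \<otimes>\<^bsub>GalQ\<^esub> b \<in> N" if "a \<in> K1" "b \<in> K2" for a b using that unfolding N_def by blast
  have conj: "inv\<^bsub>GalQ\<^esub> \<alpha> \<otimes>\<^bsub>GalQ\<^esub> a \<otimes>\<^bsub>GalQ\<^esub> \<alpha> \<in> K1" if "a \<in> K1" "\<alpha> \<in> carrier GalQ" for a \<alpha>
    using biinvariant_kernel(3)[OF R(1), of a \<alpha>] that by (simp add: K1_def)
  have K1N: "K1 \<subseteq> N"
  proof
    fix a assume a: "a \<in> K1"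
    from NI[OF a subgroup.one_closed[OF sub(2)]] K a show "a \<in> N" by simp
  qed
  have K2N: "K2 \<subseteq> N"
  proof
    fix a assume a: "a \<in> K2"
    from NI[OF subgroup.one_closed[OF sub(1)] a] K a show "a \<in> N" by simp
  qed
  \<comment> \<open>Normality of \<open>K1\<close> is what makes the product of the kernels a
    subgroup.\<close>
  have swap: "b \<otimes>\<^bsub>GalQ\<^esub> a \<in> N" if a: "a \<in> K1" and b: "b \<in> K2" for a b
  proof -
    have G: "a \<in> carrier GalQ" "b \<in> carrier GalQ" using K a b by auto
    have "inv\<^bsub>GalQ\<^esub> (inv\<^bsub>GalQ\<^esub> b) \<otimes>\<^bsub>GalQ\<^esub> a \<otimes>\<^bsub>GalQ\<^esub> inv\<^bsub>GalQ\<^esub> b \<in> K1" using conj[OF a GalQ.inv_closed[OF G(2)]] .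
    hence "(b \<otimes>\<^bsub>GalQ\<^esub> a \<otimes>\<^bsub>GalQ\<^esub> inv\<^bsub>GalQ\<^esub> b) \<otimes>\<^bsub>GalQ\<^esub> b \<in> N" using G by (intro NI b) simp
    thus ?thesis using G by (simp add: GalQ.m_assoc)
  qed
  have mult1: "a \<otimes>\<^bsub>GalQ\<^esub> x \<in> N" if a: "a \<in> K1" and x: "x \<in> N" for a x
  proof -
    from x obtain c d where cd: "c \<in> K1" "d \<in> K2" "x = c \<otimes>\<^bsub>GalQ\<^esub> d" unfolding N_def by blast
    have "a \<otimes>\<^bsub>GalQ\<^esub> c \<otimes>\<^bsub>GalQ\<^esub> d \<in> N" by (rule NI[OF subgroup.m_closed[OF sub(1) a cd(1)] cd(2)])
    thus ?thesis using cd a K by (simp add: GalQ.m_assoc)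
  qed
  have mult2: "x \<otimes>\<^bsub>GalQ\<^esub> b \<in> N" if b: "b \<in> K2" and x: "x \<in> N" for b x
  proof -
    from x obtain c d where cd: "c \<in> K1" "d \<in> K2" "x = c \<otimes>\<^bsub>GalQ\<^esub> d" unfolding N_def by blast
    have "c \<otimes>\<^bsub>GalQ\<^esub> (d \<otimes>\<^bsub>GalQ\<^esub> b) \<in> N" by (rule NI[OF cd(1) subgroup.m_closed[OF sub(2) cd(2) b]])
    thus ?thesis using cd b K by (simp add: GalQ.m_assoc)
  qed
  have subN: "subgroup N GalQ"
  proof (rule GalQ.subgroupI)
    show "N \<subseteq> carrier GalQ" using K by (auto simp: N_def)
    show "N \<noteq> {}" using K1N subgroup.one_closed[OF sub(1)] by blast
    fix x assume x: "x \<in> N"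
    then obtain a b where ab: "a \<in> K1" "b \<in> K2" "x = a \<otimes>\<^bsub>GalQ\<^esub> b" unfolding N_def by blast
    have "inv\<^bsub>GalQ\<^esub> b \<otimes>\<^bsub>GalQ\<^esub> inv\<^bsub>GalQ\<^esub> a \<in> N"
      by (rule swap[OF subgroup.m_inv_closed[OF sub(1) ab(1)] subgroup.m_inv_closed[OF sub(2) ab(2)]])
    thus "inv\<^bsub>GalQ\<^esub> x \<in> N" using ab K by (simp add: GalQ.inv_mult_group)
    fix y assume y: "y \<in> N"
    then obtain c d where cd: "c \<in> K1" "d \<in> K2" "y = c \<otimes>\<^bsub>GalQ\<^esub> d" unfolding N_def by blast
    have "a \<otimes>\<^bsub>GalQ\<^esub> (b \<otimes>\<^bsub>GalQ\<^esub> c) \<otimes>\<^bsub>GalQ\<^esub> d \<in> N"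
      by (rule mult2[OF cd(2) mult1[OF ab(1) swap[OF cd(1) ab(2)]]])
    thus "x \<otimes>\<^bsub>GalQ\<^esub> y \<in> N" using ab cd K by (simp add: GalQ.m_assoc)
  qed
  have "N = carrier GalQ"
  proof (rule no_unramified_extension[OF subN F(1,2) _ _ fin(1)])
    show "\<tau> \<in> N" if "\<tau> \<in> carrier GalQ" "\<And>x. x \<in> F \<Longrightarrow> \<tau> x = x" for \<tau>
      using F(3)[OF that] that(1) K1N by (auto simp: K1_def)
    show "inertia_group P \<subseteq> N" if "prime p" "P \<in> primes_above p" for p P
      using inertia[OF that] K1N K2N
      by (auto simp: K1_def K2_def inertia_group_def decomposition_group_def subset_iff)
    show "inv\<^bsub>GalQ\<^esub> g \<otimes>\<^bsub>GalQ\<^esub> h \<in> N" if "g \<in> carrier GalQ" "h \<in> carrier GalQ" "\<kappa> g = \<kappa> h" for g h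
    proof -
      have "R1 g h" by (rule fin(2)[OF that])
      hence "R1 (inv\<^bsub>GalQ\<^esub> g \<otimes>\<^bsub>GalQ\<^esub> h) \<one>\<^bsub>GalQ\<^esub>" by (rule biinvariant_kernel(2)[OF R(1), OF that(1,2)])
      hence "inv\<^bsub>GalQ\<^esub> g \<otimes>\<^bsub>GalQ\<^esub> h \<in> K1" using that(1,2) by (simp add: K1_def)
      thus ?thesis by (rule subsetD[OF K1N])
    qed
  qed
  moreover have "inv\<^bsub>GalQ\<^esub> \<sigma> \<otimes>\<^bsub>GalQ\<^esub> \<tau> \<in> carrier GalQ" using st by simp
  ultimately obtain a b where ab: "a \<in> K1" "b \<in> K2" "inv\<^bsub>GalQ\<^esub> \<sigma> \<otimes>\<^bsub>GalQ\<^esub> \<tau> = a \<otimes>\<^bsub>GalQ\<^esub> b"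
    unfolding N_def by blast
  have G: "a \<in> carrier GalQ" "b \<in> carrier GalQ" "R1 a \<one>\<^bsub>GalQ\<^esub>" "R2 b \<one>\<^bsub>GalQ\<^esub>" using ab by (auto simp: K1_def K2_def)
  \<comment> \<open>As \<open>a\<close> is in the first kernel, \<open>g\<close> is related to
    \<open>\<sigma>\<close> by \<open>R1\<close>; as \<open>\<tau>\<close> equals
    \<open>g \<otimes> b\<close> with \<open>b\<close> in the second, it is related to
    \<open>\<tau>\<close> by \<open>R2\<close>.\<close>
  define g where "g = \<sigma> \<otimes>\<^bsub>GalQ\<^esub> a"
  have g: "g \<in> carrier GalQ" using st G by (simp add: g_def)
  have "\<sigma> \<otimes>\<^bsub>GalQ\<^esub> (inv\<^bsub>GalQ\<^esub> \<sigma> \<otimes>\<^bsub>GalQ\<^esub> \<tau>) = g \<otimes>\<^bsub>GalQ\<^esub> b"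
    unfolding ab(3) g_def using st G by (simp add: GalQ.m_assoc)
  hence \<tau>: "\<tau> = g \<otimes>\<^bsub>GalQ\<^esub> b" using st by (simp add: GalQ.m_assoc[symmetric])
  note r1 = biinvariant_rules[OF R(1)] and r2 = biinvariant_rules[OF R(2)]
  have "R1 g \<sigma>" using r1(4)[OF G(1) GalQ.one_closed st(1) G(3)] st(1) by (simp add: g_def)
  moreover have "R2 \<tau> g" using r2(4)[OF G(2) GalQ.one_closed g G(4)] g unfolding \<tau> by simp
  hence "R2 g \<tau>" by (rule r2(2))
  ultimately show ?thesis using g by blast
qed

section \<open>Multiplicativity of the density\<close>

definition level :: "nat \<Rightarrow> (nat \<Rightarrow> int) mat2 \<Rightarrow> int mat2" where
  "level e = map_mat2 (\<lambda>x. x e)"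

lemma level_simp: "level e A = ((fst (fst A) e, snd (fst A) e), (fst (snd A) e, snd (snd A) e))"
  unfolding level_def by (cases A; cases "fst A"; cases "snd A"; simp)

lemma level_eq_iff:
  "level e A = level e B \<longleftrightarrow> fst (fst A) e = fst (fst B) e \<and> snd (fst A) e = snd (fst B) e \<and>
     fst (snd A) e = fst (snd B) e \<and> snd (snd A) e = snd (snd B) e"
  by (auto simp: level_simp)

lemma mat2_mult_Zl_simp:
  "mat2_mult (Zl l) A B =
     ((\<lambda>e. (fst (fst A) e * fst (fst B) e mod int l ^ e + snd (fst A) e * fst (snd B) e mod int l ^ e) mod int l ^ e,
       \<lambda>e. (fst (fst A) e * snd (fst B) e mod int l ^ e + snd (fst A) e * snd (snd B) e mod int l ^ e) mod int l ^ e),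
      (\<lambda>e. (fst (snd A) e * fst (fst B) e mod int l ^ e + snd (snd A) e * fst (snd B) e mod int l ^ e) mod int l ^ e,
       \<lambda>e. (fst (snd A) e * snd (fst B) e mod int l ^ e + snd (snd A) e * snd (snd B) e mod int l ^ e) mod int l ^ e))"
  by (cases A; cases B; cases "fst A"; cases "snd A"; cases "fst B"; cases "snd B"; simp add: Zl_def)

lemma level_mult:
  assumes "level e A = level e A'" "level e B = level e B'"
  shows "level e (mat2_mult (Zl l) A B) = level e (mat2_mult (Zl l) A' B')"
  using assms unfolding level_eq_iff mat2_mult_Zl_simp by simp

lemma GL2_simps:
  "x \<otimes>\<^bsub>GL2 R\<^esub> y = mat2_mult R x y" "carrier (GL2 R) \<subseteq> (carrier R \<times> carrier R) \<times> (carrier R \<times> carrier R)"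
  by (auto simp: GL2_def units_of_def M2_def Units_def)

lemma Zl_level: "x \<in> carrier (Zl l) \<Longrightarrow> x e \<in> {0..<int l ^ e}"
  by (simp add: Zl_def)

text \<open>The rationals form a number field, so the generating sets cover the whole group.\<close>

lemma topspace_krull: "topspace krull_topology = carrier GalQ"
proof -
  have "CF.dimension 1 \<rat> \<rat>" by (rule CF.dimension_one[OF Rats_subfield])
  hence "CF.finite_dimension \<rat> \<rat>" by (intro CF.finite_dimensionI)
  hence "number_field \<rat>" using Rats_subfield unfolding number_field_def by simp
  hence *: "{\<tau> \<in> carrier GalQ. \<forall>x\<in>\<rat>. \<tau> x = \<sigma> x} \<in>
     {{\<tau> \<in> carrier GalQ. \<forall>x\<in>L. \<tau> x = \<sigma> x} | \<sigma> L. \<sigma> \<in> carrier GalQ \<and> number_field L}"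
    if "\<sigma> \<in> carrier GalQ" for \<sigma>
    using that by blast
  have "\<sigma> \<in> topspace krull_topology" if "\<sigma> \<in> carrier GalQ" for \<sigma>
    unfolding krull_topology_def topology_generated_by_topspace
    by (rule UnionI[OF *[OF that]]) (use that in simp)
  moreover have "topspace krull_topology \<subseteq> carrier GalQ"
    unfolding krull_topology_def topology_generated_by_topspace by auto
  ultimately show ?thesis by blast
qed

lemma openin_entry:
  assumes c: "continuous_map krull_topology (Zl_topology l) f"
  shows "openin krull_topology {\<sigma> \<in> carrier GalQ. f \<sigma> e = c}"
proof -
  have "continuous_map (Zl_topology l) (discrete_topology {0..<int l ^ e}) (\<lambda>x. x e)"
    unfolding Zl_topology_def
    by (rule continuous_map_from_subtopology, rule continuous_map_product_projection) simp
  from continuous_map_compose[OF c this]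
  have cc: "continuous_map krull_topology (discrete_topology {0..<int l ^ e}) (\<lambda>\<sigma>. f \<sigma> e)"
    by (simp add: o_def)
  have "openin krull_topology {\<sigma> \<in> topspace krull_topology. f \<sigma> e \<in> {c} \<inter> {0..<int l ^ e}}"
    by (rule openin_continuous_map_preimage[OF cc]) simp
  moreover have "{\<sigma> \<in> topspace krull_topology. f \<sigma> e \<in> {c} \<inter> {0..<int l ^ e}} = {\<sigma> \<in> carrier GalQ. f \<sigma> e = c}"
    using continuous_map_funspace[OF cc] by (auto simp: topspace_krull)
  ultimately show ?thesis by simp
qed

lemma deligne_rep_rules:
  assumes "deligne_rep a k l \<rho>"
  shows "\<sigma> \<in> carrier GalQ \<Longrightarrow> \<rho> \<sigma> \<in> carrier (GL2 (Zl l))"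
    and "\<sigma> \<in> carrier GalQ \<Longrightarrow> \<tau> \<in> carrier GalQ \<Longrightarrow> \<rho> (\<sigma> \<otimes>\<^bsub>GalQ\<^esub> \<tau>) = mat2_mult (Zl l) (\<rho> \<sigma>) (\<rho> \<tau>)"
    and "continuous_map krull_topology (GL2_Zl_topology l) \<rho>"
    and "prime p \<Longrightarrow> p \<noteq> l \<Longrightarrow> P \<in> primes_above p \<Longrightarrow> \<sigma> \<in> inertia_group P \<Longrightarrow> \<rho> \<sigma> = \<one>\<^bsub>GL2 (Zl l)\<^esub>"
  using assms unfolding deligne_rep_def hom_def GL2_simps(1)[symmetric] by auto

text \<open>Each entry modulo a fixed power of \<open>l\<close> is a continuous map to a discrete
  space; the four conditions together define an open neighbourhood of the neutral element, and
  finitely many algebraic numbers control it.\<close>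

lemma level_locally_constant:
  assumes "deligne_rep a k l \<rho>"
  shows "\<exists>F. finite F \<and> F \<subseteq> QQbar \<and>
    (\<forall>\<tau>\<in>carrier GalQ. (\<forall>x\<in>F. \<tau> x = x) \<longrightarrow> level e (\<rho> \<tau>) = level e (\<rho> \<one>\<^bsub>GalQ\<^esub>))"
proof -
  let ?Z = "Zl_topology l"
  have c: "continuous_map krull_topology (prod_topology (prod_topology ?Z ?Z) (prod_topology ?Z ?Z)) \<rho>"
    using deligne_rep_rules(3)[OF assms] unfolding GL2_Zl_topology_def by (simp add: continuous_map_in_subtopology)
  have c12: "continuous_map krull_topology (prod_topology ?Z ?Z) (\<lambda>\<sigma>. fst (\<rho> \<sigma>))"
    "continuous_map krull_topology (prod_topology ?Z ?Z) (\<lambda>\<sigma>. snd (\<rho> \<sigma>))"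
    using continuous_map_compose[OF c continuous_map_fst] continuous_map_compose[OF c continuous_map_snd]
    by (simp_all add: o_def)
  have c4: "continuous_map krull_topology ?Z (\<lambda>\<sigma>. fst (fst (\<rho> \<sigma>)))"
    "continuous_map krull_topology ?Z (\<lambda>\<sigma>. snd (fst (\<rho> \<sigma>)))"
    "continuous_map krull_topology ?Z (\<lambda>\<sigma>. fst (snd (\<rho> \<sigma>)))"
    "continuous_map krull_topology ?Z (\<lambda>\<sigma>. snd (snd (\<rho> \<sigma>)))"
    using continuous_map_compose[OF c12(1) continuous_map_fst] continuous_map_compose[OF c12(1) continuous_map_snd]
      continuous_map_compose[OF c12(2) continuous_map_fst] continuous_map_compose[OF c12(2) continuous_map_snd]
    by (simp_all add: o_def)
  let ?one = "\<rho> \<one>\<^bsub>GalQ\<^esub>"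
  define U where "U = {\<sigma> \<in> carrier GalQ. fst (fst (\<rho> \<sigma>)) e = fst (fst ?one) e} \<inter>
    {\<sigma> \<in> carrier GalQ. snd (fst (\<rho> \<sigma>)) e = snd (fst ?one) e} \<inter>
    {\<sigma> \<in> carrier GalQ. fst (snd (\<rho> \<sigma>)) e = fst (snd ?one) e} \<inter>
    {\<sigma> \<in> carrier GalQ. snd (snd (\<rho> \<sigma>)) e = snd (snd ?one) e}"
  have "openin krull_topology U" unfolding U_def
    by (intro openin_Int openin_entry[OF c4(1)] openin_entry[OF c4(2)] openin_entry[OF c4(3)] openin_entry[OF c4(4)])
  moreover have "\<one>\<^bsub>GalQ\<^esub> \<in> U" by (simp add: U_def)
  ultimately have "\<exists>F. finite F \<and> F \<subseteq> QQbar \<and>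
     (\<forall>\<tau>\<in>carrier GalQ. (\<forall>x\<in>F. \<tau> x = \<one>\<^bsub>GalQ\<^esub> x) \<longrightarrow> \<tau> \<in> U)"
    by (rule krull_open_finitely_determined)
  then obtain F where F: "finite F" "F \<subseteq> QQbar"
    "\<forall>\<tau>\<in>carrier GalQ. (\<forall>x\<in>F. \<tau> x = \<one>\<^bsub>GalQ\<^esub> x) \<longrightarrow> \<tau> \<in> U" by (elim exE conjE) (rule that)
  have "level e (\<rho> \<tau>) = level e ?one" if "\<tau> \<in> carrier GalQ" "\<forall>x\<in>F. \<tau> x = x" for \<tau>
  proof -
    have "\<forall>x\<in>F. \<tau> x = \<one>\<^bsub>GalQ\<^esub> x"
    proof
      fix x assume x: "x \<in> F"
      hence "\<one>\<^bsub>GalQ\<^esub> x = x" using F(2) by (intro GalQ_one) blast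
      thus "\<tau> x = \<one>\<^bsub>GalQ\<^esub> x" using x that(2) by simp
    qed
    hence "\<tau> \<in> U" using F(3) that(1) by simp
    thus ?thesis by (simp add: level_eq_iff U_def)
  qed
  with F(1,2) show ?thesis by (intro exI[of _ F]) simp
qed

text \<open>Through this the unramifiedness clause itself supplies the value of a representation at
  the neutral element.\<close>

lemma one_in_inertia_group:
  assumes "P \<in> primes_above p"
  shows "\<one>\<^bsub>GalQ\<^esub> \<in> inertia_group P"
proof -
  have "primeideal P Zbar" using assms by (simp add: primes_above_def)
  note P = primeideal_Zbar_rules(1)[OF this, unfolded zbar_ideal_def]
  have id: "\<one>\<^bsub>GalQ\<^esub> x = x" if "x \<in> ZZbar" for x using GalQ_one[of x] that by auto
  have "\<one>\<^bsub>GalQ\<^esub> ` P = (\<lambda>x. x) ` P" using id P by (intro image_cong) auto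
  thus ?thesis using id P by (simp add: inertia_group_def decomposition_group_def)
qed

text \<open>The prescribed residues are reduced, without which the description in
  \<open>crt_residue\<close> would denote nothing.\<close>

definition crt_valid :: "nat \<Rightarrow> (nat \<Rightarrow> nat \<Rightarrow> int) \<Rightarrow> bool" where
  "crt_valid m x \<longleftrightarrow> (\<forall>l\<in>prime_factors m. x l (multiplicity l m) \<in> {0..<int l ^ multiplicity l m})"

lemma crt_residue_ex1:
  assumes m: "m > 0" and x: "crt_valid m x"
  shows "\<exists>!r. r \<in> carrier (residue_ring (int m)) \<and>
    (\<forall>l\<in>prime_factors m. r mod int l ^ multiplicity l m = x l (multiplicity l m))"
proof -
  define q where "q l = l ^ multiplicity l m" for l
  define u where "u l = nat (x l (multiplicity l m))" for l
  have u: "int (u l) = x l (multiplicity l m)" "u l < q l" if "l \<in> prime_factors m" for l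
    using x that by (auto simp: crt_valid_def u_def q_def nat_less_iff)
  have "\<exists>!n. n < (\<Prod>l\<in>prime_factors m. q l) \<and> (\<forall>l\<in>prime_factors m. [n = u l] (mod q l))"
  proof (rule chinese_remainder_unique_nat)
    show "\<forall>l\<in>prime_factors m. q l \<noteq> 0" by (auto simp: q_def in_prime_factors_iff dest: prime_gt_0_nat)
    show "\<forall>l\<in>prime_factors m. \<forall>k\<in>prime_factors m. l \<noteq> k \<longrightarrow> coprime (q l) (q k)"
      by (auto simp: q_def in_prime_factors_iff intro!: coprime_power_left_iff[THEN iffD2] coprime_power_right_iff[THEN iffD2] primes_coprime)
  qed simp
  moreover have "(\<Prod>l\<in>prime_factors m. q l) = m"
    using prod_prime_factors[of m] m by (simp add: q_def)
  moreover have "[n = u l] (mod q l) \<longleftrightarrow> int n mod int l ^ multiplicity l m = x l (multiplicity l m)"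
    if "l \<in> prime_factors m" for n l
  proof -
    have "[n = u l] (mod q l) \<longleftrightarrow> n mod q l = u l" using u(2)[OF that] by (simp add: cong_def)
    also have "\<dots> \<longleftrightarrow> int (n mod q l) = int (u l)" by (simp only: of_nat_eq_iff)
    finally show ?thesis using u(1)[OF that] by (simp add: q_def zmod_int)
  qed
  ultimately have ex1: "\<exists>!n. n < m \<and> (\<forall>l\<in>prime_factors m. int n mod int l ^ multiplicity l m = x l (multiplicity l m))"
    by auto
  show ?thesis
  proof (rule ex_ex1I)
    from ex1 obtain n where "n < m" "\<forall>l\<in>prime_factors m. int n mod int l ^ multiplicity l m = x l (multiplicity l m)"
      by blast
    thus "\<exists>r. r \<in> carrier (residue_ring (int m)) \<and>
      (\<forall>l\<in>prime_factors m. r mod int l ^ multiplicity l m = x l (multiplicity l m))"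
      by (intro exI[of _ "int n"]) (auto simp: residue_ring_def)
  next
    fix r s assume r: "r \<in> carrier (residue_ring (int m)) \<and>
        (\<forall>l\<in>prime_factors m. r mod int l ^ multiplicity l m = x l (multiplicity l m))"
      and s: "s \<in> carrier (residue_ring (int m)) \<and>
        (\<forall>l\<in>prime_factors m. s mod int l ^ multiplicity l m = x l (multiplicity l m))"
    have "int (nat r) = r" "int (nat s) = s" "nat r < m" "nat s < m"
      using r s by (auto simp: residue_ring_def nat_less_iff)
    hence "nat r = nat s" using ex1 r s by (metis (no_types, lifting))
    thus "r = s" using \<open>int (nat r) = r\<close> \<open>int (nat s) = s\<close> by metis
  qed
qed

lemma crt_residue_props:
  assumes "m > 0" "crt_valid m x"
  shows "crt_residue m x \<in> {0..<int m}"
    and "l \<in> prime_factors m \<Longrightarrow> crt_residue m x mod int l ^ multiplicity l m = x l (multiplicity l m)"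
  using theI'[OF crt_residue_ex1[OF assms], folded crt_residue_def] by (auto simp: residue_ring_def)

lemma crt_residue_eqI:
  assumes "m > 0" "crt_valid m x" "r \<in> {0..<int m}"
    "\<And>l. l \<in> prime_factors m \<Longrightarrow> r mod int l ^ multiplicity l m = x l (multiplicity l m)"
  shows "crt_residue m x = r"
proof -
  define Q where "Q r \<longleftrightarrow> r \<in> carrier (residue_ring (int m)) \<and>
    (\<forall>l\<in>prime_factors m. r mod int l ^ multiplicity l m = x l (multiplicity l m))" for r
  have "\<exists>!r. Q r" unfolding Q_def by (rule crt_residue_ex1[OF assms(1,2)])
  moreover have "Q r" using assms(3,4) by (simp add: Q_def residue_ring_def)
  ultimately have "(THE r. Q r) = r" by (rule the1_equality)
  thus ?thesis by (simp add: Q_def crt_residue_def)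
qed

lemma crt_residue_eq_iff:
  assumes "m > 0" "crt_valid m x" "crt_valid m y"
  shows "crt_residue m x = crt_residue m y \<longleftrightarrow>
    (\<forall>l\<in>prime_factors m. x l (multiplicity l m) = y l (multiplicity l m))"
proof
  assume "crt_residue m x = crt_residue m y"
  thus "\<forall>l\<in>prime_factors m. x l (multiplicity l m) = y l (multiplicity l m)"
    using crt_residue_props(2)[OF assms(1,2)] crt_residue_props(2)[OF assms(1,3)] by simp
next
  assume "\<forall>l\<in>prime_factors m. x l (multiplicity l m) = y l (multiplicity l m)"
  thus "crt_residue m x = crt_residue m y"
    by (intro crt_residue_eqI[OF assms(1,2) crt_residue_props(1)[OF assms(1,3)]])
       (simp add: crt_residue_props(2)[OF assms(1,3)])
qed

lemma multiplicity_coprime_factor: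
  fixes m1 m2 :: nat
  assumes "coprime m1 m2" "m1 > 0" "m2 > 0" "l \<in> prime_factors m1"
  shows "l \<in> prime_factors (m1 * m2)" "multiplicity l (m1 * m2) = multiplicity l m1"
proof -
  have l: "prime l" "l dvd m1" using assms(4) by (auto simp: in_prime_factors_iff)
  have "\<not> l dvd m2" using l assms(1) by (metis coprime_common_divisor_nat not_prime_1 One_nat_def)
  hence "multiplicity l m2 = 0" by (rule not_dvd_imp_multiplicity_0)
  thus "multiplicity l (m1 * m2) = multiplicity l m1"
    using l assms by (simp add: prime_elem_multiplicity_mult_distrib)
  show "l \<in> prime_factors (m1 * m2)" using l assms by (auto simp: in_prime_factors_iff)
qed

text \<open>Coprimality makes a prime factor of \<open>m1\<close> occur in \<open>m1 * m2\<close>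
  with the same exponent, so both residues are tested at the same level of \<open>x\<close>.\<close>

lemma crt_residue_mod:
  assumes m: "coprime m1 m2" "m1 > 0" "m2 > 0" and x: "crt_valid (m1 * m2) x"
  shows "crt_residue (m1 * m2) x mod int m1 = crt_residue m1 x"
proof (rule crt_residue_eqI[symmetric])
  have m': "m1 * m2 > 0" using m by simp
  note mult = multiplicity_coprime_factor[OF m]
  show "m1 > 0" by fact
  show "crt_valid m1 x" unfolding crt_valid_def
  proof
    fix l assume l: "l \<in> prime_factors m1"
    from x mult(1)[OF l] have "x l (multiplicity l (m1 * m2)) \<in> {0..<int l ^ multiplicity l (m1 * m2)}"
      unfolding crt_valid_def by blast
    thus "x l (multiplicity l m1) \<in> {0..<int l ^ multiplicity l m1}" unfolding mult(2)[OF l] .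
  qed
  show "crt_residue (m1 * m2) x mod int m1 \<in> {0..<int m1}" using m by simp
  fix l assume l: "l \<in> prime_factors m1"
  have "int (l ^ multiplicity l m1) dvd int m1" by (simp only: of_nat_dvd_iff multiplicity_dvd)
  hence "int l ^ multiplicity l m1 dvd int m1" by simp
  hence "crt_residue (m1 * m2) x mod int m1 mod int l ^ multiplicity l m1 =
      crt_residue (m1 * m2) x mod int l ^ multiplicity l m1" by (rule mod_mod_cancel)
  also have "\<dots> = x l (multiplicity l m1)"
    using crt_residue_props(2)[OF m' x mult(1)[OF l]] mult(2)[OF l] by simp
  finally show "crt_residue (m1 * m2) x mod int m1 mod int l ^ multiplicity l m1 = x l (multiplicity l m1)" .
qed

lemma mat2_trace_residue_ring:
  "mat2_trace (residue_ring (int m)) A = (fst (fst A) + snd (snd A)) mod int m"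
  by (cases A; cases "fst A"; cases "snd A"; simp add: residue_ring_def)

definition reduce_mat2 :: "nat \<Rightarrow> int mat2 \<Rightarrow> int mat2" where
  "reduce_mat2 m A = ((fst (fst A) mod int m, snd (fst A) mod int m), (fst (snd A) mod int m, snd (snd A) mod int m))"

lemma reduce_mat2_inj:
  assumes m: "coprime m1 m2"
    and A: "A \<in> ({0..<int (m1 * m2)} \<times> {0..<int (m1 * m2)}) \<times> ({0..<int (m1 * m2)} \<times> {0..<int (m1 * m2)})"
    and B: "B \<in> ({0..<int (m1 * m2)} \<times> {0..<int (m1 * m2)}) \<times> ({0..<int (m1 * m2)} \<times> {0..<int (m1 * m2)})"
    and eq: "reduce_mat2 m1 A = reduce_mat2 m1 B" "reduce_mat2 m2 A = reduce_mat2 m2 B"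
  shows "A = B"
proof -
  have uniq: "x = y" if "x \<in> {0..<int (m1 * m2)}" "y \<in> {0..<int (m1 * m2)}" "x mod int m1 = y mod int m1" "x mod int m2 = y mod int m2"
    for x y
  proof -
    have "int m1 dvd x - y" "int m2 dvd x - y" using that(3,4) by (simp_all add: mod_eq_dvd_iff)
    hence "int m1 * int m2 dvd x - y" using m by (intro divides_mult) simp_all
    hence "x mod int (m1 * m2) = y mod int (m1 * m2)" by (simp add: mod_eq_dvd_iff)
    thus "x = y" using that(1,2) by simp
  qed
  note facts = A[unfolded mem_Times_iff] B[unfolded mem_Times_iff] eq[unfolded reduce_mat2_def prod.inject]
  have "fst (fst A) = fst (fst B)" "snd (fst A) = snd (fst B)" "fst (snd A) = fst (snd B)" "snd (snd A) = snd (snd B)"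
    by (rule uniq; use facts in blast)+
  thus ?thesis by (intro prod_eqI)
qed

context
  fixes a1 a2 :: "nat \<Rightarrow> int" and k1 k2 :: nat and \<rho>1 \<rho>2 :: "nat \<Rightarrow> (complex \<Rightarrow> complex) \<Rightarrow> (nat \<Rightarrow> int) mat2"
  assumes rho1: "\<And>l. prime l \<Longrightarrow> deligne_rep a1 k1 l (\<rho>1 l)"
    and rho2: "\<And>l. prime l \<Longrightarrow> deligne_rep a2 k2 l (\<rho>2 l)"
begin

text \<open>Equality of both reductions modulo \<open>m\<close>, prime by prime, before the Chinese
  remainder theorem merges them. In this form compatibility with multiplication is visible.\<close>

definition same_level :: "nat \<Rightarrow> (complex \<Rightarrow> complex) \<Rightarrow> (complex \<Rightarrow> complex) \<Rightarrow> bool" where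
  "same_level m \<sigma> \<tau> \<longleftrightarrow> (\<forall>l\<in>prime_factors m.
     level (multiplicity l m) (\<rho>1 l \<sigma>) = level (multiplicity l m) (\<rho>1 l \<tau>) \<and>
     level (multiplicity l m) (\<rho>2 l \<sigma>) = level (multiplicity l m) (\<rho>2 l \<tau>))"

definition pair_rep :: "nat \<Rightarrow> (complex \<Rightarrow> complex) \<Rightarrow> int mat2 \<times> int mat2" where
  "pair_rep m \<sigma> = (mod_rep \<rho>1 m \<sigma>, mod_rep \<rho>2 m \<sigma>)"

lemma biinvariant_same_level: "biinvariant (same_level m)"
  unfolding biinvariant_def
proof (intro conjI allI ballI impI)
  fix \<sigma> \<tau> \<upsilon>
  show "same_level m \<sigma> \<sigma>" by (simp add: same_level_def)
  show "same_level m \<sigma> \<tau> \<Longrightarrow> same_level m \<tau> \<sigma>" by (simp add: same_level_def)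
  show "same_level m \<sigma> \<tau> \<Longrightarrow> same_level m \<tau> \<upsilon> \<Longrightarrow> same_level m \<sigma> \<upsilon>" by (simp add: same_level_def)
next
  fix \<sigma> \<tau> \<alpha> assume G: "\<sigma> \<in> carrier GalQ" "\<tau> \<in> carrier GalQ" "\<alpha> \<in> carrier GalQ" and eq: "same_level m \<sigma> \<tau>"
  have pr: "prime l" if "l \<in> prime_factors m" for l using that by (simp add: in_prime_factors_iff)
  show "same_level m (\<alpha> \<otimes>\<^bsub>GalQ\<^esub> \<sigma>) (\<alpha> \<otimes>\<^bsub>GalQ\<^esub> \<tau>)" "same_level m (\<sigma> \<otimes>\<^bsub>GalQ\<^esub> \<alpha>) (\<tau> \<otimes>\<^bsub>GalQ\<^esub> \<alpha>)"
    unfolding same_level_def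
    using eq G deligne_rep_rules(2)[OF rho1[OF pr]] deligne_rep_rules(2)[OF rho2[OF pr]]
    by (auto simp: same_level_def intro!: level_mult)
qed

lemma crt_valid_entries:
  assumes "\<sigma> \<in> carrier GalQ"
  shows "crt_valid m (\<lambda>l. fst (fst (\<rho>1 l \<sigma>)))" "crt_valid m (\<lambda>l. snd (fst (\<rho>1 l \<sigma>)))"
    "crt_valid m (\<lambda>l. fst (snd (\<rho>1 l \<sigma>)))" "crt_valid m (\<lambda>l. snd (snd (\<rho>1 l \<sigma>)))"
    "crt_valid m (\<lambda>l. fst (fst (\<rho>2 l \<sigma>)))" "crt_valid m (\<lambda>l. snd (fst (\<rho>2 l \<sigma>)))"
    "crt_valid m (\<lambda>l. fst (snd (\<rho>2 l \<sigma>)))" "crt_valid m (\<lambda>l. snd (snd (\<rho>2 l \<sigma>)))"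
proof -
  have M: "\<rho>1 l \<sigma> \<in> (carrier (Zl l) \<times> carrier (Zl l)) \<times> (carrier (Zl l) \<times> carrier (Zl l))"
    "\<rho>2 l \<sigma> \<in> (carrier (Zl l) \<times> carrier (Zl l)) \<times> (carrier (Zl l) \<times> carrier (Zl l))"
    if "l \<in> prime_factors m" for l
  proof -
    have "prime l" using that by (simp add: in_prime_factors_iff)
    from deligne_rep_rules(1)[OF rho1[OF this] assms] deligne_rep_rules(1)[OF rho2[OF this] assms]
    show "\<rho>1 l \<sigma> \<in> (carrier (Zl l) \<times> carrier (Zl l)) \<times> (carrier (Zl l) \<times> carrier (Zl l))"
      "\<rho>2 l \<sigma> \<in> (carrier (Zl l) \<times> carrier (Zl l)) \<times> (carrier (Zl l) \<times> carrier (Zl l))"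
      using GL2_simps(2)[of "Zl l"] by blast+
  qed
  show "crt_valid m (\<lambda>l. fst (fst (\<rho>1 l \<sigma>)))" "crt_valid m (\<lambda>l. snd (fst (\<rho>1 l \<sigma>)))"
    "crt_valid m (\<lambda>l. fst (snd (\<rho>1 l \<sigma>)))" "crt_valid m (\<lambda>l. snd (snd (\<rho>1 l \<sigma>)))"
    "crt_valid m (\<lambda>l. fst (fst (\<rho>2 l \<sigma>)))" "crt_valid m (\<lambda>l. snd (fst (\<rho>2 l \<sigma>)))"
    "crt_valid m (\<lambda>l. fst (snd (\<rho>2 l \<sigma>)))" "crt_valid m (\<lambda>l. snd (snd (\<rho>2 l \<sigma>)))"
    unfolding crt_valid_def by (intro ballI Zl_level; use M in \<open>simp add: mem_Times_iff\<close>)+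
qed

lemma pair_rep_eq_iff:
  assumes "m > 0" "\<sigma> \<in> carrier GalQ" "\<tau> \<in> carrier GalQ"
  shows "pair_rep m \<sigma> = pair_rep m \<tau> \<longleftrightarrow> same_level m \<sigma> \<tau>"
  unfolding pair_rep_def mod_rep_def prod.inject same_level_def level_eq_iff
    crt_residue_eq_iff[OF assms(1) crt_valid_entries(1)[OF assms(2)] crt_valid_entries(1)[OF assms(3)]]
    crt_residue_eq_iff[OF assms(1) crt_valid_entries(2)[OF assms(2)] crt_valid_entries(2)[OF assms(3)]]
    crt_residue_eq_iff[OF assms(1) crt_valid_entries(3)[OF assms(2)] crt_valid_entries(3)[OF assms(3)]]
    crt_residue_eq_iff[OF assms(1) crt_valid_entries(4)[OF assms(2)] crt_valid_entries(4)[OF assms(3)]]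
    crt_residue_eq_iff[OF assms(1) crt_valid_entries(5)[OF assms(2)] crt_valid_entries(5)[OF assms(3)]]
    crt_residue_eq_iff[OF assms(1) crt_valid_entries(6)[OF assms(2)] crt_valid_entries(6)[OF assms(3)]]
    crt_residue_eq_iff[OF assms(1) crt_valid_entries(7)[OF assms(2)] crt_valid_entries(7)[OF assms(3)]]
    crt_residue_eq_iff[OF assms(1) crt_valid_entries(8)[OF assms(2)] crt_valid_entries(8)[OF assms(3)]]
  by blast

lemma pair_rep_range:
  assumes "m > 0" "\<sigma> \<in> carrier GalQ"
  shows "pair_rep m \<sigma> \<in> (({0..<int m} \<times> {0..<int m}) \<times> ({0..<int m} \<times> {0..<int m})) \<times>
    (({0..<int m} \<times> {0..<int m}) \<times> ({0..<int m} \<times> {0..<int m}))"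
  unfolding pair_rep_def mod_rep_def
  by (intro SigmaI crt_residue_props(1)[OF assms(1)] crt_valid_entries[OF assms(2)])

lemma pair_rep_reduce:
  assumes "coprime m1 m2" "m1 > 0" "m2 > 0" "\<sigma> \<in> carrier GalQ"
  shows "map_prod (reduce_mat2 m1) (reduce_mat2 m1) (pair_rep (m1 * m2) \<sigma>) = pair_rep m1 \<sigma>"
  unfolding pair_rep_def mod_rep_def map_prod_simp reduce_mat2_def fst_conv snd_conv
    crt_residue_mod[OF assms(1-3) crt_valid_entries(1)[OF assms(4)]] crt_residue_mod[OF assms(1-3) crt_valid_entries(2)[OF assms(4)]]
    crt_residue_mod[OF assms(1-3) crt_valid_entries(3)[OF assms(4)]] crt_residue_mod[OF assms(1-3) crt_valid_entries(4)[OF assms(4)]]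
    crt_residue_mod[OF assms(1-3) crt_valid_entries(5)[OF assms(4)]] crt_residue_mod[OF assms(1-3) crt_valid_entries(6)[OF assms(4)]]
    crt_residue_mod[OF assms(1-3) crt_valid_entries(7)[OF assms(4)]] crt_residue_mod[OF assms(1-3) crt_valid_entries(8)[OF assms(4)]]
  by (rule refl)

text \<open>All the representations involved belong to primes \<open>l\<close> dividing
  \<open>m\<close>, hence different from \<open>p\<close>, and are unramified at
  \<open>p\<close>.\<close>

lemma same_level_one_if_inertia:
  assumes "prime p" "\<not> p dvd m" "P \<in> primes_above p" "\<sigma> \<in> inertia_group P"
  shows "same_level m \<sigma> \<one>\<^bsub>GalQ\<^esub>"
  unfolding same_level_def
proof
  fix l assume l: "l \<in> prime_factors m"
  hence "prime l" "p \<noteq> l" using assms(2) by (auto simp: in_prime_factors_iff)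
  note r1 = deligne_rep_rules(4)[OF rho1[OF this(1)] assms(1) this(2) assms(3)]
    and r2 = deligne_rep_rules(4)[OF rho2[OF this(1)] assms(1) this(2) assms(3)]
  note one = one_in_inertia_group[OF assms(3)]
  show "level (multiplicity l m) (\<rho>1 l \<sigma>) = level (multiplicity l m) (\<rho>1 l \<one>\<^bsub>GalQ\<^esub>) \<and>
     level (multiplicity l m) (\<rho>2 l \<sigma>) = level (multiplicity l m) (\<rho>2 l \<one>\<^bsub>GalQ\<^esub>)"
    by (simp add: r1[OF one] r2[OF one] r1[OF assms(4)] r2[OF assms(4)])
qed

lemma same_level_one_open:
  "\<exists>F. finite F \<and> F \<subseteq> QQbar \<and> (\<forall>\<tau>\<in>carrier GalQ. (\<forall>x\<in>F. \<tau> x = x) \<longrightarrow> same_level m \<tau> \<one>\<^bsub>GalQ\<^esub>)"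
proof -
  define e where "e l = multiplicity l m" for l
  have "\<forall>l. \<exists>F. l \<in> prime_factors m \<longrightarrow> finite F \<and> F \<subseteq> QQbar \<and>
    (\<forall>\<tau>\<in>carrier GalQ. (\<forall>x\<in>F. \<tau> x = x) \<longrightarrow> level (e l) (\<rho>1 l \<tau>) = level (e l) (\<rho>1 l \<one>\<^bsub>GalQ\<^esub>))"
    using level_locally_constant[OF rho1] by (auto simp: in_prime_factors_iff)
  then obtain F1 where F1: "\<And>l. l \<in> prime_factors m \<Longrightarrow> finite (F1 l) \<and> F1 l \<subseteq> QQbar \<and>
    (\<forall>\<tau>\<in>carrier GalQ. (\<forall>x\<in>F1 l. \<tau> x = x) \<longrightarrow> level (e l) (\<rho>1 l \<tau>) = level (e l) (\<rho>1 l \<one>\<^bsub>GalQ\<^esub>))" by metis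
  have "\<forall>l. \<exists>F. l \<in> prime_factors m \<longrightarrow> finite F \<and> F \<subseteq> QQbar \<and>
    (\<forall>\<tau>\<in>carrier GalQ. (\<forall>x\<in>F. \<tau> x = x) \<longrightarrow> level (e l) (\<rho>2 l \<tau>) = level (e l) (\<rho>2 l \<one>\<^bsub>GalQ\<^esub>))"
    using level_locally_constant[OF rho2] by (auto simp: in_prime_factors_iff)
  then obtain F2 where F2: "\<And>l. l \<in> prime_factors m \<Longrightarrow> finite (F2 l) \<and> F2 l \<subseteq> QQbar \<and>
    (\<forall>\<tau>\<in>carrier GalQ. (\<forall>x\<in>F2 l. \<tau> x = x) \<longrightarrow> level (e l) (\<rho>2 l \<tau>) = level (e l) (\<rho>2 l \<one>\<^bsub>GalQ\<^esub>))" by metis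
  define F where "F = (\<Union>l\<in>prime_factors m. F1 l \<union> F2 l)"
  have "finite F" unfolding F_def using F1 F2 by (intro finite_UN_I finite_UnI) simp_all
  moreover have "F \<subseteq> QQbar" unfolding F_def using F1 F2 by (intro UN_least Un_least) simp_all
  moreover have "same_level m \<tau> \<one>\<^bsub>GalQ\<^esub>" if \<tau>: "\<tau> \<in> carrier GalQ" "\<forall>x\<in>F. \<tau> x = x" for \<tau>
    unfolding same_level_def
  proof
    fix l assume l: "l \<in> prime_factors m"
    have "\<forall>x\<in>F1 l. \<tau> x = x" "\<forall>x\<in>F2 l. \<tau> x = x" using \<tau>(2) l by (auto simp: F_def)
    thus "level (multiplicity l m) (\<rho>1 l \<tau>) = level (multiplicity l m) (\<rho>1 l \<one>\<^bsub>GalQ\<^esub>) \<and>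
      level (multiplicity l m) (\<rho>2 l \<tau>) = level (multiplicity l m) (\<rho>2 l \<one>\<^bsub>GalQ\<^esub>)"
      using F1[OF l] F2[OF l] \<tau>(1) by (simp add: e_def)
  qed
  ultimately show ?thesis by (intro exI[of _ F]) simp
qed

text \<open>A prime divides at most one of the coprime numbers \<open>m1\<close> and
  \<open>m2\<close>, so its inertia groups lie in the kernel for the other: this is the inertia
  condition of \<open>linearly_disjoint\<close>.\<close>

lemma pair_rep_independent:
  assumes m: "coprime m1 m2" "m1 > 0" "m2 > 0" and st: "\<sigma> \<in> carrier GalQ" "\<tau> \<in> carrier GalQ"
  shows "\<exists>g\<in>carrier GalQ. pair_rep m1 g = pair_rep m1 \<sigma> \<and> pair_rep m2 g = pair_rep m2 \<tau>"
proof -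
  obtain F where F: "finite F" "F \<subseteq> QQbar"
    "\<forall>\<tau>\<in>carrier GalQ. (\<forall>x\<in>F. \<tau> x = x) \<longrightarrow> same_level m1 \<tau> \<one>\<^bsub>GalQ\<^esub>"
    using same_level_one_open[of m1] by (elim exE conjE) (rule that)
  have "\<exists>g\<in>carrier GalQ. same_level m1 g \<sigma> \<and> same_level m2 g \<tau>"
  proof (rule linearly_disjoint[OF biinvariant_same_level biinvariant_same_level F(1,2) _ _ _ _ st])
    show "same_level m1 \<tau> \<one>\<^bsub>GalQ\<^esub>" if "\<tau> \<in> carrier GalQ" "\<And>x. x \<in> F \<Longrightarrow> \<tau> x = x" for \<tau>
      using F(3) that by simp
    show "finite (pair_rep m1 ` carrier GalQ)"
      by (rule finite_subset[of _ "(({0..<int m1} \<times> {0..<int m1}) \<times> ({0..<int m1} \<times> {0..<int m1})) \<times>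
        (({0..<int m1} \<times> {0..<int m1}) \<times> ({0..<int m1} \<times> {0..<int m1}))"])
         (use pair_rep_range[OF m(2)] in \<open>blast, simp\<close>)
    show "same_level m1 g h" if "g \<in> carrier GalQ" "h \<in> carrier GalQ" "pair_rep m1 g = pair_rep m1 h" for g h
      using pair_rep_eq_iff[OF m(2) that(1,2)] that(3) by simp
    show "(\<forall>\<sigma>\<in>inertia_group P. same_level m1 \<sigma> \<one>\<^bsub>GalQ\<^esub>) \<or> (\<forall>\<sigma>\<in>inertia_group P. same_level m2 \<sigma> \<one>\<^bsub>GalQ\<^esub>)"
      if p: "prime p" "P \<in> primes_above p" for p P
    proof -
      have "\<not> p dvd m1 \<or> \<not> p dvd m2"
        using m(1) p(1) by (metis coprime_common_divisor not_prime_unit)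
      thus ?thesis
      proof
        assume "\<not> p dvd m1"
        thus ?thesis by (intro disjI1 ballI same_level_one_if_inertia[OF p(1) _ p(2)])
      next
        assume "\<not> p dvd m2"
        thus ?thesis by (intro disjI2 ballI same_level_one_if_inertia[OF p(1) _ p(2)])
      qed
    qed
  qed
  then obtain g where g: "g \<in> carrier GalQ" "same_level m1 g \<sigma>" "same_level m2 g \<tau>" by blast
  thus ?thesis using pair_rep_eq_iff[OF m(2) g(1) st(1)] pair_rep_eq_iff[OF m(3) g(1) st(2)] by blast
qed

lemma image_pairs_eq: "image_pairs \<rho>1 \<rho>2 m = pair_rep m ` carrier GalQ"
  by (simp add: image_pairs_def pair_rep_def)

text \<open>Reduction modulo both factors is injective by the Chinese remainder theorem and onto the
  product of the images by \<open>pair_rep_independent\<close>. A trace vanishes modulo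
  \<open>m1 * m2\<close> exactly when it vanishes modulo both factors, so the traceless pairs
  correspond as well, and both cardinalities multiply.\<close>

lemma delta_mult:
  assumes m: "coprime m1 m2" "m1 > 1" "m2 > 1"
  shows "delta \<rho>1 \<rho>2 (m1 * m2) = delta \<rho>1 \<rho>2 m1 * delta \<rho>1 \<rho>2 m2"
proof -
  have pos: "m1 > 0" "m2 > 0" "m1 * m2 > 0" using m by auto
  define \<Phi> where "\<Phi> p = (map_prod (reduce_mat2 m1) (reduce_mat2 m1) p, map_prod (reduce_mat2 m2) (reduce_mat2 m2) p)"
    for p :: "int mat2 \<times> int mat2"
  let ?I = "image_pairs \<rho>1 \<rho>2" and ?T = "traceless_pairs \<rho>1 \<rho>2"
  have \<Phi>: "\<Phi> (pair_rep (m1 * m2) g) = (pair_rep m1 g, pair_rep m2 g)" if "g \<in> carrier GalQ" for g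
    using pair_rep_reduce[OF m(1) pos(1,2) that] pair_rep_reduce[of m2 m1 g] m(1) pos that
    by (simp add: \<Phi>_def coprime_commute mult.commute)
  have inj: "inj_on \<Phi> (?I (m1 * m2))"
  proof (rule inj_onI)
    fix p q assume p: "p \<in> ?I (m1 * m2)" and q: "q \<in> ?I (m1 * m2)" and eq: "\<Phi> p = \<Phi> q"
    have "p \<in> (({0..<int (m1 * m2)} \<times> {0..<int (m1 * m2)}) \<times> ({0..<int (m1 * m2)} \<times> {0..<int (m1 * m2)})) \<times>
        (({0..<int (m1 * m2)} \<times> {0..<int (m1 * m2)}) \<times> ({0..<int (m1 * m2)} \<times> {0..<int (m1 * m2)}))"
      using p pair_rep_range[OF pos(3)] unfolding image_pairs_eq by blast
    moreover have "q \<in> (({0..<int (m1 * m2)} \<times> {0..<int (m1 * m2)}) \<times> ({0..<int (m1 * m2)} \<times> {0..<int (m1 * m2)})) \<times>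
        (({0..<int (m1 * m2)} \<times> {0..<int (m1 * m2)}) \<times> ({0..<int (m1 * m2)} \<times> {0..<int (m1 * m2)}))"
      using q pair_rep_range[OF pos(3)] unfolding image_pairs_eq by blast
    ultimately have "fst p = fst q" "snd p = snd q"
      using eq by (auto simp: \<Phi>_def map_prod_def split_def mem_Times_iff intro!: reduce_mat2_inj[OF m(1)] simp del: of_nat_mult)
    thus "p = q" by (rule prod_eqI)
  qed
  have img: "\<Phi> ` ?I (m1 * m2) = ?I m1 \<times> ?I m2"
  proof
    show "\<Phi> ` ?I (m1 * m2) \<subseteq> ?I m1 \<times> ?I m2" using \<Phi> by (auto simp: image_pairs_eq)
    show "?I m1 \<times> ?I m2 \<subseteq> \<Phi> ` ?I (m1 * m2)"
    proof
      fix z assume "z \<in> ?I m1 \<times> ?I m2"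
      then obtain \<sigma> \<tau> where z: "\<sigma> \<in> carrier GalQ" "\<tau> \<in> carrier GalQ" "z = (pair_rep m1 \<sigma>, pair_rep m2 \<tau>)"
        unfolding image_pairs_eq by blast
      obtain g where g: "g \<in> carrier GalQ" "pair_rep m1 g = pair_rep m1 \<sigma>" "pair_rep m2 g = pair_rep m2 \<tau>"
        using pair_rep_independent[OF m(1) pos(1,2) z(1,2)] by blast
      have "z = \<Phi> (pair_rep (m1 * m2) g)" unfolding \<Phi>[OF g(1)] using z g by simp
      thus "z \<in> \<Phi> ` ?I (m1 * m2)" using g(1) unfolding image_pairs_eq by blast
    qed
  qed
  define tr where "tr k p \<longleftrightarrow> mat2_trace (residue_ring (int k)) (fst p) = 0 \<and> mat2_trace (residue_ring (int k)) (snd p) = 0"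
    for k and p :: "int mat2 \<times> int mat2"
  have T: "?T k = {p \<in> ?I k. tr k p}" for k by (auto simp: traceless_pairs_def tr_def)
  have zero: "t mod int (m1 * m2) = 0 \<longleftrightarrow> t mod int m1 = 0 \<and> t mod int m2 = 0" for t
  proof -
    have "int m1 * int m2 dvd t \<longleftrightarrow> int m1 dvd t \<and> int m2 dvd t"
      using m(1) by (auto intro: divides_mult dvd_mult_left dvd_mult_right)
    thus ?thesis by (simp add: dvd_eq_mod_eq_0)
  qed
  \<comment> \<open>Reducing the diagonal entries before adding them does not change the trace
    modulo \<open>m1\<close> or \<open>m2\<close>.\<close>
  have tr: "tr (m1 * m2) p \<longleftrightarrow> tr m1 (fst (\<Phi> p)) \<and> tr m2 (snd (\<Phi> p))" for p
    unfolding tr_def mat2_trace_residue_ring zero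
    by (auto simp: \<Phi>_def reduce_mat2_def mod_add_eq)
  have imgT: "\<Phi> ` ?T (m1 * m2) = ?T m1 \<times> ?T m2"
  proof -
    have "\<Phi> ` ?T (m1 * m2) = {z \<in> \<Phi> ` ?I (m1 * m2). tr m1 (fst z) \<and> tr m2 (snd z)}"
      unfolding T tr by blast
    thus ?thesis unfolding img T by auto
  qed
  have injT: "inj_on \<Phi> (?T (m1 * m2))" by (rule inj_on_subset[OF inj]) (simp add: T)
  have "card (?I (m1 * m2)) = card (?I m1) * card (?I m2)"
    using card_image[OF inj] by (simp add: img card_cartesian_product)
  moreover have "card (?T (m1 * m2)) = card (?T m1) * card (?T m2)"
    using card_image[OF injT] by (simp add: imgT card_cartesian_product)
  moreover have "m1 * m2 \<noteq> 1" "m1 \<noteq> 1" "m2 \<noteq> 1" using m by auto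
  ultimately show ?thesis by (simp add: delta_def)
qed

end

theorem proposition3p7:
  fixes f1 f2 :: "complex \<Rightarrow> complex"
    and k1 k2 :: nat
    and a1 a2 :: "nat \<Rightarrow> int"
    and \<rho>1 \<rho>2 :: "nat \<Rightarrow> (complex \<Rightarrow> complex) \<Rightarrow> (nat \<Rightarrow> int) mat2"
    and m m1 m2 :: nat
  assumes "normalized_eigenform k1 f1" and "normalized_eigenform k2 f2"
    and "\<And>n. fourier_coeff f1 n = of_int (a1 n)" and "\<And>n. fourier_coeff f2 n = of_int (a2 n)"
    and "\<And>l. prime l \<Longrightarrow> deligne_rep a1 k1 l (\<rho>1 l)"
    and "\<And>l. prime l \<Longrightarrow> deligne_rep a2 k2 l (\<rho>2 l)"
    and "m1 > 0" and "m2 > 0" and "coprime m1 m2" and "m = m1 * m2"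
  shows "delta \<rho>1 \<rho>2 m = delta \<rho>1 \<rho>2 m1 * delta \<rho>1 \<rho>2 m2"
proof (cases "m1 = 1 \<or> m2 = 1")
  case True
  thus ?thesis using assms(10) by (auto simp: delta_def)
next
  case False
  hence "m1 > 1" "m2 > 1" using assms(7,8) by auto
  thus ?thesis unfolding assms(10)
    by (intro delta_mult[of a1 k1 \<rho>1 a2 k2 \<rho>2 m1 m2] assms)
qed

end
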